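(* Let $(M^n, g, X, \rho)$ be a complete non-compact almost Yamabe soliton with $n \ge 3$, and let $R$ be the scalar curvature of $g$. If $0 \le \rho \le R$ and $\langle X, \nabla R\rangle \ge 0$ on $M$, and $R+|X| \in L^2(M)$, then $X$ is a Killing vector field.
   Context: An almost Yamabe soliton $(M^n,g,X,\rho)$ is a (smooth) Riemannian $n$-manifold $(M^n,g)$ together with a smooth vector field $X$ and a smooth function $\rho$ on $M$ such that $\frac12 \mathcal{L}_X g = (R-\rho)\, g$, where $\mathcal{L}$ is the Lie derivative and $R$ is the scalar curvature of $g$. $X$ is Killing if $\mathcal{L}_X g=0$, i.e. $R-\rho\equiv 0$. $\langle\cdot,\cdot\rangle=g$. *)

theory Defs
  imports "HOL-Analysis.Analysis"
begin

section \<open>Smooth maps between normed spaces\<close>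

text \<open>
  Derivatives are two-sided, so these notions are meant for open sets \<open>S\<close> in finite dimension.
\<close>

primrec Ck_on :: "nat \<Rightarrow> 'a::real_normed_vector set \<Rightarrow> ('a \<Rightarrow> 'b::real_normed_vector) \<Rightarrow> bool"
  where
    "Ck_on 0 S f \<longleftrightarrow> continuous_on S f"
  | "Ck_on (Suc k) S f \<longleftrightarrow>
       (\<forall>x\<in>S. f differentiable (at x)) \<and>
       (\<forall>v. Ck_on k S (\<lambda>x. frechet_derivative f (at x) v))"

definition smooth_on :: "'a::real_normed_vector set \<Rightarrow> ('a \<Rightarrow> 'b::real_normed_vector) \<Rightarrow> bool"
  where "smooth_on S f \<longleftrightarrow> (\<forall>k. Ck_on k S f)"

definition partial :: "'n::finite \<Rightarrow> (real^'n \<Rightarrow> real) \<Rightarrow> real^'n \<Rightarrow> real"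
  where "partial i f x = frechet_derivative f (at x) (axis i 1)"

section \<open>Smooth manifolds\<close>

text \<open>
  The manifold is the whole type \<open>'m\<close>, of class \<open>{t2_space, second_countable_topology}\<close>; its
  dimension is \<open>CARD('n)\<close>. It is not assumed to be connected. A chart is a pair \<open>(U, \<phi>)\<close>, and
  only the values of \<open>\<phi>\<close> on \<open>U\<close> matter. Atlases need not be maximal.
\<close>

type_synonym ('m, 'n) chart = "'m set \<times> ('m \<Rightarrow> real^'n)"

definition chart_image :: "('m, 'n::finite) chart \<Rightarrow> (real^'n) set"
  where "chart_image c = snd c ` fst c"

definition chart_inv :: "('m, 'n::finite) chart \<Rightarrow> real^'n \<Rightarrow> 'm"
  where "chart_inv c = inv_into (fst c) (snd c)"

definition overlap :: "('m, 'n::finite) chart \<Rightarrow> ('m, 'n) chart \<Rightarrow> (real^'n) set"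
  where "overlap c c' = snd c ` (fst c \<inter> fst c')"

definition transition :: "('m, 'n::finite) chart \<Rightarrow> ('m, 'n) chart \<Rightarrow> real^'n \<Rightarrow> real^'n"
  where "transition c c' = snd c' \<circ> chart_inv c"

definition smooth_atlas ::
    "('m::{t2_space,second_countable_topology}, 'n::finite) chart set \<Rightarrow> bool"
  where "smooth_atlas A \<longleftrightarrow>
    (\<Union>c\<in>A. fst c) = UNIV \<and>
    (\<forall>c\<in>A. open (fst c) \<and> open (chart_image c) \<and>
            homeomorphism (fst c) (chart_image c) (snd c) (chart_inv c)) \<and>
    (\<forall>c\<in>A. \<forall>c'\<in>A. smooth_on (overlap c c') (transition c c'))"

definition smooth_function :: "('m, 'n::finite) chart set \<Rightarrow> ('m \<Rightarrow> real) \<Rightarrow> bool"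
  where "smooth_function A f \<longleftrightarrow> (\<forall>c\<in>A. smooth_on (chart_image c) (f \<circ> chart_inv c))"

text \<open>
  A scalar defined by a coordinate formula that does not depend on the coordinates is evaluated in
  an arbitrary chart around the point.
\<close>

definition chart_at :: "('m, 'n::finite) chart set \<Rightarrow> 'm \<Rightarrow> ('m, 'n) chart"
  where "chart_at A p = (SOME c. c \<in> A \<and> p \<in> fst c)"

section \<open>Tensor fields\<close>

text \<open>
  A tensor field is given by its components in every chart, as functions of the coordinates
  \<open>x \<in> chart_image c\<close>, subject to the transformation law on overlaps. \<open>X c x $ i\<close> is the component
  \<open>X\<^sup>i\<close> of a vector field, and \<open>g c x $ i $ j\<close> is the component \<open>g\<^sub>i\<^sub>j\<close> of a covariant 2-tensor field.
\<close>

type_synonym ('m, 'n) vfield = "('m, 'n) chart \<Rightarrow> real^'n \<Rightarrow> real^'n"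
type_synonym ('m, 'n) tensor2 = "('m, 'n) chart \<Rightarrow> real^'n \<Rightarrow> real^'n^'n"

definition smooth_vector_field :: "('m, 'n::finite) chart set \<Rightarrow> ('m, 'n) vfield \<Rightarrow> bool"
  where "smooth_vector_field A X \<longleftrightarrow>
    (\<forall>c\<in>A. smooth_on (chart_image c) (X c)) \<and>
    (\<forall>c\<in>A. \<forall>c'\<in>A. \<forall>x\<in>overlap c c'.
       X c' (transition c c' x) = frechet_derivative (transition c c') (at x) (X c x))"

definition riemannian_metric :: "('m, 'n::finite) chart set \<Rightarrow> ('m, 'n) tensor2 \<Rightarrow> bool"
  where "riemannian_metric A g \<longleftrightarrow>
    (\<forall>c\<in>A. smooth_on (chart_image c) (g c)) \<and>
    (\<forall>c\<in>A. \<forall>x\<in>chart_image c.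
       transpose (g c x) = g c x \<and> (\<forall>v. v \<noteq> 0 \<longrightarrow> v \<bullet> (g c x *v v) > 0)) \<and>
    (\<forall>c\<in>A. \<forall>c'\<in>A. \<forall>x\<in>overlap c c'. \<forall>v w.
       v \<bullet> (g c x *v w) =
       frechet_derivative (transition c c') (at x) v \<bullet>
         (g c' (transition c c' x) *v frechet_derivative (transition c c') (at x) w))"

definition metric_inner ::
    "('m, 'n::finite) chart set \<Rightarrow> ('m, 'n) tensor2 \<Rightarrow> ('m, 'n) vfield \<Rightarrow> ('m, 'n) vfield \<Rightarrow> 'm \<Rightarrow> real"
  where "metric_inner A g X Y p =
    (let c = chart_at A p; x = snd c p in X c x \<bullet> (g c x *v Y c x))"

definition metric_norm ::
    "('m, 'n::finite) chart set \<Rightarrow> ('m, 'n) tensor2 \<Rightarrow> ('m, 'n) vfield \<Rightarrow> 'm \<Rightarrow> real"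
  where "metric_norm A g X p = sqrt (metric_inner A g X X p)"

definition gradient :: "('m, 'n::finite) tensor2 \<Rightarrow> ('m \<Rightarrow> real) \<Rightarrow> ('m, 'n) vfield"
  where "gradient g f c x = matrix_inv (g c x) *v (\<chi> i. partial i (f \<circ> chart_inv c) x)"

text \<open>
  \<open>(L\<^sub>X T)\<^sub>i\<^sub>j = X\<^sup>k \<partial>\<^sub>k T\<^sub>i\<^sub>j + T\<^sub>k\<^sub>j \<partial>\<^sub>i X\<^sup>k + T\<^sub>i\<^sub>k \<partial>\<^sub>j X\<^sup>k\<close>, summed over \<open>k\<close>.
\<close>

definition lie_derivative ::
    "('m, 'n::finite) vfield \<Rightarrow> ('m, 'n) tensor2 \<Rightarrow> ('m, 'n) tensor2"
  where "lie_derivative X T c x =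
    (\<chi> i j. \<Sum>k\<in>UNIV.
        X c x $ k * partial k (\<lambda>y. T c y $ i $ j) x
      + T c x $ k $ j * partial i (\<lambda>y. X c y $ k) x
      + T c x $ i $ k * partial j (\<lambda>y. X c y $ k) x)"

definition killing_field ::
    "('m, 'n::finite) chart set \<Rightarrow> ('m, 'n) tensor2 \<Rightarrow> ('m, 'n) vfield \<Rightarrow> bool"
  where "killing_field A g X \<longleftrightarrow> (\<forall>c\<in>A. \<forall>x\<in>chart_image c. lie_derivative X g c x = 0)"

section \<open>Curvature\<close>

text \<open>\<open>christoffel g c k i j\<close> is \<open>\<Gamma>\<^sup>k\<^sub>i\<^sub>j\<close>.\<close>

definition christoffel ::
    "('m, 'n::finite) tensor2 \<Rightarrow> ('m, 'n) chart \<Rightarrow> 'n \<Rightarrow> 'n \<Rightarrow> 'n \<Rightarrow> real^'n \<Rightarrow> real"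
  where "christoffel g c k i j x =
    (\<Sum>l\<in>UNIV. matrix_inv (g c x) $ k $ l *
      (partial i (\<lambda>y. g c y $ j $ l) x + partial j (\<lambda>y. g c y $ i $ l) x
       - partial l (\<lambda>y. g c y $ i $ j) x)) / 2"

text \<open>
  \<open>riemann g c l k i j\<close> is the \<open>l\<close>-th component of
  \<open>\<nabla>\<^sub>i \<nabla>\<^sub>j \<partial>\<^sub>k - \<nabla>\<^sub>j \<nabla>\<^sub>i \<partial>\<^sub>k\<close>; with the contraction below, round spheres have positive
  Ricci curvature.
\<close>

definition riemann ::
    "('m, 'n::finite) tensor2 \<Rightarrow> ('m, 'n) chart \<Rightarrow> 'n \<Rightarrow> 'n \<Rightarrow> 'n \<Rightarrow> 'n \<Rightarrow> real^'n \<Rightarrow> real"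
  where "riemann g c l k i j x =
    partial i (christoffel g c l j k) x - partial j (christoffel g c l i k) x
    + (\<Sum>m\<in>UNIV. christoffel g c l i m x * christoffel g c m j k x
               - christoffel g c l j m x * christoffel g c m i k x)"

definition ricci ::
    "('m, 'n::finite) tensor2 \<Rightarrow> ('m, 'n) chart \<Rightarrow> 'n \<Rightarrow> 'n \<Rightarrow> real^'n \<Rightarrow> real"
  where "ricci g c j k x = (\<Sum>i\<in>UNIV. riemann g c i k i j x)"

definition scalar_curvature ::
    "('m, 'n::finite) chart set \<Rightarrow> ('m, 'n) tensor2 \<Rightarrow> 'm \<Rightarrow> real"
  where "scalar_curvature A g p =
    (let c = chart_at A p; x = snd c p in
       \<Sum>j\<in>UNIV. \<Sum>k\<in>UNIV. matrix_inv (g c x) $ j $ k * ricci g c j k x)"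

section \<open>Riemannian distance and completeness\<close>

text \<open>
  As in \<^const>\<open>piecewise_C1_differentiable_on\<close>, the velocity may be unbounded near the finitely
  many exceptional times. This enlarges the class of curves but not the infimum of their lengths.
\<close>

definition piecewise_C1_curve ::
    "('m::topological_space, 'n::finite) chart set \<Rightarrow> (real \<Rightarrow> 'm) \<Rightarrow> bool"
  where "piecewise_C1_curve A \<gamma> \<longleftrightarrow> path \<gamma> \<and>
    (\<exists>S. finite S \<and>
      (\<forall>c\<in>A. (snd c \<circ> \<gamma>) C1_differentiable_on ({0<..<1} \<inter> \<gamma> -` fst c - S)))"

definition speed ::
    "('m, 'n::finite) chart set \<Rightarrow> ('m, 'n) tensor2 \<Rightarrow> (real \<Rightarrow> 'm) \<Rightarrow> real \<Rightarrow> real"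
  where "speed A g \<gamma> t =
    (let c = chart_at A (\<gamma> t); x = snd c (\<gamma> t); v = vector_derivative (snd c \<circ> \<gamma>) (at t)
     in sqrt (v \<bullet> (g c x *v v)))"

definition curve_length ::
    "('m, 'n::finite) chart set \<Rightarrow> ('m, 'n) tensor2 \<Rightarrow> (real \<Rightarrow> 'm) \<Rightarrow> ennreal"
  where "curve_length A g \<gamma> = (\<integral>\<^sup>+t\<in>{0..1}. ennreal (speed A g \<gamma> t) \<partial>lborel)"

text \<open>The distance between points in different components is \<open>\<infinity>\<close>.\<close>

definition riemannian_dist ::
    "('m::topological_space, 'n::finite) chart set \<Rightarrow> ('m, 'n) tensor2 \<Rightarrow> 'm \<Rightarrow> 'm \<Rightarrow> ennreal"
  where "riemannian_dist A g p q =
    Inf (curve_length A g ` {\<gamma>. piecewise_C1_curve A \<gamma> \<and> pathstart \<gamma> = p \<and> pathfinish \<gamma> = q})"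

definition riemannian_complete ::
    "('m::topological_space, 'n::finite) chart set \<Rightarrow> ('m, 'n) tensor2 \<Rightarrow> bool"
  where "riemannian_complete A g \<longleftrightarrow>
    (\<forall>s. (\<forall>e>0. \<exists>N. \<forall>m\<ge>N. \<forall>n\<ge>N. riemannian_dist A g (s m) (s n) < e) \<longrightarrow>
         (\<exists>p. (\<lambda>n::nat. riemannian_dist A g (s n) p) \<longlonglongrightarrow> 0))"

section \<open>Riemannian volume and square integrable functions\<close>

text \<open>
  The Riemannian volume is the unique Borel measure given by \<open>\<surd>(det g) dx\<close> in every chart.
\<close>

definition riemannian_volume ::
    "('m::topological_space, 'n::finite) chart set \<Rightarrow> ('m, 'n) tensor2 \<Rightarrow> 'm measure"
  where "riemannian_volume A g =
    (THE \<mu>. sets \<mu> = sets borel \<and>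
       (\<forall>c\<in>A. \<forall>E\<in>sets borel. E \<subseteq> fst c \<longrightarrow>
          emeasure \<mu> E = (\<integral>\<^sup>+x\<in>snd c ` E. ennreal (sqrt (det (g c x))) \<partial>lborel)))"

definition square_integrable :: "'m measure \<Rightarrow> ('m \<Rightarrow> real) \<Rightarrow> bool"
  where "square_integrable \<mu> f \<longleftrightarrow> f \<in> borel_measurable \<mu> \<and> integrable \<mu> (\<lambda>p. (f p)\<^sup>2)"

section \<open>Almost Yamabe solitons\<close>

definition almost_yamabe_soliton ::
    "('m::{t2_space,second_countable_topology}, 'n::finite) chart set \<Rightarrow> ('m, 'n) tensor2
      \<Rightarrow> ('m, 'n) vfield \<Rightarrow> ('m \<Rightarrow> real) \<Rightarrow> bool"
  where "almost_yamabe_soliton A g X \<rho> \<longleftrightarrow>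
    smooth_atlas A \<and> riemannian_metric A g \<and> smooth_vector_field A X \<and> smooth_function A \<rho> \<and>
    (\<forall>c\<in>A. \<forall>x\<in>chart_image c.
       (1/2) *\<^sub>R lie_derivative X g c x =
       (scalar_curvature A g (chart_inv c x) - \<rho> (chart_inv c x)) *\<^sub>R g c x)"

end

theory Submission
  imports Defs
begin

text \<open>
  Let \<open>\<sigma> = R - \<rho> \<ge> 0\<close>. The divergence of \<open>R X\<close> is \<open>n R \<sigma> + \<langle>X, \<nabla>R\<rangle> \<ge> 0\<close>, and \<open>R |X| \<le> (R + |X|)\<^sup>2\<close> is
  integrable. By completeness closed balls are compact, so the cutoffs \<open>f = max(0, 1 - d(p, \<cdot>)/k)\<close> have
  compact support; they are \<open>1/k\<close>-Lipschitz, whence \<open>\<integral> f div(R X) \<le> (\<integral> R |X| + 1)/k\<close>. Letting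
  \<open>k \<rightarrow> \<infinity>\<close> gives \<open>div(R X) = 0\<close>, so \<open>R \<sigma> = 0\<close>, and \<open>0 \<le> \<rho> \<le> R\<close> forces \<open>\<sigma> = 0\<close>.
  The curvature enters only through the soliton equation, which also shows that \<open>R\<close> is \<open>C\<^sup>1\<close> in every
  chart: \<open>\<sigma>\<close> is a quotient of components of \<open>\<L>\<^sub>X g\<close> and \<open>g\<close>.
\<close>

section \<open>Continuously differentiable maps and a weak derivative estimate\<close>

text \<open>All derivatives are put on C1 data instead: if \<eta> is a C1 function equal to 1 near
  the support of f, then f div(R X) and f div(\<eta> R X) agree, and \<eta> is split into pieces
  supported in single charts. In a chart, difference quotients are shifted onto f, which needs only
  a Lipschitz bound along constant vectors. The coordinate field is not constant; freezing it at a
  point makes it so, at the price of an error \<epsilon> per unit of volume. This price is paid on a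
  neighbourhood N of the support with finite volume, and \<epsilon> = 1/(vol N + 1) keeps the total
  at most 1: this is the summand 1 in the bound. The manifold may be disconnected, with infinite
  distances. The cutoffs are therefore centred at one point p and vanish off its component; each
  choice of p gives div(R X) = 0 at p.\<close>

abbreviation C1_on :: "'a::real_normed_vector set \<Rightarrow> ('a \<Rightarrow> 'b::real_normed_vector) \<Rightarrow> bool"
  where "C1_on \<equiv> Ck_on (Suc 0)"

lemma C1_on_iff:
  "C1_on S f \<longleftrightarrow> (\<forall>x\<in>S. f differentiable (at x)) \<and>
     (\<forall>v. continuous_on S (\<lambda>x. frechet_derivative f (at x) v))"
  by simp

declare Ck_on.simps [simp del]

text \<open>Two-sided derivatives are unique, so \<open>frechet_derivative\<close> may be replaced
  by any explicit \<open>f'\<close>. The closure rules below only have to exhibit a derivative and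
  check its continuity for each fixed direction.\<close>

lemma C1_onI:
  assumes d: "\<And>x. x \<in> S \<Longrightarrow> (f has_derivative f' x) (at x)"
    and c: "\<And>v. continuous_on S (\<lambda>x. f' x v)"
  shows "C1_on S f"
proof -
  have "frechet_derivative f (at x) = f' x" if "x \<in> S" for x
    using d[OF that] frechet_derivative_at by metis
  then have "continuous_on S (\<lambda>x. frechet_derivative f (at x) v)" for v
    using c[of v] by (simp cong: continuous_on_cong)
  then show ?thesis using d unfolding C1_on_iff by (auto simp: differentiable_def)
qed

lemma C1_on_has_derivative:
  "C1_on S f \<Longrightarrow> x \<in> S \<Longrightarrow> (f has_derivative frechet_derivative f (at x)) (at x)"
  by (simp add: C1_on_iff frechet_derivative_works)

lemma C1_on_continuous_derivative:
  "C1_on S f \<Longrightarrow> continuous_on S (\<lambda>x. frechet_derivative f (at x) v)"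
  by (simp add: C1_on_iff)

lemma C1_on_subset: "C1_on T f \<Longrightarrow> S \<subseteq> T \<Longrightarrow> C1_on S f"
  unfolding C1_on_iff by (auto intro: continuous_on_subset)

lemma C1_on_imp_continuous_on: "C1_on S f \<Longrightarrow> continuous_on S f"
  unfolding C1_on_iff by (auto intro!: continuous_at_imp_continuous_on dest: differentiable_imp_continuous_within)

lemma C1_on_cong:
  assumes "open S" and "C1_on S f" and eq: "\<And>x. x \<in> S \<Longrightarrow> f x = h x"
  shows "C1_on S h"
proof -
  note f' = C1_on_has_derivative[OF assms(2)] C1_on_continuous_derivative[OF assms(2)]
  show ?thesis
  proof (rule C1_onI[where f' = "\<lambda>x. frechet_derivative f (at x)"])
    show "(h has_derivative frechet_derivative f (at x)) (at x)" if "x \<in> S" for x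
      using has_derivative_transform_within_open[OF f'(1)[OF that] \<open>open S\<close> that] eq by auto
  qed (rule f')
qed

lemma C1_on_Un:
  assumes "open S" "open T" "C1_on S f" "C1_on T f"
  shows "C1_on (S \<union> T) f"
  using assms unfolding C1_on_iff by (auto intro!: continuous_on_open_Un)

lemma C1_on_const [simp, intro]: "C1_on S (\<lambda>x. c)"
  by (rule C1_onI[where f' = "\<lambda>_ _. 0"]) auto

lemma C1_on_bounded_linear:
  assumes "bounded_linear L" "C1_on S f"
  shows "C1_on S (\<lambda>x. L (f x))"
proof -
  note f' = C1_on_has_derivative[OF assms(2)] C1_on_continuous_derivative[OF assms(2)]
  show ?thesis
    by (rule C1_onI[where f' = "\<lambda>x v. L (frechet_derivative f (at x) v)"])
      (auto intro!: bounded_linear.has_derivative[OF assms(1)] f'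
        bounded_linear.continuous_on[OF assms(1)])
qed

lemma C1_on_ident: "C1_on S (\<lambda>x. x)"
  by (rule C1_onI[where f' = "\<lambda>_ v. v"]) auto

lemma C1_on_add:
  assumes "C1_on S f" "C1_on S h" shows "C1_on S (\<lambda>x. f x + h x)"
proof -
  note f' = C1_on_has_derivative[OF assms(1)] C1_on_continuous_derivative[OF assms(1)]
  note h' = C1_on_has_derivative[OF assms(2)] C1_on_continuous_derivative[OF assms(2)]
  show ?thesis
    by (rule C1_onI[where f' = "\<lambda>x v. frechet_derivative f (at x) v + frechet_derivative h (at x) v"])
      (auto intro!: has_derivative_add f' h' continuous_intros)
qed

lemma C1_on_mult:
  fixes f h :: "'a::real_normed_vector \<Rightarrow> real"
  assumes "C1_on S f" "C1_on S h" shows "C1_on S (\<lambda>x. f x * h x)"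
proof -
  note f' = C1_on_has_derivative[OF assms(1)] C1_on_continuous_derivative[OF assms(1)]
  note h' = C1_on_has_derivative[OF assms(2)] C1_on_continuous_derivative[OF assms(2)]
  show ?thesis
    by (rule C1_onI[where f' = "\<lambda>x v. f x * frechet_derivative h (at x) v + frechet_derivative f (at x) v * h x"])
      (auto intro!: has_derivative_mult f' h' continuous_intros
        C1_on_imp_continuous_on[OF assms(1)] C1_on_imp_continuous_on[OF assms(2)])
qed

lemma C1_on_diff:
  assumes "C1_on S f" "C1_on S h" shows "C1_on S (\<lambda>x. f x - h x)"
  using C1_on_add[OF assms(1) C1_on_bounded_linear[OF bounded_linear_minus[OF bounded_linear_ident] assms(2)]]
  by simp

lemma C1_on_sum:
  assumes "\<And>i. i \<in> I \<Longrightarrow> C1_on S (f i)" shows "C1_on S (\<lambda>x. \<Sum>i\<in>I. f i x)"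
  using assms by (induction I rule: infinite_finite_induct) (auto intro!: C1_on_add)

lemma C1_on_prod:
  fixes f :: "'i \<Rightarrow> 'a::real_normed_vector \<Rightarrow> real"
  assumes "\<And>i. i \<in> I \<Longrightarrow> C1_on S (f i)" shows "C1_on S (\<lambda>x. \<Prod>i\<in>I. f i x)"
  using assms by (induction I rule: infinite_finite_induct) (auto intro!: C1_on_mult)

text \<open>\<open>Ck_on\<close> asks for continuity of the derivative in the base point for fixed
  directions only, whereas the chain rule feeds the moving vector Df(x) v into Dh(f x). Expanding
  that vector in \<open>Basis\<close> leaves fixed directions with continuous coefficients.\<close>

lemma C1_on_compose:
  fixes f :: "'a::real_normed_vector \<Rightarrow> 'b::euclidean_space"
  assumes "C1_on S f" "C1_on T h" "f ` S \<subseteq> T" shows "C1_on S (\<lambda>x. h (f x))"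
proof -
  note f' = C1_on_has_derivative[OF assms(1)] C1_on_continuous_derivative[OF assms(1)]
  note h' = C1_on_has_derivative[OF assms(2)] C1_on_continuous_derivative[OF assms(2)]
  let ?f' = "\<lambda>x. frechet_derivative f (at x)"
  let ?h' = "\<lambda>x. frechet_derivative h (at x)"
  have lin: "linear (?h' y)" if "y \<in> T" for y
    using h'(1)[OF that] has_derivative_linear by blast
  have eq: "?h' (f x) (?f' x v) = (\<Sum>b\<in>Basis. (?f' x v \<bullet> b) *\<^sub>R ?h' (f x) b)" if "x \<in> S" for x v
  proof -
    have "?h' (f x) (\<Sum>b\<in>Basis. (?f' x v \<bullet> b) *\<^sub>R b) = (\<Sum>b\<in>Basis. (?f' x v \<bullet> b) *\<^sub>R ?h' (f x) b)"
      using lin[of "f x"] that assms(3) by (subst linear_sum) (auto simp: linear_cmul)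
    then show ?thesis by (simp add: euclidean_representation)
  qed
  show ?thesis
  proof (rule C1_onI[where f' = "\<lambda>x v. ?h' (f x) (?f' x v)"])
    show "((\<lambda>x. h (f x)) has_derivative (\<lambda>v. ?h' (f x) (?f' x v))) (at x)" if "x \<in> S" for x
      using has_derivative_compose[OF f'(1)[OF that] h'(1)] that assms(3) by auto
    show "continuous_on S (\<lambda>x. ?h' (f x) (?f' x v))" for v
    proof (subst continuous_on_cong[OF refl eq])
      have "continuous_on S (\<lambda>x. ?h' (f x) b)" for b
        by (rule continuous_on_compose2[OF h'(2) C1_on_imp_continuous_on[OF assms(1)] assms(3)])
      then show "continuous_on S (\<lambda>x. \<Sum>b\<in>Basis. (?f' x v \<bullet> b) *\<^sub>R ?h' (f x) b)"
        by (intro continuous_intros f'(2)) 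
    qed
  qed
qed

lemma C1_on_real_compose:
  fixes f :: "'a::real_normed_vector \<Rightarrow> real"
  assumes "C1_on S f" "f ` S \<subseteq> T"
    and "\<And>y. y \<in> T \<Longrightarrow> (h has_real_derivative h' y) (at y)" "continuous_on T h'"
  shows "C1_on S (\<lambda>x. h (f x))"
proof (rule C1_on_compose[OF assms(1) _ assms(2)])
  show "C1_on T h"
    by (rule C1_onI[where f' = "\<lambda>y v. h' y * v"])
      (use assms(3,4) in \<open>auto simp: has_field_derivative_def intro!: continuous_intros\<close>)
qed

lemma C1_on_inverse:
  fixes f :: "'a::real_normed_vector \<Rightarrow> real"
  assumes "C1_on S f" "\<And>x. x \<in> S \<Longrightarrow> f x \<noteq> 0"
  shows "C1_on S (\<lambda>x. inverse (f x))"
  by (rule C1_on_real_compose[OF assms(1), where T = "- {0}" and h' = "\<lambda>y. - (inverse y ^ Suc (Suc 0))"])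
    (use assms(2) in \<open>auto intro!: DERIV_inverse continuous_intros simp del: power_Suc\<close>)

lemma C1_on_divide:
  fixes f h :: "'a::real_normed_vector \<Rightarrow> real"
  assumes "C1_on S f" "C1_on S h" "\<And>x. x \<in> S \<Longrightarrow> h x \<noteq> 0"
  shows "C1_on S (\<lambda>x. f x / h x)"
  unfolding divide_inverse by (intro C1_on_mult C1_on_inverse assms)

lemma C1_on_sqrt:
  fixes f :: "'a::real_normed_vector \<Rightarrow> real"
  assumes "C1_on S f" "\<And>x. x \<in> S \<Longrightarrow> f x > 0"
  shows "C1_on S (\<lambda>x. sqrt (f x))"
  by (rule C1_on_real_compose[OF assms(1), where T = "{0<..}" and h' = "\<lambda>y. inverse (sqrt y) / 2"])
    (use assms(2) in \<open>auto intro!: DERIV_real_sqrt continuous_intros\<close>)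

lemma C1_on_vec_nth: "C1_on S f \<Longrightarrow> C1_on S (\<lambda>x. f x $ i)"
  by (rule C1_on_bounded_linear[OF bounded_linear_vec_nth])

lemma C1_on_det:
  fixes f :: "'a::real_normed_vector \<Rightarrow> real^'n^'n"
  assumes "C1_on S f" shows "C1_on S (\<lambda>x. det (f x))"
  unfolding det_def by (intro C1_on_sum C1_on_mult C1_on_const C1_on_prod C1_on_vec_nth assms)

lemma smooth_on_imp_C1_on: "smooth_on S f \<Longrightarrow> C1_on S f"
  unfolding smooth_on_def by blast

lemma smooth_on_imp_C1_on_derivative:
  assumes "smooth_on S f" shows "C1_on S (\<lambda>x. frechet_derivative f (at x) v)"
proof -
  have "Ck_on (Suc (Suc 0)) S f" using assms unfolding smooth_on_def by blast
  then show ?thesis by (subst (asm) Ck_on.simps) blast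
qed

section \<open>Coordinate partial derivatives and the derivative of the determinant\<close>

lemma partial_vec_nth:
  assumes "f differentiable (at x)"
  shows "partial k (\<lambda>y. f y $ i) x = frechet_derivative f (at x) (axis k 1) $ i"
proof -
  have "((\<lambda>y. f y $ i) has_derivative (\<lambda>v. frechet_derivative f (at x) v $ i)) (at x)"
    using assms by (intro bounded_linear.has_derivative[OF bounded_linear_vec_nth])
      (simp add: frechet_derivative_works)
  then show ?thesis unfolding partial_def using frechet_derivative_at by metis
qed

lemma partial_mat_nth:
  fixes f :: "real^'n \<Rightarrow> real^'m^'k"
  assumes "f differentiable (at x)"
  shows "partial k (\<lambda>y. f y $ i $ j) x = frechet_derivative f (at x) (axis k 1) $ i $ j"
proof -
  have "((\<lambda>y. f y $ i $ j) has_derivative (\<lambda>v. frechet_derivative f (at x) v $ i $ j)) (at x)"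
    using assms by (intro bounded_linear.has_derivative[OF bounded_linear_vec_nth])
      (simp add: frechet_derivative_works)
  then show ?thesis unfolding partial_def using frechet_derivative_at by metis
qed

lemma has_derivative_partial:
  fixes f :: "real^'n \<Rightarrow> real"
  assumes "f differentiable (at x)"
  shows "(f has_derivative (\<lambda>v. \<Sum>i\<in>UNIV. v $ i * partial i f x)) (at x)"
proof -
  let ?D = "frechet_derivative f (at x)"
  have D: "(f has_derivative ?D) (at x)" using assms by (simp add: frechet_derivative_works)
  then have lin: "linear ?D" by (rule has_derivative_linear)
  have "?D v = (\<Sum>i\<in>UNIV. v $ i * partial i f x)" for v
  proof -
    have "?D v = ?D (\<Sum>i\<in>UNIV. v $ i *\<^sub>R axis i 1)"
      by (simp add: basis_expansion[where 'a=real, unfolded scalar_mult_eq_scaleR])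
    also have "\<dots> = (\<Sum>i\<in>UNIV. v $ i * partial i f x)"
      by (simp add: linear_sum[OF lin] linear_cmul[OF lin] partial_def)
    finally show ?thesis .
  qed
  then show ?thesis using D by presburger
qed

lemma matrix_inv_inverse:
  fixes M :: "real^'n^'m"
  assumes "invertible M"
  shows "M ** matrix_inv M = mat 1" "matrix_inv M ** M = mat 1"
proof -
  have "\<exists>B. M ** B = mat 1 \<and> B ** M = mat 1" using assms unfolding invertible_def .
  from someI_ex[OF this] show "M ** matrix_inv M = mat 1" "matrix_inv M ** M = mat 1"
    unfolding matrix_inv_def by auto
qed

text \<open>In the Leibniz formula the term of \<open>p\<close> and \<open>i\<close> carries the
  product of the identity entries at \<open>j \<noteq> i\<close>. It vanishes unless
  \<open>p\<close> fixes all these \<open>j\<close>, and then \<open>p\<close> is the identity; what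
  remains is the diagonal.\<close>

lemma det_has_derivative_mat_1:
  "((det :: real^'n^'n \<Rightarrow> real) has_derivative trace) (at (mat 1))"
proof -
  let ?P = "{p. p permutes (UNIV :: 'n set)}"
  have fin: "finite ?P" by (simp add: finite_permutations)
  have *: "(det has_derivative (\<lambda>H. \<Sum>p\<in>?P. of_int (sign p) *
      (\<Sum>i\<in>UNIV. H $ i $ p i * (\<Prod>j\<in>UNIV - {i}. (mat 1 :: real^'n^'n) $ j $ p j)))) (at (mat 1))"
    unfolding det_def
    by (intro has_derivative_sum has_derivative_mult_right has_derivative_prod
        bounded_linear_imp_has_derivative bounded_linear_compose[OF bounded_linear_vec_nth]
        bounded_linear_vec_nth)
  have id: "p = id" if "p permutes UNIV" "\<And>j. j \<noteq> i \<Longrightarrow> p j = j" for p and i :: 'n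
  proof -
    have "p i = i"
      by (metis permutes_def iso_tuple_UNIV_I that)
    then show ?thesis using that(2) by fastforce
  qed
  have eq: "(\<Sum>p\<in>?P. of_int (sign p) *
      (\<Sum>i\<in>UNIV. H $ i $ p i * (\<Prod>j\<in>UNIV - {i}. (mat 1 :: real^'n^'n) $ j $ p j))) = trace H"
    for H :: "real^'n^'n"
  proof -
    have z: "(\<Sum>i\<in>UNIV. H $ i $ p i * (\<Prod>j\<in>UNIV - {i}. (mat 1 :: real^'n^'n) $ j $ p j)) = 0"
      if "p \<in> ?P - {id}" for p
    proof (intro sum.neutral ballI)
      fix i
      obtain j where "j \<noteq> i" "p j \<noteq> j" using id[of p i] \<open>p \<in> ?P - {id}\<close> by auto
      then have "(\<Prod>j\<in>UNIV - {i}. (mat 1 :: real^'n^'n) $ j $ p j) = 0"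
        by (intro prod_zero) (auto simp: mat_def intro!: bexI[of _ j])
      then show "H $ i $ p i * (\<Prod>j\<in>UNIV - {i}. (mat 1 :: real^'n^'n) $ j $ p j) = 0"
        by simp
    qed
    have "(\<Sum>p\<in>?P. of_int (sign p) *
      (\<Sum>i\<in>UNIV. H $ i $ p i * (\<Prod>j\<in>UNIV - {i}. (mat 1 :: real^'n^'n) $ j $ p j)))
      = (\<Sum>p\<in>{id}. of_int (sign p) *
      (\<Sum>i\<in>UNIV. H $ i $ p i * (\<Prod>j\<in>UNIV - {i}. (mat 1 :: real^'n^'n) $ j $ p j)))"
      using fin by (intro sum.mono_neutral_right ballI) (simp_all only: z mult_zero_right, auto simp: permutes_id)
    also have "\<dots> = trace H" by (simp add: trace_def mat_def)
    finally show ?thesis .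
  qed
  show ?thesis using * unfolding eq .
qed

text \<open>Jacobi's formula. Factoring \<open>det (f y)\<close> as \<open>det (f x)\<close> times
  the determinant of \<open>matrix_inv (f x) ** f y\<close> moves the point of differentiation to
  the identity matrix.\<close>

lemma det_has_derivative:
  fixes f :: "'a::real_normed_vector \<Rightarrow> real^'n^'n"
  assumes f: "(f has_derivative f') (at x)" and inv: "invertible (f x)"
  shows "((\<lambda>y. det (f y)) has_derivative (\<lambda>h. det (f x) * trace (matrix_inv (f x) ** f' h))) (at x)"
proof -
  let ?B = "matrix_inv (f x)"
  have B: "f x ** ?B = mat 1" "?B ** f x = mat 1"
    using matrix_inv_inverse[OF inv] by auto
  have bl: "bounded_linear (\<lambda>M. ?B ** M)"
    by (auto simp: linear_conv_bounded_linear[symmetric] linear_iff matrix_add_ldistrib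
        matrix_scalar_ac scalar_matrix_assoc matrix_matrix_mult_def vec_eq_iff sum.distrib algebra_simps sum_distrib_left)
  have "((\<lambda>y. ?B ** f y) has_derivative (\<lambda>h. ?B ** f' h)) (at x)"
    by (rule bounded_linear.has_derivative[OF bl f])
  then have "((\<lambda>y. det (?B ** f y)) has_derivative (\<lambda>h. trace (?B ** f' h))) (at x)"
    by (rule has_derivative_compose) (simp add: B det_has_derivative_mat_1)
  then have "((\<lambda>y. det (f x) * det (?B ** f y)) has_derivative
      (\<lambda>h. det (f x) * trace (?B ** f' h))) (at x)"
    by (rule has_derivative_mult_right)
  moreover have "det (f x) * det (?B ** f y) = det (f y)" for y
    by (simp add: det_mul[symmetric] matrix_mul_assoc B)
  ultimately show ?thesis by simp
qed


section \<open>Translations of Lebesgue integrals and weak derivatives\<close>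

lemma lborel_integral_translation:
  fixes f :: "'a::euclidean_space \<Rightarrow> real"
  assumes [measurable]: "f \<in> borel_measurable borel"
  shows "(\<integral>x. f (x + c) \<partial>lborel) = (\<integral>x. f x \<partial>lborel)"
proof -
  have "(\<integral>x. f x \<partial>lborel) = (\<integral>x. f x \<partial>(distr lborel borel ((+) c)))"
    by (simp add: lborel_distr_plus)
  also have "\<dots> = (\<integral>x. f (c + x) \<partial>lborel)" by (rule integral_distr) auto
  finally show ?thesis by (simp add: add.commute)
qed

lemma integrable_compact_support:
  fixes f :: "'a::euclidean_space \<Rightarrow> real"
  assumes "continuous_on UNIV f" "compact K" "\<And>x. x \<notin> K \<Longrightarrow> f x = 0"
  shows "integrable lborel f"
proof -
  have "(\<lambda>x. indicator K x *\<^sub>R f x) = f" using assms(3) by (auto simp: indicator_def fun_eq_iff)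
  then show ?thesis
    using borel_integrable_compact[OF assms(2) continuous_on_subset[OF assms(1)]] by simp
qed

lemma bounded_measurable_mult_integrable:
  fixes f h :: "'a::euclidean_space \<Rightarrow> real"
  assumes [measurable]: "f \<in> borel_measurable borel"
    and "\<And>x. \<bar>f x\<bar> \<le> B" and h: "integrable lborel h"
  shows "integrable lborel (\<lambda>x. f x * h x)"
proof (rule Bochner_Integration.integrable_bound[of _ "\<lambda>x. B * \<bar>h x\<bar>"])
  show "AE x in lborel. norm (f x * h x) \<le> norm (B * \<bar>h x\<bar>)"
  proof (rule AE_I2)
    fix x
    have "0 \<le> B" using assms(2)[of x] by linarith
    then show "norm (f x * h x) \<le> norm (B * \<bar>h x\<bar>)"
      using assms(2)[of x] by (simp add: abs_mult mult_right_mono)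
  qed
qed (use h in auto)

text \<open>The difference quotients of \<open>h\<close> are moved onto \<open>f\<close> by translation, so \<open>f\<close> only has to be
  Lipschitz in the direction \<open>v\<close>.\<close>

lemma weak_derivative_bound:
  fixes h f :: "'a::euclidean_space \<Rightarrow> real"
  assumes W: "open W" and K: "compact K" "K \<subseteq> W"
    and hK: "\<And>x. x \<notin> K \<Longrightarrow> h x = 0" and h: "C1_on UNIV h"
    and f[measurable]: "f \<in> borel_measurable borel" and B: "\<And>x. \<bar>f x\<bar> \<le> B"
    and lip: "\<And>x t. x \<in> W \<Longrightarrow> x + t *\<^sub>R v \<in> W \<Longrightarrow> \<bar>f (x + t *\<^sub>R v) - f x\<bar> \<le> M * \<bar>t\<bar>"
  shows "\<bar>\<integral>x. f x * frechet_derivative h (at x) v \<partial>lborel\<bar> \<le> M * (\<integral>x. \<bar>h x\<bar> \<partial>lborel)"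
    and "integrable lborel (\<lambda>x. f x * frechet_derivative h (at x) v)"
proof -
  define D where "D = (\<lambda>x. frechet_derivative h (at x) v)"
  have hder: "(h has_derivative frechet_derivative h (at x)) (at x)" for x
    using C1_on_has_derivative[OF h] by simp
  have Dcont: "continuous_on UNIV D" unfolding D_def by (rule C1_on_continuous_derivative[OF h])
  have hcont: "continuous_on UNIV h" by (rule C1_on_imp_continuous_on[OF h])
  have [measurable]: "h \<in> borel_measurable borel" "D \<in> borel_measurable borel"
    using Dcont hcont by (auto intro: borel_measurable_continuous_onI)
  have D0: "D x = 0" if "x \<notin> K" for x
  proof -
    have "((\<lambda>_. 0) has_derivative frechet_derivative h (at x)) (at x)"
      using has_derivative_transform_within_open[OF hder, of "- K" x "\<lambda>_. 0"] K(1) that hK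
      by (auto simp: compact_imp_closed open_Compl)
    then have "frechet_derivative h (at x) = (\<lambda>_. 0)"
      using has_derivative_unique has_derivative_const by blast
    then show ?thesis by (simp add: D_def)
  qed
  have "bounded (D ` K)"
    using K(1) Dcont by (meson compact_continuous_image compact_imp_bounded continuous_on_subset subset_UNIV)
  then obtain C where "C > 0" and C: "\<And>x. x \<in> K \<Longrightarrow> \<bar>D x\<bar> \<le> C"
    unfolding bounded_pos by auto
  then have C: "\<bar>D x\<bar> \<le> C" for x by (cases "x \<in> K") (auto simp: D0)
  have quot: "\<bar>h (x + t *\<^sub>R v) - h x\<bar> \<le> C * \<bar>t\<bar>" for x t
  proof -
    have "((\<lambda>s. h (x + s *\<^sub>R v)) has_field_derivative D (x + s *\<^sub>R v)) (at s within UNIV)" for s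
    proof -
      have "((\<lambda>s. x + s *\<^sub>R v) has_derivative (\<lambda>r. r *\<^sub>R v)) (at s)"
        by (auto intro!: derivative_eq_intros)
      from has_derivative_compose[OF this hder[of "x + s *\<^sub>R v"]]
      have "((\<lambda>s. h (x + s *\<^sub>R v)) has_derivative
        (\<lambda>r. frechet_derivative h (at (x + s *\<^sub>R v)) (r *\<^sub>R v))) (at s)" .
      moreover have "frechet_derivative h (at (x + s *\<^sub>R v)) (r *\<^sub>R v) = D (x + s *\<^sub>R v) * r" for r
        using linear_cmul[OF has_derivative_linear[OF hder[of "x + s *\<^sub>R v"]]] by (simp add: D_def)
      ultimately show ?thesis by (simp add: has_field_derivative_def)
    qed
    from field_differentiable_bound[OF convex_UNIV this, of C t 0] C show ?thesis by simp
  qed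
  \<comment> \<open>Room around \<open>K\<close>: translates of points of \<open>K\<close> by less
    than \<open>e\<close> stay in \<open>W\<close>, where \<open>f\<close> is known to be Lipschitz
    along \<open>v\<close>.\<close>
  obtain e where "e > 0" and e: "(\<Union>x\<in>K. ball x e) \<subseteq> W"
    using compact_subset_open_imp_ball_epsilon_subset[OF K(1) W K(2)] .
  \<comment> \<open>Step sizes tending to 0 with \<open>t n * norm v < e\<close>; the summand 1
    covers \<open>v = 0\<close>.\<close>
  define t where "t n = e / (norm v + 1) / real (Suc n)" for n
  have tpos: "t n > 0" for n using \<open>e > 0\<close> by (auto simp: t_def add_nonneg_pos)
  have tle: "t n * norm v < e" for n
  proof -
    have "t n * norm v \<le> e / (norm v + 1) * norm v"
      unfolding t_def using \<open>e > 0\<close>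
      by (intro mult_right_mono divide_left_mono[where b=1, simplified]) (auto simp: add_nonneg_pos divide_le_eq mult_left_le)
    also have "\<dots> < e" using \<open>e > 0\<close> by (simp add: divide_simps add_nonneg_pos)
    finally show ?thesis .
  qed
  have tlim: "t \<longlonglongrightarrow> 0" unfolding t_def by (rule LIMSEQ_Suc[OF lim_const_over_n])
  obtain R where R: "K \<subseteq> cball 0 R"
    using compact_imp_bounded[OF K(1)] unfolding bounded_iff by (force simp: subset_iff)
  define q where "q n x = f x * ((h (x + t n *\<^sub>R v) - h x) / t n)" for n x
  \<comment> \<open>Uniform domination: the quotients of \<open>h\<close> are at most
    \<open>C\<close> by the mean value inequality, and displacements shorter than \<open>e\<close>
    keep all supports in one ball.\<close>
  have dom: "\<bar>q n x\<bar> \<le> B * C * indicator (cball 0 (R + e)) x" for n x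
  proof (cases "x \<in> cball 0 (R + e)")
    case True
    have le: "\<bar>(h (x + t n *\<^sub>R v) - h x) / t n\<bar> \<le> C"
      using quot[of x "t n"] tpos[of n] by (simp add: divide_simps)
    have "0 \<le> B" using B[of x] by linarith
    then show ?thesis
      using True mult_mono[OF B[of x] le]
      unfolding q_def abs_mult by (simp del: abs_divide abs_ge_zero)
  next
    case False
    then have "x \<notin> K" using R \<open>e > 0\<close> by auto
    moreover have "x + t n *\<^sub>R v \<notin> K"
    proof
      assume "x + t n *\<^sub>R v \<in> K"
      then have "norm (x + t n *\<^sub>R v) \<le> R" using R by auto
      then have "norm x \<le> R + norm (t n *\<^sub>R v)" using norm_triangle_sub[of x "x + t n *\<^sub>R v"] by simp
      then show False using False tle[of n] tpos[of n] by auto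
    qed
    ultimately show ?thesis using False hK by (simp add: q_def)
  qed
  have lim: "(\<lambda>n. \<integral>x. q n x \<partial>lborel) \<longlonglongrightarrow> (\<integral>x. f x * D x \<partial>lborel)"
  proof (rule integral_dominated_convergence[where w = "\<lambda>x. B * C * indicator (cball 0 (R + e)) x"])
    show "integrable lborel (\<lambda>x. B * C * indicator (cball 0 (R + e)) x :: real)"
      by (intro integrable_mult_right integrable_real_indicator)
        (use emeasure_bounded_finite[OF bounded_cball, of 0 "R + e"] in auto)
    show "AE x in lborel. (\<lambda>n. q n x) \<longlonglongrightarrow> f x * D x"
    proof (rule AE_I2)
      fix x
      have "((\<lambda>s. x + s *\<^sub>R v) has_derivative (\<lambda>r. r *\<^sub>R v)) (at 0)"
        by (auto intro!: derivative_eq_intros)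
      from has_derivative_compose[OF this, of h "frechet_derivative h (at x)"] hder[of x]
      have "((\<lambda>s. h (x + s *\<^sub>R v)) has_derivative
        (\<lambda>r. frechet_derivative h (at x) (r *\<^sub>R v))) (at 0)" by simp
      moreover have "frechet_derivative h (at x) (r *\<^sub>R v) = D x * r" for r
        using linear_cmul[OF has_derivative_linear[OF hder[of x]]] by (simp add: D_def)
      ultimately have "((\<lambda>s. h (x + s *\<^sub>R v)) has_field_derivative D x) (at 0)"
        by (simp add: has_field_derivative_def)
      then have "((\<lambda>s. (h (x + s *\<^sub>R v) - h x) / s) \<longlongrightarrow> D x) (at 0)"
        by (simp add: DERIV_def)
      moreover have "filterlim t (at 0) sequentially"
        using tlim tpos by (intro filterlim_atI) (auto simp: less_le)
      ultimately have "(\<lambda>n. (h (x + t n *\<^sub>R v) - h x) / t n) \<longlonglongrightarrow> D x"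
        by (rule filterlim_compose)
      then show "(\<lambda>n. q n x) \<longlonglongrightarrow> f x * D x" unfolding q_def by (intro tendsto_intros)
    qed
    show "AE x in lborel. norm (q n x) \<le> B * C * indicator (cball 0 (R + e)) x" for n
      using dom by simp
  qed (unfold q_def, measurable)
  have hint: "integrable lborel h" by (rule integrable_compact_support[OF hcont K(1) hK])
  have bnd: "\<bar>\<integral>x. q n x \<partial>lborel\<bar> \<le> M * (\<integral>x. \<bar>h x\<bar> \<partial>lborel)" for n
  proof -
    define s where "s = t n"
    have s: "s > 0" "s * norm v < e" using tpos tle by (auto simp: s_def)
    have [measurable]: "(\<lambda>x. h (x + s *\<^sub>R v)) \<in> borel_measurable borel"
      by measurable
    have fs[measurable]: "(\<lambda>x. f (x - s *\<^sub>R v)) \<in> borel_measurable borel" by measurable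
    have hsint: "integrable lborel (\<lambda>x. h (x + s *\<^sub>R v))"
    proof (rule integrable_compact_support)
      show "compact ((\<lambda>x. x - s *\<^sub>R v) ` K)" using K(1) by (simp add: compact_translation_subtract)
      show "h (x + s *\<^sub>R v) = 0" if "x \<notin> (\<lambda>x. x - s *\<^sub>R v) ` K" for x
        using that by (intro hK) (auto simp: image_iff)
      show "continuous_on UNIV (\<lambda>x. h (x + s *\<^sub>R v))"
        by (intro continuous_intros continuous_on_compose2[OF hcont]) auto
    qed
    note i1 = bounded_measurable_mult_integrable[OF f B hint]
    note i2 = bounded_measurable_mult_integrable[OF f B hsint]
    note i3 = bounded_measurable_mult_integrable[of "\<lambda>x. f (x - s *\<^sub>R v)", OF fs B hint]
    have "(\<integral>x. f x * h (x + s *\<^sub>R v) \<partial>lborel)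
      = (\<integral>x. f ((x + s *\<^sub>R v) - s *\<^sub>R v) * h (x + s *\<^sub>R v) \<partial>lborel)" by simp
    also have "\<dots> = (\<integral>x. f (x - s *\<^sub>R v) * h x \<partial>lborel)"
      by (rule lborel_integral_translation) measurable
    finally have tr: "(\<integral>x. f x * h (x + s *\<^sub>R v) \<partial>lborel) = (\<integral>x. f (x - s *\<^sub>R v) * h x \<partial>lborel)" .
    have "(\<integral>x. q n x \<partial>lborel) = (\<integral>x. (f x * h (x + s *\<^sub>R v) - f x * h x) / s \<partial>lborel)"
      unfolding q_def s_def by (simp add: algebra_simps)
    also have "\<dots> = ((\<integral>x. f (x - s *\<^sub>R v) * h x \<partial>lborel) - (\<integral>x. f x * h x \<partial>lborel)) / s"
      using i1 i2 tr by simp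
    also have "\<dots> = (\<integral>x. (f (x - s *\<^sub>R v) * h x - f x * h x) / s \<partial>lborel)"
      using i1 i3 by simp
    finally have eq: "(\<integral>x. q n x \<partial>lborel) = (\<integral>x. (f (x - s *\<^sub>R v) * h x - f x * h x) / s \<partial>lborel)" .
    have "\<bar>(f (x - s *\<^sub>R v) * h x - f x * h x) / s\<bar> \<le> M * \<bar>h x\<bar>" for x
    proof (cases "x \<in> K")
      case True
      have "x - s *\<^sub>R v \<in> ball x e" using s by (auto simp: dist_norm)
      then have "x - s *\<^sub>R v \<in> W" using e True by blast
      then have "x + (- s) *\<^sub>R v \<in> W" "x \<in> W" using True K(2) by auto
      from lip[OF this(2,1)] s have "\<bar>f (x - s *\<^sub>R v) - f x\<bar> \<le> M * s" by simp
      then have "\<bar>f (x - s *\<^sub>R v) - f x\<bar> / s * \<bar>h x\<bar> \<le> M * \<bar>h x\<bar>"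
        using s by (intro mult_right_mono) (auto simp: divide_simps)
      then show ?thesis using s by (simp add: left_diff_distrib[symmetric] abs_mult)
    qed (simp add: hK)
    then have "norm (\<integral>x. q n x \<partial>lborel) \<le> (\<integral>x. M * \<bar>h x\<bar> \<partial>lborel)"
      unfolding eq using i1 i3 hint by (intro Bochner_Integration.integral_norm_bound_integral) auto
    then show ?thesis by simp
  qed
  show "\<bar>\<integral>x. f x * frechet_derivative h (at x) v \<partial>lborel\<bar> \<le> M * (\<integral>x. \<bar>h x\<bar> \<partial>lborel)"
    using tendsto_le[OF _ tendsto_const tendsto_rabs[OF lim]] bnd by (simp add: D_def)
  have "integrable lborel D" by (rule integrable_compact_support[OF Dcont K(1) D0])
  then show "integrable lborel (\<lambda>x. f x * frechet_derivative h (at x) v)"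
    using bounded_measurable_mult_integrable[OF f B] by (simp add: D_def)
qed

section \<open>Metrics in charts\<close>

text \<open>The open sets \<open>\<Omega>\<close> and \<open>- K\<close> cover the space, and
  \<open>h\<close> is zero on the second.\<close>

lemma C1_on_extend_zero:
  assumes "open \<Omega>" "C1_on \<Omega> h" "compact K" "K \<subseteq> \<Omega>" "\<And>x. x \<notin> K \<Longrightarrow> h x = 0"
  shows "C1_on UNIV h"
proof -
  have o: "open (- K)" using assms(3) by (simp add: compact_imp_closed open_Compl)
  then have "C1_on (- K) h" by (rule C1_on_cong[OF _ C1_on_const[of _ 0]]) (use assms(5) in auto)
  from C1_on_Un[OF assms(1) o assms(2) this] show ?thesis
    by (rule C1_on_subset) (use assms(4) in blast)
qed

text \<open>Near \<open>q\<close> the field is a constant vector plus a small remainder, so directional estimates for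
  finitely many constant directions give the sharp constant up to \<open>\<epsilon>\<close>.\<close>

lemma frozen_divergence_bound:
  fixes V :: "real^'n \<Rightarrow> real^'n" and N :: "real^'n \<Rightarrow> real^'n \<Rightarrow> real" and s :: "real^'n \<Rightarrow> real"
  assumes \<Omega>: "open \<Omega>" "q \<in> \<Omega>" and V: "C1_on \<Omega> V"
    and N: "\<And>v. continuous_on \<Omega> (\<lambda>x. N x v)" "continuous_on \<Omega> (\<lambda>x. N x (V x))"
      "\<And>x v. x \<in> \<Omega> \<Longrightarrow> 0 \<le> N x v"
    and s: "continuous_on \<Omega> s" "\<And>x. x \<in> \<Omega> \<Longrightarrow> s x > 0" and \<epsilon>: "\<epsilon> > 0"
  obtains r where "r > 0" "ball q r \<subseteq> \<Omega>"
    and "\<And>K \<eta> f B L. \<lbrakk>compact K; K \<subseteq> ball q r; C1_on UNIV \<eta>; \<And>x. \<eta> x \<ge> 0; \<And>x. x \<notin> K \<Longrightarrow> \<eta> x = 0;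
      f \<in> borel_measurable borel; \<And>x. \<bar>f x\<bar> \<le> B; L \<ge> 0;
      \<And>v G x t. (\<forall>z\<in>ball q r. N z v \<le> G) \<Longrightarrow> x \<in> ball q r \<Longrightarrow> x + t *\<^sub>R v \<in> ball q r
         \<Longrightarrow> \<bar>f (x + t *\<^sub>R v) - f x\<bar> \<le> L * G * \<bar>t\<bar>\<rbrakk> \<Longrightarrow>
      integrable lborel (\<lambda>x. \<eta> x * (N x (V x) + \<epsilon> * s x)) \<and>
      integrable lborel (\<lambda>x. f x * (\<Sum>i\<in>UNIV. frechet_derivative (\<lambda>y. \<eta> y * V y $ i) (at x) (axis i 1))) \<and>
      \<bar>\<integral>x. f x * (\<Sum>i\<in>UNIV. frechet_derivative (\<lambda>y. \<eta> y * V y $ i) (at x) (axis i 1)) \<partial>lborel\<bar>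
        \<le> L * (\<integral>x. \<eta> x * (N x (V x) + \<epsilon> * s x) \<partial>lborel)"
proof -
  define w where "w = V q"
  \<comment> \<open>Near \<open>q\<close> the weight \<open>s\<close> is at least \<open>m\<close>.
    Three errors of \<open>\<epsilon> * m / 3\<close> occur below: in \<open>N x w\<close> against
    \<open>N q w\<close>, in \<open>N q w\<close> against \<open>N x (V x)\<close>, and in the
    remainder \<open>V - w\<close>. Together they cost at most
    \<open>\<epsilon> * s x\<close>.\<close>
  define m where "m = s q / 2"
  have m: "m > 0" using s(2)[OF \<Omega>(2)] by (simp add: m_def)
  \<comment> \<open>A crude bound of \<open>N\<close> in the coordinate directions near
    \<open>q\<close>. The slack 1 is harmless because \<open>G i\<close> is always multiplied by
    \<open>V x $ i - w $ i\<close>, which is small.\<close>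
  define G where "G i = N q (axis i 1) + 1" for i
  have em: "\<epsilon> * m > 0" using \<epsilon> m by simp
  have Vc: "continuous_on \<Omega> V" by (rule C1_on_imp_continuous_on[OF V])
  have ev: "\<forall>\<^sub>F x in at q. x \<in> \<Omega>" using \<Omega> by (simp add: eventually_at_topological) blast
  have cont: "isCont F q" if "continuous_on \<Omega> F" for F :: "real^'n \<Rightarrow> real"
    using that \<Omega> by (simp add: continuous_on_eq_continuous_at)
  have near: "\<exists>r>0. \<forall>x\<in>ball q r. F x < (0::real)" if "continuous_on \<Omega> F" "F q < 0" for F
  proof -
    have "\<forall>\<^sub>F x in at q. F x < 0"
      using cont[OF that(1)] that(2) unfolding isCont_def by (rule order_tendstoD)
    then obtain r where "r > 0" "\<forall>x. x \<noteq> q \<and> dist x q < r \<longrightarrow> F x < 0"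
      unfolding eventually_at by auto
    then have "F x < 0" if "x \<in> ball q r" for x
      using that \<open>F q < 0\<close> by (cases "x = q") (auto simp: dist_commute)
    then show ?thesis using \<open>r > 0\<close> by blast
  qed
  have "\<forall>i. \<exists>r>0. \<forall>x\<in>ball q r. N x (axis i 1) - G i < 0"
    by (intro allI near continuous_intros N) (simp add: G_def)
  then obtain r1 where r1: "\<And>i. r1 i > 0" "\<And>i x. x \<in> ball q (r1 i) \<Longrightarrow> N x (axis i 1) - G i < 0"
    by metis
  have "\<exists>r>0. \<forall>x\<in>ball q r. N x w - (N q w + \<epsilon> * m / 3) < 0"
    by (intro near continuous_intros N) (use em in simp)
  then obtain r2 where r2: "r2 > 0" "\<And>x. x \<in> ball q r2 \<Longrightarrow> N x w - (N q w + \<epsilon> * m / 3) < 0" by metis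
  have "\<exists>r>0. \<forall>x\<in>ball q r. N q w - (N x (V x) + \<epsilon> * m / 3) < 0"
    by (intro near continuous_intros N) (use em in \<open>simp add: w_def\<close>)
  then obtain r3 where r3: "r3 > 0" "\<And>x. x \<in> ball q r3 \<Longrightarrow> N q w - (N x (V x) + \<epsilon> * m / 3) < 0" by metis
  have "\<exists>r>0. \<forall>x\<in>ball q r. (\<Sum>i\<in>UNIV. G i * \<bar>V x $ i - w $ i\<bar>) - \<epsilon> * m / 3 < 0"
    by (intro near continuous_intros Vc) (use em in \<open>simp add: w_def\<close>)
  then obtain r4 where r4: "r4 > 0" "\<And>x. x \<in> ball q r4 \<Longrightarrow> (\<Sum>i\<in>UNIV. G i * \<bar>V x $ i - w $ i\<bar>) - \<epsilon> * m / 3 < 0"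
    by metis
  have "\<exists>r>0. \<forall>x\<in>ball q r. m - s x < 0"
    by (intro near continuous_intros s) (use m in \<open>simp add: m_def\<close>)
  then obtain r5 where r5: "r5 > 0" "\<And>x. x \<in> ball q r5 \<Longrightarrow> m - s x < 0" by metis
  obtain r6 where r6: "r6 > 0" "ball q r6 \<subseteq> \<Omega>" using \<Omega> openE by blast
  define r where "r = Min (insert r2 (insert r3 (insert r4 (insert r5 (insert r6 (range r1))))))"
  have r: "r > 0" unfolding r_def using r1 r2 r3 r4 r5 r6 by (subst Min_gr_iff) auto
  have rle: "r \<le> r2" "r \<le> r3" "r \<le> r4" "r \<le> r5" "r \<le> r6" "\<And>i. r \<le> r1 i"
    unfolding r_def by (rule Min_le; simp)+
  define W where "W = ball q r"
  have W: "open W" "q \<in> W" "W \<subseteq> \<Omega>" using r rle(5) r6 by (auto simp: W_def)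
  have W1: "N x (axis i 1) \<le> G i" and W2: "N x w \<le> N q w + \<epsilon> * m / 3"
    and W3: "N q w \<le> N x (V x) + \<epsilon> * m / 3" and W4: "(\<Sum>i\<in>UNIV. G i * \<bar>V x $ i - w $ i\<bar>) \<le> \<epsilon> * m / 3"
    and W5: "m \<le> s x" if "x \<in> W" for x i
  proof -
    have "dist q x < r" using that by (simp add: W_def)
    then have "x \<in> ball q (r1 i)" "x \<in> ball q r2" "x \<in> ball q r3" "x \<in> ball q r4" "x \<in> ball q r5"
      using rle(1-5) rle(6)[of i] by auto
    then show "N x (axis i 1) \<le> G i" "N x w \<le> N q w + \<epsilon> * m / 3"
      "N q w \<le> N x (V x) + \<epsilon> * m / 3" "(\<Sum>i\<in>UNIV. G i * \<bar>V x $ i - w $ i\<bar>) \<le> \<epsilon> * m / 3" "m \<le> s x"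
      using r1(2)[of x i] r2(2)[of x] r3(2)[of x] r4(2)[of x] r5(2)[of x] by simp_all
  qed
  have "integrable lborel (\<lambda>x. \<eta> x * (N x (V x) + \<epsilon> * s x)) \<and>
      integrable lborel (\<lambda>x. f x * (\<Sum>i\<in>UNIV. frechet_derivative (\<lambda>y. \<eta> y * V y $ i) (at x) (axis i 1))) \<and>
      \<bar>\<integral>x. f x * (\<Sum>i\<in>UNIV. frechet_derivative (\<lambda>y. \<eta> y * V y $ i) (at x) (axis i 1)) \<partial>lborel\<bar>
        \<le> L * (\<integral>x. \<eta> x * (N x (V x) + \<epsilon> * s x) \<partial>lborel)"
    if K: "compact K" "K \<subseteq> W" and \<eta>: "C1_on UNIV \<eta>" and \<eta>0: "\<And>x. \<eta> x \<ge> 0"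
      and \<eta>K: "\<And>x. x \<notin> K \<Longrightarrow> \<eta> x = 0"
      and f: "f \<in> borel_measurable borel" and B: "\<And>x. \<bar>f x\<bar> \<le> B" and L: "L \<ge> 0"
      and lip: "\<And>v G x t. (\<forall>z\<in>W. N z v \<le> G) \<Longrightarrow> x \<in> W \<Longrightarrow> x + t *\<^sub>R v \<in> W
         \<Longrightarrow> \<bar>f (x + t *\<^sub>R v) - f x\<bar> \<le> L * G * \<bar>t\<bar>"
    for K \<eta> f B L
  proof -
    define h where "h i x = \<eta> x * (V x $ i - w $ i)" for i x
    have K\<Omega>: "K \<subseteq> \<Omega>" using K W by blast
    have hC: "C1_on UNIV (h i)" for i
    proof (rule C1_on_extend_zero[OF \<Omega>(1) _ K(1) K\<Omega>])
      show "C1_on \<Omega> (h i)" unfolding h_def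
        by (intro C1_on_mult C1_on_diff C1_on_const C1_on_vec_nth V C1_on_subset[OF \<eta>]) auto
    qed (simp add: h_def \<eta>K)
    have hK: "h i x = 0" if "x \<notin> K" for i x using that by (simp add: h_def \<eta>K)
    have eq: "(\<Sum>i\<in>UNIV. frechet_derivative (\<lambda>y. \<eta> y * V y $ i) (at x) (axis i 1))
      = frechet_derivative \<eta> (at x) w + (\<Sum>i\<in>UNIV. frechet_derivative (h i) (at x) (axis i 1))" for x
    proof -
      have "frechet_derivative (\<lambda>y. \<eta> y * V y $ i) (at x) v
        = frechet_derivative \<eta> (at x) v * w $ i + frechet_derivative (h i) (at x) v" for i v
      proof -
        have 1: "(\<lambda>y. \<eta> y * V y $ i) = (\<lambda>y. \<eta> y * w $ i + h i y)"
          by (auto simp: h_def algebra_simps)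
        have 2: "((\<lambda>y. \<eta> y * w $ i + h i y) has_derivative
           (\<lambda>v. frechet_derivative \<eta> (at x) v * w $ i + frechet_derivative (h i) (at x) v)) (at x)"
          by (intro has_derivative_add has_derivative_mult_left C1_on_has_derivative[OF \<eta>]
              C1_on_has_derivative[OF hC] UNIV_I)
        show ?thesis unfolding 1 by (rule fun_cong[OF frechet_derivative_at[OF 2, symmetric]])
      qed
      moreover have "(\<Sum>i\<in>UNIV. frechet_derivative \<eta> (at x) (axis i 1) * w $ i) = frechet_derivative \<eta> (at x) w"
      proof -
        have "(\<eta> has_derivative (\<lambda>v. \<Sum>i\<in>UNIV. v $ i * partial i \<eta> x)) (at x)"
          using \<eta> by (intro has_derivative_partial) (simp add: C1_on_iff)
        then have "frechet_derivative \<eta> (at x) = (\<lambda>v. \<Sum>i\<in>UNIV. v $ i * partial i \<eta> x)"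
          by (rule frechet_derivative_at[symmetric])
        from fun_cong[OF this, of w] show ?thesis by (simp add: partial_def mult.commute)
      qed
      ultimately show ?thesis by (simp add: sum.distrib)
    qed
    have lip1: "\<bar>f (x + t *\<^sub>R w) - f x\<bar> \<le> (L * (N q w + \<epsilon> * m / 3)) * \<bar>t\<bar>"
      if "x \<in> W" "x + t *\<^sub>R w \<in> W" for x t
      using lip[of w "N q w + \<epsilon> * m / 3", OF _ that] W2 by auto
    note b1 = weak_derivative_bound[OF W(1) K \<eta>K \<eta> f B lip1]
    have lip2: "\<bar>f (x + t *\<^sub>R axis i 1) - f x\<bar> \<le> (L * G i) * \<bar>t\<bar>"
      if "x \<in> W" "x + t *\<^sub>R axis i 1 \<in> W" for x t i
      using lip[of "axis i 1" "G i", OF _ that] W1 by auto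
    note b2 = weak_derivative_bound[OF W(1) K hK hC f B lip2]
    have \<eta>i: "integrable lborel \<eta>"
      by (rule integrable_compact_support[OF C1_on_imp_continuous_on[OF \<eta>] K(1) \<eta>K])
    have hi: "integrable lborel (\<lambda>x. \<bar>h i x\<bar>)" for i
      using integrable_compact_support[OF C1_on_imp_continuous_on[OF hC] K(1) hK] by simp
    have int: "integrable lborel (\<lambda>x. \<eta> x * (N x (V x) + \<epsilon> * s x))"
    proof -
      have "integrable lborel (\<lambda>x. indicator K x *\<^sub>R (\<eta> x * (N x (V x) + \<epsilon> * s x)))"
        by (intro borel_integrable_compact K continuous_intros continuous_on_subset[OF N(2) K\<Omega>]
            continuous_on_subset[OF s(1) K\<Omega>] continuous_on_subset[OF C1_on_imp_continuous_on[OF \<eta>]]) auto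
      moreover have "(\<lambda>x. indicator K x *\<^sub>R (\<eta> x * (N x (V x) + \<epsilon> * s x)))
        = (\<lambda>x. \<eta> x * (N x (V x) + \<epsilon> * s x))"
        by (auto simp: indicator_def \<eta>K fun_eq_iff)
      ultimately show ?thesis by argo
    qed
    have Gi: "G i \<ge> 0" for i using N(3)[OF \<Omega>(2)] by (simp add: G_def add_nonneg_nonneg)
    have int2: "integrable lborel (\<lambda>x. f x * (\<Sum>i\<in>UNIV. frechet_derivative (\<lambda>y. \<eta> y * V y $ i) (at x) (axis i 1)))"
      unfolding eq distrib_left sum_distrib_left using b1(2) b2(2)
      by (intro Bochner_Integration.integrable_add Bochner_Integration.integrable_sum)
    have "\<bar>\<integral>x. f x * (\<Sum>i\<in>UNIV. frechet_derivative (\<lambda>y. \<eta> y * V y $ i) (at x) (axis i 1)) \<partial>lborel\<bar>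
      = \<bar>(\<integral>x. f x * frechet_derivative \<eta> (at x) w \<partial>lborel)
         + (\<Sum>i\<in>UNIV. \<integral>x. f x * frechet_derivative (h i) (at x) (axis i 1) \<partial>lborel)\<bar>"
    proof -
      have i: "integrable lborel (\<lambda>x. \<Sum>i\<in>UNIV. f x * frechet_derivative (h i) (at x) (axis i 1))"
        by (intro Bochner_Integration.integrable_sum b2(2))
      have 1: "(\<integral>x. f x * frechet_derivative \<eta> (at x) w
          + (\<Sum>i\<in>UNIV. f x * frechet_derivative (h i) (at x) (axis i 1)) \<partial>lborel)
        = (\<integral>x. f x * frechet_derivative \<eta> (at x) w \<partial>lborel)
          + (\<integral>x. (\<Sum>i\<in>UNIV. f x * frechet_derivative (h i) (at x) (axis i 1)) \<partial>lborel)"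
        by (rule Bochner_Integration.integral_add[OF b1(2) i])
      have 2: "(\<integral>x. (\<Sum>i\<in>UNIV. f x * frechet_derivative (h i) (at x) (axis i 1)) \<partial>lborel)
        = (\<Sum>i\<in>UNIV. \<integral>x. f x * frechet_derivative (h i) (at x) (axis i 1) \<partial>lborel)"
        by (rule Bochner_Integration.integral_sum) (rule b2(2))
      show ?thesis unfolding eq distrib_left sum_distrib_left 1 2 ..
    qed
    also have "\<dots> \<le> L * (N q w + \<epsilon> * m / 3) * (\<integral>x. \<bar>\<eta> x\<bar> \<partial>lborel)
         + (\<Sum>i\<in>UNIV. L * G i * (\<integral>x. \<bar>h i x\<bar> \<partial>lborel))"
      by (intro order_trans[OF abs_triangle_ineq] add_mono b1(1) order_trans[OF sum_abs] sum_mono b2(1))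
    also have "\<dots> = L * (\<integral>x. (N q w + \<epsilon> * m / 3) * \<eta> x + (\<Sum>i\<in>UNIV. G i * \<bar>h i x\<bar>) \<partial>lborel)"
      using \<eta>i hi by (simp add: \<eta>0 Bochner_Integration.integral_add Bochner_Integration.integral_sum sum_distrib_left distrib_left mult.assoc)
    also have "\<dots> \<le> L * (\<integral>x. \<eta> x * (N x (V x) + \<epsilon> * s x) \<partial>lborel)"
    proof (rule mult_left_mono[OF integral_mono L])
      show "integrable lborel (\<lambda>x. (N q w + \<epsilon> * m / 3) * \<eta> x + (\<Sum>i\<in>UNIV. G i * \<bar>h i x\<bar>))"
        using \<eta>i hi by (intro Bochner_Integration.integrable_add Bochner_Integration.integrable_sum integrable_mult_right)
      show "(N q w + \<epsilon> * m / 3) * \<eta> x + (\<Sum>i\<in>UNIV. G i * \<bar>h i x\<bar>) \<le> \<eta> x * (N x (V x) + \<epsilon> * s x)" for x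
      proof (cases "x \<in> K")
        case True
        then have x: "x \<in> W" using K by blast
        have "(\<Sum>i\<in>UNIV. G i * \<bar>h i x\<bar>) = \<eta> x * (\<Sum>i\<in>UNIV. G i * \<bar>V x $ i - w $ i\<bar>)"
          unfolding h_def sum_distrib_left by (intro sum.cong) (auto simp: abs_mult \<eta>0)
        also have "\<dots> \<le> \<eta> x * (\<epsilon> * m / 3)" by (intro mult_left_mono W4 x \<eta>0)
        finally have "(N q w + \<epsilon> * m / 3) * \<eta> x + (\<Sum>i\<in>UNIV. G i * \<bar>h i x\<bar>)
          \<le> \<eta> x * (N q w + \<epsilon> * m / 3 + \<epsilon> * m / 3)" by (simp add: algebra_simps)
        also have "\<dots> \<le> \<eta> x * (N x (V x) + \<epsilon> * s x)"
        proof (intro mult_left_mono \<eta>0)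
          have "\<epsilon> * m \<le> \<epsilon> * s x" using W5[OF x] \<epsilon> by simp
          then show "N q w + \<epsilon> * m / 3 + \<epsilon> * m / 3 \<le> N x (V x) + \<epsilon> * s x"
            using W3[OF x] by linarith
        qed
        finally show ?thesis .
      qed (simp add: \<eta>K hK)
    qed (rule int)
    finally show ?thesis using int int2 by blast
  qed
  from that[OF r W(3)[unfolded W_def] this[unfolded W_def]] show thesis .
qed

text \<open>Every matrix on the segment from the identity to \<open>M\<close> is positive definite,
  hence invertible. The determinant does not vanish along the segment and keeps the sign it has at
  the identity.\<close>

lemma posdef_det_pos:
  fixes M :: "real^'n^'n"
  assumes "\<And>v. v \<noteq> 0 \<Longrightarrow> v \<bullet> (M *v v) > 0"
  shows "det M > 0"
proof -
  define P where "P t = (1 - t) *\<^sub>R mat 1 + t *\<^sub>R M" for t :: real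
  have nz: "det (P t) \<noteq> 0" if "0 \<le> t" "t \<le> 1" for t
  proof -
    have "P t *v v \<noteq> 0" if "v \<noteq> 0" for v
    proof -
      have eq: "v \<bullet> (P t *v v) = (1 - t) * (v \<bullet> v) + t * (v \<bullet> (M *v v))"
        unfolding P_def by (simp add: matrix_vector_mult_add_rdistrib scaleR_matrix_vector_assoc[symmetric] inner_add_right)
      have "v \<bullet> v > 0" "v \<bullet> (M *v v) > 0" using assms that by auto
      then have "v \<bullet> (P t *v v) > 0" unfolding eq using \<open>0 \<le> t\<close> \<open>t \<le> 1\<close>
        by (cases "t = 0") (auto intro!: add_nonneg_pos)
      then show ?thesis by auto
    qed
    then show ?thesis
      using invertible_det_nz[of "P t"] matrix_left_invertible_ker[of "P t"]
      unfolding invertible_left_inverse by blast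
  qed
  have cont: "continuous_on {0..1} (\<lambda>t. det (P t))"
    unfolding P_def det_def by (intro continuous_intros)
  show ?thesis
  proof (rule ccontr)
    assume "\<not> det M > 0"
    then have "det (P 1) \<le> 0" "0 \<le> det (P 0)" by (auto simp: P_def)
    then obtain t where "0 \<le> t" "t \<le> 1" "det (P t) = 0"
      using IVT2'[of "\<lambda>t. det (P t)" 1 0 0] cont by auto
    then show False using nz by blast
  qed
qed


text \<open>For a metric \<open>M\<close> with inverse \<open>B\<close> and P_ik = \<partial>_i X^k,
  the bracket is the part of the Lie derivative of the metric in which \<open>X\<close> is
  differentiated. Each of its two summands contracts to \<open>trace P\<close>.\<close>

lemma double_contraction:
  "trace (B ** (P ** M + M ** transpose P)) = 2 * trace P"
  if "B ** M = mat 1" "M ** B = mat 1" for B M P :: "real^'n^'n"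
proof -
  have "trace (B ** (P ** M)) = trace P"
    using trace_mul_sym[of B "P ** M"] that by (simp add: matrix_mul_assoc[symmetric])
  moreover have "trace (B ** (M ** transpose P)) = trace P"
    using that by (simp add: matrix_mul_assoc trace_def transpose_def)
  ultimately show ?thesis by (simp add: matrix_add_ldistrib trace_add)
qed

section \<open>Charts, transition maps and the norm of a coordinate vector\<close>

locale riemannian_manifold =
  fixes A :: "('m::{t2_space,second_countable_topology}, 'n::finite) chart set"
    and g :: "('m, 'n) tensor2"
  assumes smooth_atlas: "smooth_atlas A" and riemannian_metric: "riemannian_metric A g"
begin

lemma open_chart: "c \<in> A \<Longrightarrow> open (fst c)"
  and open_chart_image: "c \<in> A \<Longrightarrow> open (chart_image c)"
  and chart_homeomorphism: "c \<in> A \<Longrightarrow> homeomorphism (fst c) (chart_image c) (snd c) (chart_inv c)"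
  using smooth_atlas unfolding smooth_atlas_def by blast+

lemma chart_at: "chart_at A p \<in> A" "p \<in> fst (chart_at A p)"
proof -
  have "\<exists>c. c \<in> A \<and> p \<in> fst c" using smooth_atlas unfolding smooth_atlas_def by blast
  from someI_ex[OF this] show "chart_at A p \<in> A" "p \<in> fst (chart_at A p)"
    unfolding chart_at_def by auto
qed

lemma chart_inv_snd [simp]: "c \<in> A \<Longrightarrow> p \<in> fst c \<Longrightarrow> chart_inv c (snd c p) = p"
  and snd_chart_inv [simp]: "c \<in> A \<Longrightarrow> x \<in> chart_image c \<Longrightarrow> snd c (chart_inv c x) = x"
  using chart_homeomorphism[of c] by (auto simp: homeomorphism_def)

lemma chart_inv_in [simp]: "c \<in> A \<Longrightarrow> x \<in> chart_image c \<Longrightarrow> chart_inv c x \<in> fst c"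
  using chart_homeomorphism[of c] by (auto simp: homeomorphism_def)

lemma snd_in_chart_image [simp]: "p \<in> fst c \<Longrightarrow> snd c p \<in> chart_image c"
  by (simp add: chart_image_def)

lemma continuous_on_chart: "c \<in> A \<Longrightarrow> continuous_on (fst c) (snd c)"
  and continuous_on_chart_inv: "c \<in> A \<Longrightarrow> continuous_on (chart_image c) (chart_inv c)"
  using chart_homeomorphism[of c] by (auto simp: homeomorphism_def)

lemma open_chart_inv_image:
  assumes "c \<in> A" "open V" "V \<subseteq> chart_image c" shows "open (chart_inv c ` V)"
proof -
  have "chart_inv c ` V = snd c -` V \<inter> fst c"
    using assms by (auto simp: image_iff subset_iff) (metis chart_inv_snd)
  then show ?thesis
    using continuous_open_preimage[OF continuous_on_chart open_chart assms(2), of c] assms(1)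
    by (simp add: Int_commute)
qed

lemma overlap_eq:
  assumes "c \<in> A" shows "overlap c c' = {x \<in> chart_image c. chart_inv c x \<in> fst c'}"
proof
  show "overlap c c' \<subseteq> {x \<in> chart_image c. chart_inv c x \<in> fst c'}"
    using assms by (auto simp: overlap_def)
  show "{x \<in> chart_image c. chart_inv c x \<in> fst c'} \<subseteq> overlap c c'"
  proof clarify
    fix x assume "x \<in> chart_image c" "chart_inv c x \<in> fst c'"
    then have "chart_inv c x \<in> fst c \<inter> fst c'" "x = snd c (chart_inv c x)" using assms by auto
    then show "x \<in> overlap c c'" unfolding overlap_def by blast
  qed
qed

lemma open_overlap: "c \<in> A \<Longrightarrow> c' \<in> A \<Longrightarrow> open (overlap c c')"
  using continuous_open_preimage[OF continuous_on_chart_inv open_chart_image open_chart, of c c']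
  by (simp add: overlap_eq vimage_def Int_def)

lemma transition_C1: "c \<in> A \<Longrightarrow> c' \<in> A \<Longrightarrow> C1_on (overlap c c') (transition c c')"
  using smooth_atlas unfolding smooth_atlas_def by (blast intro: smooth_on_imp_C1_on)

lemma transition_has_derivative:
  "c \<in> A \<Longrightarrow> c' \<in> A \<Longrightarrow> x \<in> overlap c c' \<Longrightarrow>
    (transition c c' has_derivative frechet_derivative (transition c c') (at x)) (at x)"
  by (rule C1_on_has_derivative[OF transition_C1])

lemma transition_transition:
  "c \<in> A \<Longrightarrow> c' \<in> A \<Longrightarrow> x \<in> overlap c c' \<Longrightarrow> transition c' c (transition c c' x) = x"
  by (auto simp: overlap_eq transition_def)

lemma chart_inv_transition:
  "c \<in> A \<Longrightarrow> c' \<in> A \<Longrightarrow> x \<in> overlap c c' \<Longrightarrow> chart_inv c' (transition c c' x) = chart_inv c x"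
  by (auto simp: overlap_eq transition_def)

lemma snd_in_overlap:
  "c \<in> A \<Longrightarrow> c' \<in> A \<Longrightarrow> p \<in> fst c \<Longrightarrow> p \<in> fst c' \<Longrightarrow> snd c p \<in> overlap c c'"
  by (auto simp: overlap_eq)

lemma transition_snd:
  "c \<in> A \<Longrightarrow> c' \<in> A \<Longrightarrow> p \<in> fst c \<Longrightarrow> transition c c' (snd c p) = snd c' p"
  by (auto simp: transition_def)

lemma metric_smooth: "c \<in> A \<Longrightarrow> smooth_on (chart_image c) (g c)"
  and metric_pos: "c \<in> A \<Longrightarrow> x \<in> chart_image c \<Longrightarrow> v \<noteq> 0 \<Longrightarrow> v \<bullet> (g c x *v v) > 0"
  and metric_transition: "c \<in> A \<Longrightarrow> c' \<in> A \<Longrightarrow> x \<in> overlap c c' \<Longrightarrow>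
    v \<bullet> (g c x *v w) = frechet_derivative (transition c c') (at x) v \<bullet>
         (g c' (transition c c' x) *v frechet_derivative (transition c c') (at x) w)"
  using riemannian_metric unfolding riemannian_metric_def by blast+

lemma metric_C1: "c \<in> A \<Longrightarrow> C1_on (chart_image c) (g c)"
  by (rule smooth_on_imp_C1_on[OF metric_smooth])

lemma metric_continuous: "c \<in> A \<Longrightarrow> continuous_on (chart_image c) (g c)"
  by (rule C1_on_imp_continuous_on[OF metric_C1])

lemma metric_det_pos: "c \<in> A \<Longrightarrow> x \<in> chart_image c \<Longrightarrow> det (g c x) > 0"
  by (rule posdef_det_pos) (rule metric_pos)

text \<open>In matrix form the transformation law is g = J^T g' J, so the determinant picks up (det
  J)^2 and its root the factor |det J| that the change of variables formula supplies.\<close>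

lemma metric_det_transition:
  assumes "c \<in> A" "c' \<in> A" "x \<in> overlap c c'"
  shows "sqrt (det (g c x)) = \<bar>det (matrix (frechet_derivative (transition c c') (at x)))\<bar>
           * sqrt (det (g c' (transition c c' x)))"
proof -
  let ?D = "frechet_derivative (transition c c') (at x)"
  let ?M = "matrix ?D"
  let ?h = "g c' (transition c c' x)"
  have lin: "linear ?D" using transition_has_derivative[OF assms] by (rule has_derivative_linear)
  have D: "?D v = ?M *v v" for v by (rule fun_cong[OF matrix_vector_mul(2)[OF lin], symmetric])
  have eq: "v \<bullet> (g c x *v w) = v \<bullet> ((transpose ?M ** ?h ** ?M) *v w)" for v w
  proof -
    have "v \<bullet> ((transpose ?M ** ?h ** ?M) *v w) = v \<bullet> (transpose ?M *v (?h *v (?M *v w)))"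
      by (simp add: matrix_vector_mul_assoc matrix_mul_assoc)
    also have "\<dots> = (?M *v v) \<bullet> (?h *v (?M *v w))"
      by (simp only: transpose_matrix_vector inner_commute[of v] inner_commute[of "?M *v v"] dot_lmul_matrix)
    also have "\<dots> = ?D v \<bullet> (?h *v ?D w)" unfolding D[of v, symmetric] D[of w, symmetric] ..
    also have "\<dots> = v \<bullet> (g c x *v w)" by (rule metric_transition[OF assms, symmetric])
    finally show ?thesis ..
  qed
  have "g c x *v w = (transpose ?M ** ?h ** ?M) *v w" for w
    by (rule iffD1[OF vector_eq_ldot]) (rule allI, rule eq)
  then have "g c x = transpose ?M ** ?h ** ?M"
    unfolding matrix_eq by blast
  then have "det (g c x) = (det ?M)\<^sup>2 * det ?h"
    by (simp add: det_mul det_transpose power2_eq_square)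
  then show ?thesis by (simp add: real_sqrt_mult)
qed

text \<open>Norm in a prescribed chart; \<open>metric_norm\<close> and \<open>speed\<close> evaluate
  in the chart picked by \<open>chart_at\<close>, which may jump from point to point.\<close>

definition gnorm :: "('m, 'n) chart \<Rightarrow> real^'n \<Rightarrow> real^'n \<Rightarrow> real"
  where "gnorm c x v = sqrt (v \<bullet> (g c x *v v))"

lemma metric_nonneg: "c \<in> A \<Longrightarrow> x \<in> chart_image c \<Longrightarrow> v \<bullet> (g c x *v v) \<ge> 0"
  using metric_pos[of c x v] by (cases "v = 0") (auto simp: less_imp_le)

lemma gnorm_nonneg: "c \<in> A \<Longrightarrow> x \<in> chart_image c \<Longrightarrow> gnorm c x v \<ge> 0"
  by (simp add: gnorm_def metric_nonneg)

lemma gnorm_scaleR: "gnorm c x (r *\<^sub>R v) = \<bar>r\<bar> * gnorm c x v"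
proof -
  have "(r *\<^sub>R v) \<bullet> (g c x *v (r *\<^sub>R v)) = r\<^sup>2 * (v \<bullet> (g c x *v v))"
    by (simp add: matrix_vector_mult_scaleR power2_eq_square)
  then show ?thesis by (simp add: gnorm_def real_sqrt_mult)
qed

lemma gnorm_transition:
  "c \<in> A \<Longrightarrow> c' \<in> A \<Longrightarrow> x \<in> overlap c c' \<Longrightarrow>
    gnorm c' (transition c c' x) (frechet_derivative (transition c c') (at x) v) = gnorm c x v"
  unfolding gnorm_def by (subst (2) metric_transition) auto

lemma continuous_on_gnorm:
  assumes "c \<in> A" "continuous_on S \<phi>" "\<phi> ` S \<subseteq> chart_image c" "continuous_on S v"
  shows "continuous_on S (\<lambda>x. gnorm c (\<phi> x) (v x))"
proof -
  have "continuous_on S (\<lambda>x. g c (\<phi> x))"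
    by (rule continuous_on_compose2[OF metric_continuous[OF assms(1)] assms(2,3)])
  then show ?thesis unfolding gnorm_def matrix_vector_mult_def inner_vec_def
    by (intro continuous_intros assms(4))
qed

text \<open>By homogeneity it suffices to look at unit vectors; \<open>K\<close> times the unit
  sphere is compact, and the continuous positive function \<open>gnorm\<close> attains its minimum
  there. The bound is used to convert lengths of curves into Euclidean displacements.\<close>

lemma gnorm_lower_bound:
  assumes "c \<in> A" "compact K" "K \<subseteq> chart_image c"
  shows "\<exists>l>0. \<forall>x\<in>K. \<forall>v. l * norm v \<le> gnorm c x v"
proof (cases "K = {}")
  case False
  have "continuous_on (K \<times> sphere 0 1) (\<lambda>z. gnorm c (fst z) (snd z))"
    by (rule continuous_on_gnorm[OF assms(1)]) (use assms(3) in \<open>auto intro!: continuous_intros\<close>)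
  moreover have "compact (K \<times> sphere (0::real^'n) 1)" using assms(2) by (intro compact_Times) auto
  moreover have "K \<times> sphere (0::real^'n) 1 \<noteq> {}"
    using False by (auto intro!: exI[of _ "axis undefined 1"])
  ultimately obtain z where z: "z \<in> K \<times> sphere 0 1"
    and min: "\<And>y. y \<in> K \<times> sphere 0 1 \<Longrightarrow> gnorm c (fst z) (snd z) \<le> gnorm c (fst y) (snd y)"
    using continuous_attains_inf[of "K \<times> sphere 0 1" "\<lambda>z. gnorm c (fst z) (snd z)"] by blast
  let ?l = "gnorm c (fst z) (snd z)"
  have "fst z \<in> chart_image c" "norm (snd z) = 1" using z assms(3) by auto
  then have "fst z \<in> chart_image c" "snd z \<noteq> 0" by (auto simp del: norm_eq_zero)
  then have "?l > 0" using metric_pos[OF assms(1)] by (simp add: gnorm_def)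
  moreover have "?l * norm v \<le> gnorm c x v" if "x \<in> K" for x v
  proof (cases "v = 0")
    case False
    have "gnorm c x v = gnorm c x (norm v *\<^sub>R sgn v)" by (simp add: sgn_div_norm False)
    also have "\<dots> = norm v * gnorm c x (sgn v)" by (simp add: gnorm_scaleR)
    finally show ?thesis using min[of "(x, sgn v)"] that False
      by (simp add: norm_sgn mult.commute mult_left_mono)
  qed (simp add: gnorm_def)
  ultimately show ?thesis by blast
qed (simp add: gt_ex)

end

section \<open>The divergence of a conformal vector field\<close>

context riemannian_manifold
begin

definition C1_function :: "('m \<Rightarrow> real) \<Rightarrow> bool"
  where "C1_function f \<longleftrightarrow> (\<forall>c\<in>A. C1_on (chart_image c) (f \<circ> chart_inv c))"

definition chart_deriv :: "('m, 'n) vfield \<Rightarrow> ('m, 'n) chart \<Rightarrow> ('m \<Rightarrow> real) \<Rightarrow> 'm \<Rightarrow> real"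
  where "chart_deriv X c f p = frechet_derivative (f \<circ> chart_inv c) (at (snd c p)) (X c (snd c p))"

lemma C1_function_has_derivative:
  assumes "C1_function f" "c \<in> A" "x \<in> chart_image c"
  shows "((f \<circ> chart_inv c) has_derivative frechet_derivative (f \<circ> chart_inv c) (at x)) (at x)"
  using assms unfolding C1_function_def by (blast intro: C1_on_has_derivative)

text \<open>By the chain rule the differential of \<open>f\<close> in \<open>c\<close> is the one in
  \<open>c'\<close> composed with the differential of the transition map, and the latter carries the
  components of \<open>X\<close> in \<open>c\<close> to those in \<open>c'\<close>.\<close>

lemma chart_deriv_cong:
  assumes f: "C1_function f" and X: "smooth_vector_field A X"
    and c: "c \<in> A" "c' \<in> A" and p: "p \<in> fst c" "p \<in> fst c'"
  shows "chart_deriv X c f p = chart_deriv X c' f p"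
proof -
  let ?T = "transition c c'"
  let ?x = "snd c p"
  have x: "?x \<in> overlap c c'" by (rule snd_in_overlap[OF c p])
  have Tx: "?T ?x = snd c' p" by (rule transition_snd[OF c p(1)])
  have "(f \<circ> chart_inv c' has_derivative frechet_derivative (f \<circ> chart_inv c') (at (?T ?x))) (at (?T ?x))"
    using p by (intro C1_function_has_derivative[OF f c(2)]) (simp add: Tx)
  from diff_chain_at[OF transition_has_derivative[OF c x] this]
  have "((f \<circ> chart_inv c') \<circ> ?T has_derivative
      frechet_derivative (f \<circ> chart_inv c') (at (?T ?x)) \<circ> frechet_derivative ?T (at ?x)) (at ?x)" .
  moreover have "((f \<circ> chart_inv c') \<circ> ?T) y = (f \<circ> chart_inv c) y" if "y \<in> overlap c c'" for y
    using chart_inv_transition[OF c that] by simp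
  ultimately have "(f \<circ> chart_inv c has_derivative
      frechet_derivative (f \<circ> chart_inv c') (at (?T ?x)) \<circ> frechet_derivative ?T (at ?x)) (at ?x)"
    using has_derivative_transform_within_open[OF _ open_overlap[OF c] x] by blast
  then have "frechet_derivative (f \<circ> chart_inv c) (at ?x)
    = frechet_derivative (f \<circ> chart_inv c') (at (?T ?x)) \<circ> frechet_derivative ?T (at ?x)"
    by (rule frechet_derivative_at[symmetric])
  moreover have "X c' (?T ?x) = frechet_derivative ?T (at ?x) (X c ?x)"
    using X c x unfolding smooth_vector_field_def by blast
  ultimately show ?thesis by (simp add: chart_deriv_def Tx)
qed

lemma vector_field_C1: "smooth_vector_field A X \<Longrightarrow> c \<in> A \<Longrightarrow> C1_on (chart_image c) (X c)"
  unfolding smooth_vector_field_def by (blast intro: smooth_on_imp_C1_on)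

lemma metric_norm_eq:
  assumes X: "smooth_vector_field A X" and c: "c \<in> A" "p \<in> fst c"
  shows "metric_norm A g X p = gnorm c (snd c p) (X c (snd c p))"
proof -
  let ?d = "chart_at A p"
  note d = chart_at[of p]
  have x: "snd c p \<in> overlap c ?d" by (rule snd_in_overlap[OF c(1) d(1) c(2) d(2)])
  have "X ?d (transition c ?d (snd c p)) = frechet_derivative (transition c ?d) (at (snd c p)) (X c (snd c p))"
    using X c d x unfolding smooth_vector_field_def by blast
  then show ?thesis
    using gnorm_transition[OF c(1) d(1) x, of "X c (snd c p)"]
    by (simp add: metric_norm_def metric_inner_def Let_def gnorm_def transition_snd[OF c(1) d(1) c(2)])
qed

lemma metric_invertible: "c \<in> A \<Longrightarrow> x \<in> chart_image c \<Longrightarrow> invertible (g c x)"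
  using metric_det_pos[of c x] by (simp add: invertible_det_nz)

text \<open>The inverse metric in the gradient cancels the metric of the inner product. This turns
  the sign hypothesis on the gradient of the curvature into one on its derivative along
  \<open>X\<close>.\<close>

lemma metric_inner_gradient:
  assumes f: "C1_function f" and X: "smooth_vector_field A X" and c: "c \<in> A" "p \<in> fst c"
  shows "metric_inner A g X (gradient g f) p = chart_deriv X c f p"
proof -
  let ?d = "chart_at A p"
  let ?x = "snd ?d p"
  note d = chart_at[of p]
  have x: "?x \<in> chart_image ?d" using d by simp
  have "g ?d ?x *v gradient g f ?d ?x = (\<chi> i. partial i (f \<circ> chart_inv ?d) ?x)"
    using matrix_inv_inverse[OF metric_invertible[OF d(1) x]]
    by (simp add: gradient_def matrix_vector_mul_assoc)
  then have "metric_inner A g X (gradient g f) p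
      = (\<Sum>i\<in>UNIV. X ?d ?x $ i * partial i (f \<circ> chart_inv ?d) ?x)"
    by (simp add: metric_inner_def Let_def inner_vec_def)
  also have "\<dots> = chart_deriv X ?d f p"
  proof -
    have "(f \<circ> chart_inv ?d) differentiable (at ?x)"
      using C1_function_has_derivative[OF f d(1) x] by (auto simp: differentiable_def)
    from frechet_derivative_at[OF has_derivative_partial[OF this]]
    show ?thesis by (simp add: chart_deriv_def fun_eq_iff)
  qed
  also have "\<dots> = chart_deriv X c f p" by (rule chart_deriv_cong[OF f X d(1) c(1) d(2) c(2)])
  finally show ?thesis .
qed

text \<open>Contraction of the conformal equation with the inverse metric, divided by 2. The left
  side is the divergence of \<open>X\<close> in coordinates: by Jacobi's formula the trace term is
  the derivative of log sqrt(det g) along \<open>X\<close>.\<close>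

lemma trace_jacobian_conformal:
  assumes X: "smooth_vector_field A X" and c: "c \<in> A" and x: "x \<in> chart_image c"
    and L: "lie_derivative X g c x = (2 * \<sigma>) *\<^sub>R g c x"
  shows "(\<Sum>i\<in>UNIV. frechet_derivative (X c) (at x) (axis i 1) $ i)
    + trace (matrix_inv (g c x) ** frechet_derivative (g c) (at x) (X c x)) / 2 = real CARD('n) * \<sigma>"
proof -
  let ?B = "matrix_inv (g c x)"
  define P :: "real^'n^'n" where "P = (\<chi> i k. frechet_derivative (X c) (at x) (axis i 1) $ k)"
  have B: "?B ** g c x = mat 1" "g c x ** ?B = mat 1"
    using matrix_inv_inverse[OF metric_invertible[OF c x]] by auto
  have gd: "(g c has_derivative frechet_derivative (g c) (at x)) (at x)"
    by (rule C1_on_has_derivative[OF metric_C1[OF c] x])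
  have gdiff: "g c differentiable (at x)" using gd by (auto simp: differentiable_def)
  have Xdiff: "X c differentiable (at x)"
    using C1_on_has_derivative[OF vector_field_C1[OF X c] x] by (auto simp: differentiable_def)
  note lin = has_derivative_linear[OF gd]
  have gX: "frechet_derivative (g c) (at x) (X c x)
    = (\<Sum>k\<in>UNIV. X c x $ k *\<^sub>R frechet_derivative (g c) (at x) (axis k 1))"
  proof -
    have "frechet_derivative (g c) (at x) (X c x)
      = frechet_derivative (g c) (at x) (\<Sum>k\<in>UNIV. X c x $ k *\<^sub>R axis k 1)"
      by (simp add: basis_expansion[where 'a=real, unfolded scalar_mult_eq_scaleR])
    then show ?thesis by (simp add: linear_sum[OF lin] linear_cmul[OF lin])
  qed
  have "lie_derivative X g c x
    = frechet_derivative (g c) (at x) (X c x) + (P ** g c x + g c x ** transpose P)"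
    unfolding gX by (simp add: lie_derivative_def vec_eq_iff P_def matrix_matrix_mult_def transpose_def
        partial_mat_nth[OF gdiff] partial_vec_nth[OF Xdiff] sum.distrib mult.commute)
  then have "?B ** ((2 * \<sigma>) *\<^sub>R g c x)
    = ?B ** frechet_derivative (g c) (at x) (X c x) + ?B ** (P ** g c x + g c x ** transpose P)"
    using L by (simp add: matrix_add_ldistrib)
  then have "trace (?B ** ((2 * \<sigma>) *\<^sub>R g c x))
    = trace (?B ** frechet_derivative (g c) (at x) (X c x)) + 2 * trace P"
    by (simp add: trace_add double_contraction[OF B])
  moreover have "?B ** ((2 * \<sigma>) *\<^sub>R g c x) = (2 * \<sigma>) *\<^sub>R mat 1"
  proof -
    have "?B ** ((2 * \<sigma>) *\<^sub>R g c x) = (2 * \<sigma>) *\<^sub>R (?B ** g c x)"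
      by (simp add: matrix_matrix_mult_def vec_eq_iff sum_distrib_left mult.left_commute)
    then show ?thesis by (simp add: B)
  qed
  ultimately show ?thesis by (simp add: trace_def P_def mat_def)
qed

text \<open>The coordinate formula \<partial>_i (sqrt(det g) u X^i) = sqrt(det g) div(u X), with div
  X = n \<sigma> inserted. The density is kept on both sides because the integral in a chart is
  taken against it.\<close>

lemma divergence_conformal:
  assumes X: "smooth_vector_field A X" and c: "c \<in> A" and x: "x \<in> chart_image c"
    and L: "lie_derivative X g c x = (2 * \<sigma>) *\<^sub>R g c x" and u: "u differentiable (at x)"
  shows "(\<Sum>i\<in>UNIV. frechet_derivative (\<lambda>y. u y * (sqrt (det (g c y)) * X c y $ i)) (at x) (axis i 1))
    = sqrt (det (g c x)) * (u x * (real CARD('n) * \<sigma>) + frechet_derivative u (at x) (X c x))"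
proof -
  let ?B = "matrix_inv (g c x)"
  let ?s = "sqrt (det (g c x))"
  let ?T = "\<lambda>h. trace (?B ** frechet_derivative (g c) (at x) h)"
  let ?DX = "frechet_derivative (X c) (at x)"
  let ?Du = "frechet_derivative u (at x)"
  have ud: "(u has_derivative ?Du) (at x)" using u by (simp add: frechet_derivative_works)
  have gd: "(g c has_derivative frechet_derivative (g c) (at x)) (at x)"
    by (rule C1_on_has_derivative[OF metric_C1[OF c] x])
  have Xd: "(X c has_derivative ?DX) (at x)"
    by (rule C1_on_has_derivative[OF vector_field_C1[OF X c] x])
  have pos: "det (g c x) > 0" by (rule metric_det_pos[OF c x])
  have sd: "((\<lambda>y. sqrt (det (g c y))) has_derivative (\<lambda>h. ?s * ?T h / 2)) (at x)"
  proof -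
    have "(sqrt has_derivative (\<lambda>h. (inverse ?s / 2) * h)) (at (det (g c x)))"
      using DERIV_real_sqrt[OF pos] unfolding has_field_derivative_def .
    from has_derivative_compose[OF det_has_derivative[OF gd metric_invertible[OF c x]] this]
    have 1: "((\<lambda>y. sqrt (det (g c y))) has_derivative (\<lambda>h. (inverse ?s / 2) * (det (g c x) * ?T h))) (at x)" .
    have 2: "(inverse ?s / 2) * (det (g c x) * t) = ?s * t / 2" for t
    proof -
      have "inverse ?s * det (g c x) = ?s"
        using pos by (simp add: inverse_eq_divide real_div_sqrt less_imp_le)
      then show ?thesis by (metis (no_types, lifting) mult.assoc times_divide_eq_left)
    qed
    show ?thesis using 1 unfolding 2 .
  qed
  have i: "frechet_derivative (\<lambda>y. u y * (sqrt (det (g c y)) * X c y $ i)) (at x) h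
    = u x * (?s * ?DX h $ i + ?s * ?T h / 2 * X c x $ i) + ?Du h * (?s * X c x $ i)" for i h
  proof -
    have "((\<lambda>y. u y * (sqrt (det (g c y)) * X c y $ i)) has_derivative
      (\<lambda>h. u x * (?s * ?DX h $ i + ?s * ?T h / 2 * X c x $ i) + ?Du h * (?s * X c x $ i))) (at x)"
      by (intro has_derivative_mult ud sd bounded_linear.has_derivative[OF bounded_linear_vec_nth Xd])
    from fun_cong[OF frechet_derivative_at[OF this], of h] show ?thesis by simp
  qed
  have expand: "(\<Sum>i\<in>UNIV. F (axis i 1) * X c x $ i) = F (X c x)"
    if "linear F" for F :: "real^'n \<Rightarrow> real"
  proof -
    have "F (X c x) = F (\<Sum>k\<in>UNIV. X c x $ k *\<^sub>R axis k 1)"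
      by (simp add: basis_expansion[where 'a=real, unfolded scalar_mult_eq_scaleR])
    then show ?thesis by (simp add: linear_sum[OF that] linear_cmul[OF that] mult.commute)
  qed
  have T: "(\<Sum>i\<in>UNIV. (?s * ?T (axis i 1) / 2) * X c x $ i) = ?s * ?T (X c x) / 2"
    by (rule expand[OF has_derivative_linear[OF sd]])
  have U: "(\<Sum>i\<in>UNIV. ?Du (axis i 1) * X c x $ i) = ?Du (X c x)"
    by (rule expand[OF has_derivative_linear[OF ud]])
  have "(\<Sum>i\<in>UNIV. frechet_derivative (\<lambda>y. u y * (sqrt (det (g c y)) * X c y $ i)) (at x) (axis i 1))
    = u x * (?s * (\<Sum>i\<in>UNIV. ?DX (axis i 1) $ i) + (\<Sum>i\<in>UNIV. (?s * ?T (axis i 1) / 2) * X c x $ i))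
      + ?s * (\<Sum>i\<in>UNIV. ?Du (axis i 1) * X c x $ i)"
    unfolding i by (simp add: sum.distrib sum_distrib_left distrib_left mult_ac)
  also have "\<dots> = ?s * (u x * ((\<Sum>i\<in>UNIV. ?DX (axis i 1) $ i) + ?T (X c x) / 2) + ?Du (X c x))"
    unfolding T U by (simp add: algebra_simps)
  finally show ?thesis unfolding trace_jacobian_conformal[OF X c x L] .
qed

text \<open>A conformal factor is determined by any diagonal entry of the Lie derivative, so it is as
  regular as \<open>X\<close> and \<open>g\<close> permit.\<close>

lemma conformal_factor_C1:
  assumes X: "smooth_vector_field A X" and c: "c \<in> A"
    and L: "\<And>x. x \<in> chart_image c \<Longrightarrow> lie_derivative X g c x = (2 * \<sigma> x) *\<^sub>R g c x"
  shows "C1_on (chart_image c) \<sigma>"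
proof -
  \<comment> \<open>Any index serves: definiteness makes \<open>g c x $ i $ i\<close> positive, so
    the equation can be solved for \<sigma>.\<close>
  fix i :: 'n
  define D where "D = (\<lambda>x. \<Sum>k\<in>UNIV. X c x $ k * (frechet_derivative (g c) (at x) (axis k 1) $ i $ i)
      + g c x $ k $ i * frechet_derivative (X c) (at x) (axis i 1) $ k
      + g c x $ i $ k * frechet_derivative (X c) (at x) (axis i 1) $ k)"
  have gii: "g c x $ i $ i > 0" if "x \<in> chart_image c" for x
    using metric_pos[OF c that, of "axis i 1"]
    by (simp add: matrix_vector_mul_component inner_axis' inner_axis)
  have "\<sigma> x = D x / (2 * g c x $ i $ i)" if x: "x \<in> chart_image c" for x
  proof -
    have "g c differentiable (at x)" "X c differentiable (at x)"
      using metric_C1[OF c] vector_field_C1[OF X c] x by (auto simp: C1_on_iff)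
    then have "lie_derivative X g c x $ i $ i = D x"
      by (simp add: lie_derivative_def D_def partial_mat_nth partial_vec_nth)
    then show ?thesis using L[OF x] gii[OF x] by (simp add: field_simps)
  qed
  moreover have "C1_on (chart_image c) (\<lambda>x. D x / (2 * g c x $ i $ i))"
  proof (intro C1_on_divide)
    have X': "smooth_on (chart_image c) (X c)" using X c unfolding smooth_vector_field_def by blast
    show "C1_on (chart_image c) D" unfolding D_def
      by (intro C1_on_sum C1_on_add C1_on_mult C1_on_vec_nth metric_C1[OF c] vector_field_C1[OF X c]
          smooth_on_imp_C1_on_derivative metric_smooth[OF c] X')
    show "C1_on (chart_image c) (\<lambda>x. 2 * g c x $ i $ i)"
      by (intro C1_on_mult C1_on_const C1_on_vec_nth metric_C1[OF c])
    show "2 * g c x $ i $ i \<noteq> 0" if "x \<in> chart_image c" for x using gii[OF that] by simp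
  qed
  ultimately show ?thesis using C1_on_cong[OF open_chart_image[OF c]] by fastforce
qed

end

section \<open>Change of variables\<close>

text \<open>The change of variables theorem of the library needs a well-ordered index type; \<open>'n enum_index\<close> is
  such a copy of \<open>'n\<close>.\<close>

typedef ('n::finite) enum_index = "{..<CARD('n)}"
  by (auto intro!: exI[of _ 0])

instantiation enum_index :: (finite) linorder
begin

definition less_eq_enum_index :: "'a enum_index \<Rightarrow> 'a enum_index \<Rightarrow> bool"
  where "less_eq_enum_index x y \<longleftrightarrow> Rep_enum_index x \<le> Rep_enum_index y"

definition less_enum_index :: "'a enum_index \<Rightarrow> 'a enum_index \<Rightarrow> bool"
  where "less_enum_index x y \<longleftrightarrow> Rep_enum_index x < Rep_enum_index y"

instance
  by intro_classes (auto simp: less_eq_enum_index_def less_enum_index_def Rep_enum_index_inject)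

end

instance enum_index :: (finite) wellorder
proof
  fix P :: "'a enum_index \<Rightarrow> bool" and a
  assume step: "\<And>x. (\<And>y. y < x \<Longrightarrow> P y) \<Longrightarrow> P x"
  show "P a"
    by (induction a rule: measure_induct_rule[of Rep_enum_index])
      (auto intro: step simp: less_enum_index_def)
qed

instance enum_index :: (finite) finite
proof
  have "(UNIV :: 'a enum_index set) = Abs_enum_index ` {..<CARD('a)}"
    by (rule type_definition.Abs_image[OF type_definition_enum_index, symmetric])
  then show "finite (UNIV :: 'a enum_index set)" by (metis finite_imageI finite_lessThan)
qed

section \<open>Renaming coordinates: permutations, determinants and Lebesgue measure\<close>

lemma enum_index_bij: "\<exists>\<pi> :: 'n::finite \<Rightarrow> 'n enum_index. bij \<pi>"
  by (rule finite_same_card_bij)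
    (simp_all add: type_definition.card[OF type_definition_enum_index])

text \<open>Conjugation by \<pi> carries the transposition of \<open>a\<close> and \<open>b\<close>
  to that of \<open>\<pi> a\<close> and \<open>\<pi> b\<close>, so a product of transpositions keeps
  its number of factors.\<close>

lemma sign_conjugate:
  fixes \<pi> :: "'a::finite \<Rightarrow> 'b::finite"
  assumes \<pi>: "bij \<pi>" and p: "p permutes (UNIV :: 'a set)"
  shows "(\<pi> \<circ> p \<circ> inv \<pi>) permutes UNIV \<and> sign (\<pi> \<circ> p \<circ> inv \<pi>) = sign p"
  using p finite_class.finite_UNIV
proof (induction rule: permutes_induct)
  case id
  have "\<pi> \<circ> id \<circ> inv \<pi> = id" using iffD1[OF surj_iff bij_is_surj[OF \<pi>]] by simp
  then show ?case using permutes_id by (auto simp only: comp_id id_comp sign_id)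
next
  case (swap a b p)
  have inj: "inj \<pi>" using \<pi> by (rule bij_is_inj)
  have perm: "permutation q" if "q permutes UNIV" for q :: "'c::finite \<Rightarrow> 'c"
    unfolding permutation_permutes using that by (intro exI[of _ UNIV]) simp
  have eq: "\<pi> \<circ> (Transposition.transpose a b \<circ> p) \<circ> inv \<pi>
    = Transposition.transpose (\<pi> a) (\<pi> b) \<circ> (\<pi> \<circ> p \<circ> inv \<pi>)"
    using inj by (auto simp: fun_eq_iff Transposition.transpose_def inj_eq)
  have t: "Transposition.transpose (\<pi> a) (\<pi> b) permutes UNIV" by (rule permutes_swap_id) auto
  have "\<pi> a \<noteq> \<pi> b" using inj swap.hyps by (simp add: inj_eq)
  moreover have "sign (Transposition.transpose (\<pi> a) (\<pi> b) \<circ> (\<pi> \<circ> p \<circ> inv \<pi>))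
      = sign (Transposition.transpose (\<pi> a) (\<pi> b)) * sign (\<pi> \<circ> p \<circ> inv \<pi>)"
    using swap.IH by (intro sign_compose permutation_swap_id perm) blast
  moreover have "sign (Transposition.transpose a b \<circ> p) = sign (Transposition.transpose a b) * sign p"
    using swap.hyps by (intro sign_compose permutation_swap_id perm) blast
  ultimately show ?case
    unfolding eq using swap.IH swap.hyps(3) permutes_compose[OF _ t] by (simp only: sign_swap_id if_False)
qed

text \<open>In the Leibniz formula, conjugation by \<pi> is a sign-preserving bijection between the
  two permutation groups, and it matches the products of entries.\<close>

lemma det_reindex:
  fixes \<pi> :: "'a::finite \<Rightarrow> 'b::finite" and M :: "real^'a^'a"
  assumes \<pi>: "bij \<pi>"
  shows "det (\<chi> i j. M $ inv \<pi> i $ inv \<pi> j) = det M"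
proof -
  let ?N = "(\<chi> i j. M $ inv \<pi> i $ inv \<pi> j) :: real^'b^'b"
  let ?c = "\<lambda>p. \<pi> \<circ> p \<circ> inv \<pi>"
  have ii: "inv \<pi> (\<pi> x) = x" "\<pi> (inv \<pi> y) = y" for x y
    using \<pi> by (simp_all add: bij_is_inj bij_is_surj surj_f_inv_f)
  have b: "bij_betw ?c {p. p permutes (UNIV :: 'a set)} {p. p permutes (UNIV :: 'b set)}"
  proof (rule bij_betw_byWitness[where f' = "\<lambda>q. inv \<pi> \<circ> q \<circ> \<pi>"])
    have "inv \<pi> \<circ> q \<circ> \<pi> permutes UNIV" if "q permutes UNIV" for q
      using sign_conjugate[OF bij_imp_bij_inv[OF \<pi>] that] by (simp add: inv_inv_eq[OF \<pi>])
    then show "(\<lambda>q. inv \<pi> \<circ> q \<circ> \<pi>) ` {p. p permutes UNIV} \<subseteq> {p. p permutes UNIV}" by auto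
  qed (auto simp: fun_eq_iff ii sign_conjugate[OF \<pi>])
  have "det ?N = (\<Sum>p\<in>{p. p permutes (UNIV :: 'b set)}. of_int (sign p) * (\<Prod>i\<in>UNIV. ?N $ i $ p i))"
    by (simp add: det_def)
  also have "\<dots> = (\<Sum>p\<in>{p. p permutes (UNIV :: 'a set)}. of_int (sign (?c p)) * (\<Prod>i\<in>UNIV. ?N $ i $ ?c p i))"
    by (rule sum.reindex_bij_betw[OF b, symmetric])
  also have "\<dots> = det M"
    unfolding det_def
  proof (rule sum.cong[OF refl])
    fix p assume "p \<in> {p. p permutes (UNIV :: 'a set)}"
    moreover have "(\<Prod>i\<in>UNIV. ?N $ i $ ?c p i) = (\<Prod>i\<in>UNIV. ?N $ \<pi> i $ ?c p (\<pi> i))"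
      by (rule prod.reindex_bij_betw[OF \<pi>, symmetric])
    ultimately show "of_int (sign (?c p)) * (\<Prod>i\<in>UNIV. ?N $ i $ ?c p i) = of_int (sign p) * (\<Prod>i\<in>UNIV. M $ i $ p i)"
      using sign_conjugate[OF \<pi>, of p] by (simp add: ii)
  qed
  finally show ?thesis .
qed

definition reindex :: "('a::finite \<Rightarrow> 'b::finite) \<Rightarrow> real^'a \<Rightarrow> real^'b"
  where "reindex \<pi> x = (\<chi> j. x $ inv \<pi> j)"

lemma reindex_inverse:
  assumes "bij \<pi>" shows "reindex (inv \<pi>) (reindex \<pi> x) = x" "reindex \<pi> (reindex (inv \<pi>) y) = y"
  using assms by (simp_all add: reindex_def vec_eq_iff inv_inv_eq bij_is_inj bij_is_surj surj_f_inv_f)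

lemma bounded_linear_reindex: "bounded_linear (reindex \<pi>)"
  by (simp add: linear_conv_bounded_linear[symmetric] linear_iff reindex_def vec_eq_iff)

lemma measurable_reindex [measurable]: "reindex \<pi> \<in> borel_measurable borel"
  by (intro borel_measurable_continuous_onI linear_continuous_on bounded_linear_reindex)

lemma prod_Basis_vec: "(\<Prod>b\<in>Basis. (v :: real^'n) \<bullet> b) = (\<Prod>i\<in>UNIV. v $ i)"
proof -
  have B: "(Basis :: (real^'n) set) = (\<lambda>i. axis i 1) ` UNIV" by (auto simp: Basis_vec_def)
  have "inj (\<lambda>i::'n. axis i (1::real))" by (auto simp: inj_on_def axis_eq_axis)
  then show ?thesis unfolding B by (subst prod.reindex) (auto simp: inner_axis)
qed

text \<open>Lebesgue measure is determined by its values on boxes, and renaming coordinates maps a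
  box to a box with the same side lengths.\<close>

lemma distr_lborel_reindex:
  fixes \<pi> :: "'a::finite \<Rightarrow> 'b::finite"
  assumes \<pi>: "bij \<pi>" shows "distr lborel borel (reindex \<pi>) = lborel"
proof (rule lborel_eqI[symmetric])
  fix l u :: "real^'b"
  assume le: "\<And>b. b \<in> Basis \<Longrightarrow> l \<bullet> b \<le> u \<bullet> b"
  have le': "l $ i \<le> u $ i" for i using le[of "axis i 1"] by (simp add: inner_axis)
  let ?r = "reindex (inv \<pi>)"
  have nth: "?r v $ i = v $ \<pi> i" for v i using \<pi> by (simp add: reindex_def inv_inv_eq)
  have "reindex \<pi> -` box l u = box (?r l) (?r u)"
  proof -
    have "(\<forall>i. l $ i < x $ inv \<pi> i \<and> x $ inv \<pi> i < u $ i) \<longleftrightarrow> (\<forall>i. l $ \<pi> i < x $ i \<and> x $ i < u $ \<pi> i)" for x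
      using \<pi> by (metis bij_inv_eq_iff)
    moreover have "reindex \<pi> x $ i = x $ inv \<pi> i" for x i by (simp add: reindex_def)
    ultimately show ?thesis by (simp add: set_eq_iff mem_box_cart nth)
  qed
  then have "emeasure (distr lborel borel (reindex \<pi>)) (box l u) = emeasure lborel (box (?r l) (?r u))"
    by (simp add: emeasure_distr)
  also have "\<dots> = (\<Prod>b\<in>Basis. (?r u - ?r l) \<bullet> b)"
    by (rule emeasure_lborel_box) (auto simp: Basis_vec_def inner_axis nth le')
  also have "\<dots> = (\<Prod>i\<in>UNIV. (u - l) $ \<pi> i)" by (simp add: prod_Basis_vec nth)
  also have "\<dots> = (\<Prod>i\<in>UNIV. (u - l) $ i)" using prod.reindex_bij_betw[OF \<pi>, of "\<lambda>i. (u - l) $ i"] by simp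
  finally show "emeasure (distr lborel borel (reindex \<pi>)) (box l u) = (\<Prod>b\<in>Basis. (u - l) \<bullet> b)"
    by (simp add: prod_Basis_vec)
qed simp

lemma nn_integral_reindex:
  fixes \<pi> :: "'a::finite \<Rightarrow> 'b::finite"
  assumes \<pi>: "bij \<pi>" and [measurable]: "h \<in> borel_measurable borel"
  shows "(\<integral>\<^sup>+y. h y \<partial>lborel) = (\<integral>\<^sup>+x. h (reindex \<pi> x) \<partial>lborel)"
proof -
  have "(\<integral>\<^sup>+y. h y \<partial>lborel) = (\<integral>\<^sup>+y. h y \<partial>(distr lborel borel (reindex \<pi>)))"
    by (simp add: distr_lborel_reindex[OF \<pi>])
  also have "\<dots> = (\<integral>\<^sup>+x. h (reindex \<pi> x) \<partial>lborel)" by (rule nn_integral_distr) auto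
  finally show ?thesis .
qed

text \<open>A bridge between two languages: change of variables speaks of absolute integrability
  with a finite value \<open>b\<close>, the volume of nonnegative integrals in
  \<open>ennreal\<close>.\<close>

lemma nonneg_absolutely_integrable_iff:
  fixes f :: "'a::euclidean_space \<Rightarrow> real"
  assumes f: "\<And>x. x \<in> S \<Longrightarrow> 0 \<le> f x" and m: "(\<lambda>x. indicator S x * f x) \<in> borel_measurable borel"
    and b: "0 \<le> b"
  shows "f absolutely_integrable_on S \<and> integral S f = b
    \<longleftrightarrow> (\<integral>\<^sup>+x. ennreal (indicator S x * f x) \<partial>lborel) = ennreal b"
proof
  assume L: "f absolutely_integrable_on S \<and> integral S f = b"
  then have "(f has_integral b) S" using absolutely_integrable_on_def integrable_integral by blast
  from nn_integral_has_integral_lebesgue[OF f this]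
  show "(\<integral>\<^sup>+x. ennreal (indicator S x * f x) \<partial>lborel) = ennreal b" .
next
  assume R: "(\<integral>\<^sup>+x. ennreal (indicator S x * f x) \<partial>lborel) = ennreal b"
  have nn: "0 \<le> indicator S x * f x" for x using f by (auto simp: indicator_def)
  have "integrable lborel (\<lambda>x. indicator S x * f x)"
    using m R nn by (intro integrableI_nonneg) auto
  then have "integrable lebesgue (\<lambda>x. indicator S x *\<^sub>R f x)"
    using m by (simp add: integrable_completion)
  then have ai: "f absolutely_integrable_on S" by (simp add: set_integrable_def)
  then have "(f has_integral (integral S f)) S" using absolutely_integrable_on_def integrable_integral by blast
  from nn_integral_has_integral_lebesgue[OF f this] R b
  have "integral S f = b"
    using integral_nonneg[of f S] f ai absolutely_integrable_on_def by fastforce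
  with ai show "f absolutely_integrable_on S \<and> integral S f = b" by blast
qed

text \<open>Agreement about all finite values settles the infinite one as well, so an equivalence
  for every finite \<open>b\<close> also covers divergent integrals.\<close>

lemma ennreal_eqI_top:
  assumes "\<And>b. 0 \<le> b \<Longrightarrow> x = ennreal b \<longleftrightarrow> y = ennreal b" shows "x = y"
proof (cases x)
  case (real r)
  then show ?thesis using assms[of r] by auto
next
  case top
  then show ?thesis using assms by (cases y) auto
qed

lemma nn_integral_change_of_variables_wellorder:
  fixes T :: "real^'k::{finite,wellorder} \<Rightarrow> real^'k::{finite,wellorder}" and f :: "real^'k::{finite,wellorder} \<Rightarrow> real"
  assumes S: "S \<in> sets borel" and T: "\<And>x. x \<in> S \<Longrightarrow> (T has_derivative T' x) (at x within S)"
    and inj: "inj_on T S" and f: "\<And>y. y \<in> T ` S \<Longrightarrow> 0 \<le> f y"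
    and m1: "(\<lambda>y. indicator (T ` S) y * f y) \<in> borel_measurable borel"
    and m2: "(\<lambda>x. indicator S x * (\<bar>det (matrix (T' x))\<bar> * f (T x))) \<in> borel_measurable borel"
  shows "(\<integral>\<^sup>+y. ennreal (indicator (T ` S) y * f y) \<partial>lborel)
    = (\<integral>\<^sup>+x. ennreal (indicator S x * (\<bar>det (matrix (T' x))\<bar> * f (T x))) \<partial>lborel)"
proof -
  let ?G = "\<lambda>x. \<bar>det (matrix (T' x))\<bar> * f (T x)"
  \<comment> \<open>The underlying theorem is about vector-valued integrands, so the scalar
    \<open>f\<close> is wrapped into \<open>real^1\<close>.\<close>
  have "?G absolutely_integrable_on S \<and> integral S ?G = b
    \<longleftrightarrow> f absolutely_integrable_on (T ` S) \<and> integral (T ` S) f = b" for b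
    using has_absolute_integral_change_of_variables[where f = "\<lambda>x. vec (f x) :: real^1" and b = "vec b"
        and g = T and g' = T' and S = S] S T inj
    by (simp add: absolutely_integrable_on_1_iff integral_on_1_eq sets_completionI_sets)
  then have *: "(\<integral>\<^sup>+x. ennreal (indicator S x * ?G x) \<partial>lborel) = ennreal b
    \<longleftrightarrow> (\<integral>\<^sup>+y. ennreal (indicator (T ` S) y * f y) \<partial>lborel) = ennreal b" if "0 \<le> b" for b
    using nonneg_absolutely_integrable_iff[OF f m1 that]
      nonneg_absolutely_integrable_iff[OF _ m2 that] f by auto
  show ?thesis
    using ennreal_eqI_top[of "\<integral>\<^sup>+y. ennreal (indicator (T ` S) y * f y) \<partial>lborel"
      "\<integral>\<^sup>+x. ennreal (indicator S x * ?G x) \<partial>lborel"] * by blast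
qed

text \<open>Conjugating \<open>T\<close> with the renaming of coordinates changes neither the
  integrals nor the Jacobian determinants, so the well-ordered case carries over to any finite index
  type.\<close>

lemma nn_integral_change_of_variables:
  fixes T :: "real^'n \<Rightarrow> real^'n" and f :: "real^'n \<Rightarrow> real"
  assumes S: "S \<in> sets borel" and TS: "T ` S \<in> sets borel"
    and T: "\<And>x. x \<in> S \<Longrightarrow> (T has_derivative T' x) (at x)"
    and inj: "inj_on T S" and f: "\<And>y. y \<in> T ` S \<Longrightarrow> 0 \<le> f y"
    and m1: "(\<lambda>y. indicator (T ` S) y * f y) \<in> borel_measurable borel"
    and m2: "(\<lambda>x. indicator S x * (\<bar>det (matrix (T' x))\<bar> * f (T x))) \<in> borel_measurable borel"
  shows "(\<integral>\<^sup>+y. ennreal (indicator (T ` S) y * f y) \<partial>lborel)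
    = (\<integral>\<^sup>+x. ennreal (indicator S x * (\<bar>det (matrix (T' x))\<bar> * f (T x))) \<partial>lborel)"
proof -
  obtain \<pi> :: "'n \<Rightarrow> 'n enum_index" where \<pi>: "bij \<pi>" using enum_index_bij by blast
  let ?r = "reindex \<pi>" and ?s = "reindex (inv \<pi>)"
  note rs = reindex_inverse[OF \<pi>]
  let ?T = "\<lambda>y. ?r (T (?s y))"
  let ?T' = "\<lambda>y. \<lambda>v. ?r (T' (?s y) (?s v))"
  let ?S = "?r ` S"
  have rS: "y \<in> ?r ` Q \<longleftrightarrow> ?s y \<in> Q" for y and Q :: "(real^'n) set"
  proof
    show "?s y \<in> Q" if "y \<in> ?r ` Q" using that by (auto simp: rs)
    show "y \<in> ?r ` Q" if "?s y \<in> Q"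
      using imageI[OF that, of ?r] by (simp add: rs)
  qed
  have TS': "?T ` ?S = ?r ` (T ` S)" by (auto simp: rs image_iff)
  have meas: "?r ` Q \<in> sets borel" if "Q \<in> sets borel" for Q
  proof -
    have "?r ` Q = ?s -` Q \<inter> space borel" using rS by auto
    then show ?thesis using measurable_sets[OF measurable_reindex that] by simp
  qed
  have detT: "det (matrix (?T' y)) = det (matrix (T' (?s y)))" for y
  proof -
    have "?s (axis j 1) = (axis (inv \<pi> j) 1 :: real^'n)" for j
      using \<pi> by (auto simp: reindex_def vec_eq_iff axis_def inv_inv_eq bij_inv_eq_iff)
    then have "matrix (?T' y) = (\<chi> i j. matrix (T' (?s y)) $ inv \<pi> i $ inv \<pi> j)"
      by (simp add: matrix_def reindex_def)
    then show ?thesis by (simp add: det_reindex[OF \<pi>])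
  qed
  have ind1: "indicator (?r ` Q) y = (indicator Q (?s y) :: real)" for Q y
    using rS[of y Q] by (simp add: indicator_def)
  have "(\<integral>\<^sup>+y. ennreal (indicator (?T ` ?S) y * f (?s y)) \<partial>lborel)
    = (\<integral>\<^sup>+x. ennreal (indicator ?S x * (\<bar>det (matrix (?T' x))\<bar> * f (?s (?T x)))) \<partial>lborel)"
  proof (rule nn_integral_change_of_variables_wellorder)
    show "?S \<in> sets borel" by (rule meas[OF S])
    show "(?T has_derivative ?T' y) (at y within ?S)" if "y \<in> ?S" for y
    proof -
      have "?s y \<in> S" using that rS by simp
      from has_derivative_compose[OF bounded_linear_imp_has_derivative[OF bounded_linear_reindex] T[OF this]]
      have "((\<lambda>y. T (?s y)) has_derivative (\<lambda>v. T' (?s y) (?s v))) (at y within ?S)" .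
      then show ?thesis by (rule bounded_linear.has_derivative[OF bounded_linear_reindex])
    qed
    show "inj_on ?T ?S"
    proof (rule inj_onI)
      fix x y assume "x \<in> ?S" "y \<in> ?S" "?T x = ?T y"
      then have "?s x \<in> S" "?s y \<in> S" "?s (?T x) = ?s (?T y)" by (simp_all add: rS)
      then have "?s x \<in> S" "?s y \<in> S" "T (?s x) = T (?s y)" by (simp_all add: rs)
      then have "?s x = ?s y" using inj by (simp add: inj_on_eq_iff)
      then have "?r (?s x) = ?r (?s y)" by simp
      then show "x = y" by (simp add: rs)
    qed
    show "0 \<le> f (?s y)" if "y \<in> ?T ` ?S" for y using that f unfolding TS' rS by simp
    show "(\<lambda>y. indicator (?T ` ?S) y * f (?s y)) \<in> borel_measurable borel"
      unfolding TS' ind1 by (rule measurable_compose[OF measurable_reindex m1])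
    show "(\<lambda>x. indicator ?S x * (\<bar>det (matrix (?T' x))\<bar> * f (?s (?T x)))) \<in> borel_measurable borel"
      unfolding detT ind1 rs by (rule measurable_compose[OF measurable_reindex m2])
  qed
  then have eq: "(\<integral>\<^sup>+y. ennreal (indicator (T ` S) (?s y) * f (?s y)) \<partial>lborel)
    = (\<integral>\<^sup>+y. ennreal (indicator S (?s y) * (\<bar>det (matrix (T' (?s y)))\<bar> * f (T (?s y)))) \<partial>lborel)"
    unfolding TS' detT ind1 rs .
  have [measurable]: "(\<lambda>y. ennreal (indicator (T ` S) y * f y)) \<in> borel_measurable borel"
    "(\<lambda>x. ennreal (indicator S x * (\<bar>det (matrix (T' x))\<bar> * f (T x)))) \<in> borel_measurable borel"
    using m1 m2 by measurable
  show ?thesis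
    using eq nn_integral_reindex[OF \<pi>, of "\<lambda>y. ennreal (indicator (T ` S) (?s y) * f (?s y))"]
      nn_integral_reindex[OF \<pi>, of "\<lambda>y. ennreal (indicator S (?s y) * (\<bar>det (matrix (T' (?s y)))\<bar> * f (T (?s y))))"]
      measurable_compose[OF measurable_reindex[of "inv \<pi>"], of "\<lambda>y. ennreal (indicator (T ` S) y * f y)"]
      measurable_compose[OF measurable_reindex[of "inv \<pi>"], of "\<lambda>x. ennreal (indicator S x * (\<bar>det (matrix (T' x))\<bar> * f (T x)))"]
    by (simp add: rs)
qed

section \<open>The Riemannian volume\<close>

context riemannian_manifold
begin

text \<open>The value that \<open>riemannian_volume\<close> is required to take on Borel sets inside
  the chart \<open>c\<close>.\<close>

definition chart_volume :: "('m, 'n) chart \<Rightarrow> 'm set \<Rightarrow> ennreal"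
  where "chart_volume c E = (\<integral>\<^sup>+x\<in>snd c ` E. ennreal (sqrt (det (g c x))) \<partial>lborel)"

lemma sets_chart_image: "c \<in> A \<Longrightarrow> chart_image c \<in> sets borel"
  by (intro borel_open open_chart_image)

lemma snd_image_eq:
  assumes "c \<in> A" "E \<subseteq> fst c" shows "snd c ` E = {x \<in> chart_image c. chart_inv c x \<in> E}"
proof
  show "snd c ` E \<subseteq> {x \<in> chart_image c. chart_inv c x \<in> E}" using assms by auto
  show "{x \<in> chart_image c. chart_inv c x \<in> E} \<subseteq> snd c ` E"
  proof clarify
    fix x assume "x \<in> chart_image c" "chart_inv c x \<in> E"
    then show "x \<in> snd c ` E" using snd_chart_inv[OF assms(1), of x] by (metis imageI)
  qed
qed

lemma measurable_chart_inv: "c \<in> A \<Longrightarrow> chart_inv c \<in> borel_measurable (restrict_space borel (chart_image c))"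
  by (intro borel_measurable_continuous_on_restrict continuous_on_chart_inv)

lemma sets_snd_image:
  assumes c: "c \<in> A" and E: "E \<in> sets borel" "E \<subseteq> fst c" shows "snd c ` E \<in> sets borel"
proof -
  have "chart_inv c -` E \<inter> space (restrict_space borel (chart_image c)) \<in> sets (restrict_space borel (chart_image c))"
    by (rule measurable_sets[OF measurable_chart_inv[OF c] E(1)])
  then have "chart_inv c -` E \<inter> chart_image c \<in> sets borel"
    using sets_chart_image[OF c] by (simp add: space_restrict_space sets_restrict_space_iff)
  then show ?thesis unfolding snd_image_eq[OF c E(2)] by (simp add: vimage_def Int_def conj_commute)
qed

lemma continuous_on_sqrt_det: "c \<in> A \<Longrightarrow> continuous_on (chart_image c) (\<lambda>x. sqrt (det (g c x)))"
  unfolding det_def by (intro continuous_intros metric_continuous)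

lemma measurable_sqrt_det:
  assumes "c \<in> A" "S \<in> sets borel" "S \<subseteq> chart_image c"
  shows "(\<lambda>x. indicator S x * sqrt (det (g c x))) \<in> borel_measurable borel"
proof -
  have "(\<lambda>x. indicator S x *\<^sub>R sqrt (det (g c x))) \<in> borel_measurable borel"
    by (intro borel_measurable_continuous_on_indicator assms
        continuous_on_subset[OF continuous_on_sqrt_det[OF assms(1)] assms(3)])
  then show ?thesis by simp
qed

lemma chart_volume_alt:
  "chart_volume c E = (\<integral>\<^sup>+x. ennreal (indicator (snd c ` E) x * sqrt (det (g c x))) \<partial>lborel)"
  unfolding chart_volume_def
  by (intro nn_integral_cong) (auto simp: indicator_def)

text \<open>Change of variables along the transition map; its Jacobian is exactly the ratio of the
  two densities. This makes the requirements imposed by different charts compatible.\<close>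

lemma chart_volume_cong:
  assumes c: "c \<in> A" "c' \<in> A" and E: "E \<in> sets borel" "E \<subseteq> fst c" "E \<subseteq> fst c'"
  shows "chart_volume c E = chart_volume c' E"
proof -
  let ?T = "transition c c'"
  let ?T' = "\<lambda>x. frechet_derivative ?T (at x)"
  let ?S = "snd c ` E"
  have So: "?S \<subseteq> overlap c c'" using E snd_in_overlap[OF c] by auto
  have TS: "?T ` ?S = snd c' ` E"
    using E transition_snd[OF c] by (auto simp: image_image intro!: image_cong)
  have eq: "indicator ?S x * (\<bar>det (matrix (?T' x))\<bar> * sqrt (det (g c' (?T x)))) = indicator ?S x * sqrt (det (g c x))" for x
    using metric_det_transition[OF c, of x] So by (cases "x \<in> ?S") auto
  have "chart_volume c' E = (\<integral>\<^sup>+y. ennreal (indicator (?T ` ?S) y * sqrt (det (g c' y))) \<partial>lborel)"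
    unfolding TS chart_volume_alt ..
  also have "\<dots> = (\<integral>\<^sup>+x. ennreal (indicator ?S x * (\<bar>det (matrix (?T' x))\<bar> * sqrt (det (g c' (?T x))))) \<partial>lborel)"
  proof (rule nn_integral_change_of_variables)
    show "?S \<in> sets borel" by (rule sets_snd_image[OF c(1) E(1,2)])
    show "?T ` ?S \<in> sets borel" unfolding TS by (rule sets_snd_image[OF c(2) E(1,3)])
    show "(?T has_derivative ?T' x) (at x)" if "x \<in> ?S" for x
      using that So by (intro transition_has_derivative[OF c]) auto
    show "inj_on ?T ?S"
      by (rule inj_on_inverseI[where g = "transition c' c"]) (use So transition_transition[OF c] in auto)
    show "0 \<le> sqrt (det (g c' y))" if "y \<in> ?T ` ?S" for y
      using that metric_det_pos[OF c(2), of y] E(3) unfolding TS by (auto simp: less_imp_le subset_iff)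
    show "(\<lambda>y. indicator (?T ` ?S) y * sqrt (det (g c' y))) \<in> borel_measurable borel"
      unfolding TS by (rule measurable_sqrt_det[OF c(2) sets_snd_image[OF c(2) E(1,3)]]) (use E in auto)
    show "(\<lambda>x. indicator ?S x * (\<bar>det (matrix (?T' x))\<bar> * sqrt (det (g c' (?T x))))) \<in> borel_measurable borel"
      unfolding eq by (rule measurable_sqrt_det[OF c(1) sets_snd_image[OF c(1) E(1,2)]]) (use E in auto)
  qed
  finally show ?thesis unfolding eq chart_volume_alt by simp
qed

text \<open>Second countability yields a countable cover by chart domains (Lindelof), which is then
  made disjoint. A measure can thus be assembled from, and compared on, countably many pieces that
  each lie in one chart.\<close>

lemma borel_chart_partition:
  "\<exists>C D. (\<forall>i::nat. C i \<in> A \<and> D i \<in> sets borel \<and> D i \<subseteq> fst (C i))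
     \<and> (\<Union>i. D i) = UNIV \<and> disjoint_family D"
proof -
  obtain F' where F': "F' \<subseteq> fst ` A" "countable F'" "\<Union>F' = \<Union>(fst ` A)"
    using Lindelof[of "fst ` A"] open_chart by blast
  then have U: "\<Union>F' = UNIV" using smooth_atlas unfolding smooth_atlas_def by blast
  then have ne: "F' \<noteq> {}" by auto
  have "\<exists>c. c \<in> A \<and> from_nat_into F' i = fst c" for i using from_nat_into[OF ne, of i] F'(1) by blast
  then obtain C where C: "\<And>i. C i \<in> A" "\<And>i. from_nat_into F' i = fst (C i)" by metis
  define D where "D = disjointed (\<lambda>i. fst (C i))"
  have o: "fst (C i) \<in> sets borel" for i by (rule borel_open[OF open_chart[OF C(1)]])
  have "D i \<in> sets borel \<and> D i \<subseteq> fst (C i)" for i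
    using sets.range_disjointed_sets[of "\<lambda>i. fst (C i)" borel] o
      disjointed_subset[of "\<lambda>i. fst (C i)" i] by (auto simp: D_def simp del: disjointed_subset)
  moreover have "(\<Union>i. D i) = UNIV"
    using range_from_nat_into[OF ne F'(2)] C(2) U by (simp add: D_def UN_disjointed_eq)
  moreover have "disjoint_family D" by (simp add: D_def disjoint_family_disjointed)
  ultimately show ?thesis using C(1) by blast
qed

text \<open>Inside one chart the volume is the measure with density sqrt(det g) pulled back along an
  injective map, so additivity is inherited from it.\<close>

lemma chart_volume_suminf:
  assumes c: "c \<in> A" and E: "\<And>n::nat. E n \<in> sets borel" "\<And>n. E n \<subseteq> fst c" "disjoint_family E"
  shows "(\<Sum>n. chart_volume c (E n)) = chart_volume c (\<Union>n. E n)"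
proof -
  let ?f = "\<lambda>x. ennreal (indicator (chart_image c) x * sqrt (det (g c x)))"
  have [measurable]: "?f \<in> borel_measurable lborel"
    using measurable_sqrt_det[OF c sets_chart_image[OF c]] by simp
  have v: "chart_volume c F = emeasure (density lborel ?f) (snd c ` F)" if "F \<in> sets borel" "F \<subseteq> fst c" for F
  proof -
    have "chart_volume c F = (\<integral>\<^sup>+x. ?f x * indicator (snd c ` F) x \<partial>lborel)"
      using that unfolding chart_volume_def
      by (intro nn_integral_cong) (auto simp: indicator_def subset_iff)
    also have "\<dots> = emeasure (density lborel ?f) (snd c ` F)"
      using sets_snd_image[OF c that] by (intro emeasure_density[symmetric]) auto
    finally show ?thesis .
  qed
  have disj: "disjoint_family (\<lambda>n. snd c ` E n)"
    using E(3) unfolding disjoint_family_on_def snd_image_eq[OF c E(2)] by blast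
  have "(\<Sum>n. chart_volume c (E n)) = (\<Sum>n. emeasure (density lborel ?f) (snd c ` E n))"
    using v E by simp
  also have "\<dots> = emeasure (density lborel ?f) (\<Union>n. snd c ` E n)"
    by (rule suminf_emeasure[OF _ disj]) (use sets_snd_image[OF c] E in auto)
  also have "\<dots> = chart_volume c (\<Union>n. E n)"
    using E by (subst v) (auto simp: image_UN)
  finally show ?thesis .
qed

text \<open>The predicate under \<open>THE\<close> in \<open>riemannian_volume\<close>. Existence
  and uniqueness are proved next, since without both the definite description would say
  nothing.\<close>

definition volume_condition :: "'m measure \<Rightarrow> bool"
  where "volume_condition \<mu> \<longleftrightarrow> sets \<mu> = sets borel \<and>
    (\<forall>c\<in>A. \<forall>E\<in>sets borel. E \<subseteq> fst c \<longrightarrow> emeasure \<mu> E = chart_volume c E)"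

lemma volume_condition_unique:
  assumes "volume_condition \<mu>" "volume_condition \<nu>" shows "\<mu> = \<nu>"
proof -
  obtain C D where C: "\<And>i::nat. C i \<in> A" and D: "\<And>i. D i \<in> sets borel" "\<And>i. D i \<subseteq> fst (C i)"
    and DU: "(\<Union>i. D i) = UNIV" and dD: "disjoint_family D"
    using borel_chart_partition by blast
  show ?thesis
  proof (rule measure_eqI)
    show "sets \<mu> = sets \<nu>" using assms by (simp add: volume_condition_def)
    fix E assume "E \<in> sets \<mu>"
    then have E: "E \<in> sets borel" using assms by (simp add: volume_condition_def)
    have s: "emeasure M E = (\<Sum>i. chart_volume (C i) (E \<inter> D i))" if M: "volume_condition M" for M
    proof -
      have "(\<Sum>i. chart_volume (C i) (E \<inter> D i)) = (\<Sum>i. emeasure M (E \<inter> D i))"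
      proof (intro suminf_cong)
        fix i
        have "E \<inter> D i \<subseteq> fst (C i)" "E \<inter> D i \<in> sets borel" using D E by auto
        then show "chart_volume (C i) (E \<inter> D i) = emeasure M (E \<inter> D i)"
          using M C unfolding volume_condition_def by metis
      qed
      also have "\<dots> = emeasure M (\<Union>i. E \<inter> D i)"
      proof (intro suminf_emeasure)
        show "disjoint_family (\<lambda>i. E \<inter> D i)" using dD unfolding disjoint_family_on_def by blast
      qed (use M D E in \<open>auto simp: volume_condition_def\<close>)
      also have "(\<Union>i. E \<inter> D i) = E" using DU by auto
      finally show ?thesis ..
    qed
    show "emeasure \<mu> E = emeasure \<nu> E" using s assms by simp
  qed
qed

text \<open>The measure of \<open>E\<close> is defined as the sum of the chart volumes of its
  pieces. For \<open>E\<close> inside an arbitrary chart \<open>c\<close>, every piece may be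
  measured in \<open>c\<close> instead, and the pieces add up again.\<close>

lemma volume_condition_exists: "\<exists>\<mu>. volume_condition \<mu>"
proof -
  obtain C D where C: "\<And>i::nat. C i \<in> A" and D: "\<And>i. D i \<in> sets borel" "\<And>i. D i \<subseteq> fst (C i)"
    and DU: "(\<Union>i. D i) = UNIV" and dD: "disjoint_family D"
    using borel_chart_partition by blast
  define vol where "vol E = (\<Sum>i. chart_volume (C i) (E \<inter> D i))" for E
  define \<mu> where "\<mu> = measure_of UNIV (sets borel) vol"
  have sets: "sets \<mu> = sets borel" unfolding \<mu>_def
    by (metis sets.sets_measure_of_eq space_borel)
  have em: "emeasure \<mu> E = vol E" if "E \<in> sets borel" for E
    unfolding \<mu>_def
  proof (rule emeasure_measure_of_sigma[OF _ _ _ that])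
    show "sigma_algebra UNIV (sets (borel :: 'm measure))"
      using sets.sigma_algebra_axioms[of "borel :: 'm measure"] by simp
    show "positive (sets borel) vol" by (simp add: positive_def vol_def chart_volume_def)
    show "countably_additive (sets borel) vol"
      unfolding countably_additive_def
    proof (intro allI impI)
      fix F :: "nat \<Rightarrow> 'm set"
      assume F: "range F \<subseteq> sets borel" "disjoint_family F"
      \<comment> \<open>The sum over pieces is written as an integral against counting measure, so
        that the two sums can be exchanged.\<close>
      have "(\<Sum>n. vol (F n)) = (\<Sum>n. \<integral>\<^sup>+i. chart_volume (C i) (F n \<inter> D i) \<partial>count_space UNIV)"
        by (simp add: vol_def nn_integral_count_space_nat)
      also have "\<dots> = (\<integral>\<^sup>+i. (\<Sum>n. chart_volume (C i) (F n \<inter> D i)) \<partial>count_space UNIV)"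
        by (rule nn_integral_suminf[symmetric]) simp
      also have "\<dots> = (\<integral>\<^sup>+i. chart_volume (C i) (\<Union>n. F n \<inter> D i) \<partial>count_space UNIV)"
      proof (intro nn_integral_cong chart_volume_suminf)
        fix i show "disjoint_family (\<lambda>n. F n \<inter> D i)" using F(2) unfolding disjoint_family_on_def by blast
      qed (use C D F in auto)
      also have "\<dots> = vol (\<Union>n. F n)" by (simp add: vol_def nn_integral_count_space_nat Int_UN_distrib2)
      finally show "(\<Sum>n. vol (F n)) = vol (\<Union> (range F))" .
    qed
  qed
  have "emeasure \<mu> E = chart_volume c E" if c: "c \<in> A" and E: "E \<in> sets borel" "E \<subseteq> fst c" for c E
  proof -
    have "chart_volume (C i) (E \<inter> D i) = chart_volume c (E \<inter> D i)" for i
      using D E by (intro chart_volume_cong C c) auto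
    then have "emeasure \<mu> E = (\<Sum>i. chart_volume c (E \<inter> D i))" using em[OF E(1)] by (simp add: vol_def)
    also have "\<dots> = chart_volume c (\<Union>i. E \<inter> D i)"
    proof (intro chart_volume_suminf c)
      show "disjoint_family (\<lambda>i. E \<inter> D i)" using dD unfolding disjoint_family_on_def by blast
    qed (use D E in auto)
    also have "(\<Union>i. E \<inter> D i) = E" using DU by auto
    finally show ?thesis .
  qed
  with sets show ?thesis unfolding volume_condition_def by blast
qed

abbreviation vol_measure :: "'m measure" ("\<mu>\<^sub>g") where "\<mu>\<^sub>g \<equiv> riemannian_volume A g"

lemma volume_condition_riemannian_volume: "volume_condition \<mu>\<^sub>g"
proof -
  have "\<exists>!\<mu>. volume_condition \<mu>" using volume_condition_exists volume_condition_unique by blast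
  from theI'[OF this] show ?thesis
    unfolding riemannian_volume_def volume_condition_def chart_volume_def .
qed

lemma sets_volume [measurable_cong]: "sets \<mu>\<^sub>g = sets borel"
  using volume_condition_riemannian_volume by (simp add: volume_condition_def)

lemma space_volume [simp]: "space \<mu>\<^sub>g = UNIV"
  using sets_eq_imp_space_eq[OF sets_volume] by simp

lemma emeasure_volume: "c \<in> A \<Longrightarrow> E \<in> sets borel \<Longrightarrow> E \<subseteq> fst c \<Longrightarrow> emeasure \<mu>\<^sub>g E = chart_volume c E"
  using volume_condition_riemannian_volume by (simp add: volume_condition_def)

text \<open>Off \<open>chart_image c\<close> the density vanishes and
  the value \<open>p\<close> is irrelevant.\<close>

lemma density_volume_chart:
  assumes c: "c \<in> A"
  shows "density \<mu>\<^sub>g (indicator (fst c)) =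
    distr (density lborel (\<lambda>x. ennreal (indicator (chart_image c) x * sqrt (det (g c x))))) borel
      (\<lambda>x. if x \<in> chart_image c then chart_inv c x else p)"
    and "(\<lambda>x. if x \<in> chart_image c then chart_inv c x else p) \<in> borel_measurable borel"
proof -
  let ?f = "\<lambda>x. ennreal (indicator (chart_image c) x * sqrt (det (g c x)))"
  let ?\<Phi> = "\<lambda>x. if x \<in> chart_image c then chart_inv c x else p"
  show \<Phi>: "?\<Phi> \<in> borel_measurable borel"
    using measurable_chart_inv[OF c] sets_chart_image[OF c] by (subst (asm) measurable_restrict_space_iff) auto
  have [measurable]: "?f \<in> borel_measurable lborel"
    using measurable_sqrt_det[OF c sets_chart_image[OF c]] by simp
  have o [measurable]: "fst c \<in> sets borel" by (rule borel_open[OF open_chart[OF c]])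
  have \<Phi>' [measurable]: "?\<Phi> \<in> measurable (density lborel ?f) borel" using \<Phi> by simp
  show "density \<mu>\<^sub>g (indicator (fst c)) = distr (density lborel ?f) borel ?\<Phi>"
  proof (rule measure_eqI)
    fix E assume "E \<in> sets (density \<mu>\<^sub>g (indicator (fst c)))"
    then have E [measurable]: "E \<in> sets borel" by (simp add: sets_volume)
    have E' [measurable]: "E \<in> sets \<mu>\<^sub>g" by (simp add: sets_volume)
    have "emeasure (density \<mu>\<^sub>g (indicator (fst c))) E = emeasure \<mu>\<^sub>g (fst c \<inter> E)"
    proof -
      have "emeasure (density \<mu>\<^sub>g (indicator (fst c))) E = (\<integral>\<^sup>+x. indicator (fst c) x * indicator E x \<partial>\<mu>\<^sub>g)"
        by (rule emeasure_density) (use o sets_volume E' in auto)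
      also have "\<dots> = (\<integral>\<^sup>+x. indicator (fst c \<inter> E) x \<partial>\<mu>\<^sub>g)" by (simp add: indicator_inter_arith)
      also have "\<dots> = emeasure \<mu>\<^sub>g (fst c \<inter> E)" by (rule nn_integral_indicator) (use o E sets_volume in auto)
      finally show ?thesis .
    qed
    also have "\<dots> = chart_volume c (fst c \<inter> E)" by (rule emeasure_volume[OF c]) auto
    also have "\<dots> = (\<integral>\<^sup>+x. ?f x * indicator (?\<Phi> -` E \<inter> UNIV) x \<partial>lborel)"
      unfolding chart_volume_alt snd_image_eq[OF c Int_lower1]
      using c by (intro nn_integral_cong) (auto simp: indicator_def)
    also have "\<dots> = emeasure (density lborel ?f) (?\<Phi> -` E \<inter> UNIV)"
      using measurable_sets[OF \<Phi> E] by (subst emeasure_density) auto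
    also have "\<dots> = emeasure (distr (density lborel ?f) borel ?\<Phi>) E"
      by (subst emeasure_distr[OF \<Phi>' E]) simp
    finally show "emeasure (density \<mu>\<^sub>g (indicator (fst c))) E = emeasure (distr (density lborel ?f) borel ?\<Phi>) E" .
  qed (simp add: sets_volume)
qed

lemma integral_volume_chart:
  fixes h :: "'m \<Rightarrow> real"
  assumes c: "c \<in> A" and h: "h \<in> borel_measurable borel" and supp: "\<And>p. p \<notin> fst c \<Longrightarrow> h p = 0"
  shows "integrable \<mu>\<^sub>g h \<longleftrightarrow>
      integrable lborel (\<lambda>x. indicator (chart_image c) x * (sqrt (det (g c x)) * h (chart_inv c x)))" (is ?A)
    and "(\<integral>p. h p \<partial>\<mu>\<^sub>g) =
      (\<integral>x. indicator (chart_image c) x * (sqrt (det (g c x)) * h (chart_inv c x)) \<partial>lborel)" (is ?B)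
proof -
  \<comment> \<open>An arbitrary default for the inverse chart off its image, where the density is
    0.\<close>
  fix p0 :: 'm
  let ?d = "\<lambda>x. indicator (chart_image c) x * sqrt (det (g c x))"
  let ?\<Phi> = "\<lambda>x. if x \<in> chart_image c then chart_inv c x else p0"
  note eq = density_volume_chart(1)[OF c, of p0] and \<Phi> = density_volume_chart(2)[OF c, of p0]
  have d [measurable]: "?d \<in> borel_measurable lborel"
    using measurable_sqrt_det[OF c sets_chart_image[OF c]] by simp
  have d0: "0 \<le> ?d x" for x using metric_det_pos[OF c, of x] by (auto simp: indicator_def less_imp_le)
  have o: "fst c \<in> sets borel" by (rule borel_open[OF open_chart[OF c]])
  have \<Phi>' : "?\<Phi> \<in> measurable (density lborel (\<lambda>x. ennreal (?d x))) borel" using \<Phi> by simp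
  have h' [measurable]: "h \<in> borel_measurable \<mu>\<^sub>g" using h by (simp add: measurable_cong_sets[OF sets_volume refl])
  have h\<Phi>: "(\<lambda>x. h (?\<Phi> x)) \<in> borel_measurable lborel" using measurable_compose[OF \<Phi> h] by simp
  have i: "indicator (fst c) = (\<lambda>p. ennreal (indicator (fst c) p))" by (simp add: fun_eq_iff ennreal_indicator)
  have im: "(\<lambda>p. indicator (fst c) p :: real) \<in> borel_measurable \<mu>\<^sub>g" using o by (simp add: sets_volume)
  have hh: "(\<lambda>p. indicator (fst c) p *\<^sub>R h p) = h" using supp by (auto simp: fun_eq_iff indicator_def)
  have dd: "(\<lambda>x. ?d x *\<^sub>R h (?\<Phi> x)) = (\<lambda>x. indicator (chart_image c) x * (sqrt (det (g c x)) * h (chart_inv c x)))"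
    by (auto simp: fun_eq_iff indicator_def)
  have "integrable \<mu>\<^sub>g h \<longleftrightarrow> integrable (density \<mu>\<^sub>g (indicator (fst c))) h"
    unfolding i using integrable_density[OF h' im] unfolding hh by simp
  also have "\<dots> \<longleftrightarrow> integrable (density lborel (\<lambda>x. ennreal (?d x))) (\<lambda>x. h (?\<Phi> x))"
    unfolding eq by (rule integrable_distr_eq[OF \<Phi>' h])
  also have "\<dots> \<longleftrightarrow> integrable lborel (\<lambda>x. ?d x *\<^sub>R h (?\<Phi> x))"
    by (rule integrable_density[OF h\<Phi> d]) (use d0 in simp)
  finally show ?A unfolding dd .
  have "(\<integral>p. h p \<partial>\<mu>\<^sub>g) = (\<integral>p. h p \<partial>density \<mu>\<^sub>g (indicator (fst c)))"
    unfolding i using integral_density[OF h' im] unfolding hh by simp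
  also have "\<dots> = (\<integral>x. h (?\<Phi> x) \<partial>density lborel (\<lambda>x. ennreal (?d x)))"
    unfolding eq by (rule integral_distr[OF \<Phi>' h])
  also have "\<dots> = (\<integral>x. ?d x *\<^sub>R h (?\<Phi> x) \<partial>lborel)"
    by (rule integral_density[OF h\<Phi> d]) (use d0 in simp)
  finally show ?B unfolding dd .
qed

lemma chart_volume_finite:
  assumes c: "c \<in> A" and K: "compact K" "K \<subseteq> chart_image c"
  shows "emeasure \<mu>\<^sub>g (chart_inv c ` K) < \<infinity>"
proof -
  have "compact (chart_inv c ` K)"
    by (intro compact_continuous_image continuous_on_subset[OF continuous_on_chart_inv[OF c]] K)
  then have B: "chart_inv c ` K \<in> sets borel" by (intro borel_closed compact_imp_closed)
  have sub: "chart_inv c ` K \<subseteq> fst c" using K c by auto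
  have img: "snd c ` chart_inv c ` K = K" using K c by (force simp: image_image)
  have "integrable lborel (\<lambda>x. indicator K x *\<^sub>R sqrt (det (g c x)))"
    by (intro borel_integrable_compact K continuous_on_subset[OF continuous_on_sqrt_det[OF c]])
  then have "(\<integral>\<^sup>+x. ennreal (norm (indicator K x *\<^sub>R sqrt (det (g c x)))) \<partial>lborel) < \<infinity>"
    unfolding integrable_iff_bounded by blast
  moreover have "(\<integral>\<^sup>+x. ennreal (norm (indicator K x *\<^sub>R sqrt (det (g c x)))) \<partial>lborel) = chart_volume c (chart_inv c ` K)"
    unfolding chart_volume_alt img using K metric_det_pos[OF c]
    by (intro nn_integral_cong) (auto simp: indicator_def less_imp_le subset_iff)
  ultimately show ?thesis using emeasure_volume[OF c B sub] by simp
qed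

text \<open>The density is positive, so volume 0 would make a nonempty open set of coordinates
  Lebesgue negligible. This is what allows an integral statement to be turned into a pointwise
  one.\<close>

lemma volume_open_pos:
  assumes U: "open U" "U \<noteq> {}" shows "emeasure \<mu>\<^sub>g U > 0"
proof -
  obtain p where p: "p \<in> U" using U by blast
  let ?c = "chart_at A p"
  note c = chart_at[of p]
  let ?V = "U \<inter> fst ?c"
  have Vo: "open ?V" using U open_chart[OF c(1)] by blast
  then have V: "?V \<in> sets borel" by (rule borel_open)
  have "snd ?c ` ?V = chart_image ?c \<inter> chart_inv ?c -` ?V"
    unfolding snd_image_eq[OF c(1) Int_lower2] by auto
  moreover have "open (chart_image ?c \<inter> chart_inv ?c -` ?V)"
    by (rule continuous_open_preimage[OF continuous_on_chart_inv[OF c(1)] open_chart_image[OF c(1)] Vo])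
  ultimately have W: "open (snd ?c ` ?V)" by simp
  have "emeasure \<mu>\<^sub>g ?V \<noteq> 0"
  proof
    assume "emeasure \<mu>\<^sub>g ?V = 0"
    then have "(\<integral>\<^sup>+x. ennreal (indicator (snd ?c ` ?V) x * sqrt (det (g ?c x))) \<partial>lborel) = 0"
      using emeasure_volume[OF c(1) V] unfolding chart_volume_alt by simp
    moreover have m: "(\<lambda>x. indicator (snd ?c ` ?V) x * sqrt (det (g ?c x))) \<in> borel_measurable lborel"
      using measurable_sqrt_det[OF c(1) sets_snd_image[OF c(1) V]]
      by (simp add: image_subset_iff)
    ultimately have "AE x in lborel. ennreal (indicator (snd ?c ` ?V) x * sqrt (det (g ?c x))) = 0"
      by (subst (asm) nn_integral_0_iff_AE) auto
    then have "AE x in lborel. x \<notin> snd ?c ` ?V"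
    proof eventually_elim
      case (elim x)
      show ?case
      proof
        assume x: "x \<in> snd ?c ` ?V"
        then have "x \<in> chart_image ?c" by (auto simp: chart_image_def)
        then show False using elim x metric_det_pos[OF c(1), of x] by (simp add: ennreal_eq_0_iff)
      qed
    qed
    then have "emeasure lborel (snd ?c ` ?V) = 0"
      using W by (subst (asm) AE_iff_measurable[OF _ refl]) auto
    then have "snd ?c ` ?V = {}"
      using W open_not_negligible[of "snd ?c ` ?V"] by (auto simp: negligible_iff_emeasure0 emeasure_completion)
    then show False using p c by auto
  qed
  then have "0 < emeasure \<mu>\<^sub>g ?V" by (simp add: zero_less_iff_neq_zero)
  also have "\<dots> \<le> emeasure \<mu>\<^sub>g U" by (rule emeasure_mono) (use U sets_volume in auto)
  finally show ?thesis .
qed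

end

section \<open>The Riemannian distance\<close>

text \<open>Needed for concatenated curves, which are treated separately on the two open halves of
  the parameter interval. An open neighbourhood of a point does not affect continuity of the
  derivative there.\<close>

lemma C1_differentiable_on_local:
  assumes "\<And>x. x \<in> T \<Longrightarrow> \<exists>J. open J \<and> x \<in> J \<and> f C1_differentiable_on (T \<inter> J)"
  shows "f C1_differentiable_on T"
  unfolding C1_differentiable_on_eq
proof (intro conjI ballI)
  fix x assume x: "x \<in> T"
  then obtain J where "open J" "x \<in> J" "f C1_differentiable_on (T \<inter> J)" using assms by blast
  then show "f differentiable at x" using x by (simp add: C1_differentiable_on_eq)
next
  show "continuous_on T (\<lambda>x. vector_derivative f (at x))"
    unfolding continuous_on_eq_continuous_within
  proof
    fix x assume x: "x \<in> T"
    then obtain J where J: "open J" "x \<in> J" "f C1_differentiable_on (T \<inter> J)" using assms by blast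
    then have "continuous (at x within T \<inter> J) (\<lambda>x. vector_derivative f (at x))"
      using x by (simp add: C1_differentiable_on_eq continuous_on_eq_continuous_within)
    moreover have "at x within T \<inter> J = at x within T"
      using J(1,2) by (intro at_within_nhd[of x J]) auto
    ultimately show "continuous (at x within T) (\<lambda>x. vector_derivative f (at x))" by simp
  qed
qed

lemma C1_differentiable_on_cong_open:
  assumes "open J" "T \<subseteq> J" "\<And>x. x \<in> J \<Longrightarrow> f x = h x" "f C1_differentiable_on T"
  shows "h C1_differentiable_on T"
proof -
  obtain D where D: "\<And>x. x \<in> T \<Longrightarrow> (f has_vector_derivative D x) (at x)" "continuous_on T D"
    using assms(4) unfolding C1_differentiable_on_def by blast
  have "(h has_vector_derivative D x) (at x)" if "x \<in> T" for x
    using has_vector_derivative_transform_within_open[OF D(1)[OF that] assms(1)] assms(2,3) that by blast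
  with D(2) show ?thesis unfolding C1_differentiable_on_def by blast
qed

lemma AE_notin_finite: "finite (F :: real set) \<Longrightarrow> AE t in lborel. t \<notin> F"
  by (intro AE_not_in null_setsI emeasure_lborel_countable countable_finite) (auto intro: sets.countable countable_finite)

lemma has_vector_derivative_affine:
  assumes "(f has_vector_derivative D) (at (m * t + k :: real))"
  shows "((\<lambda>t. f (m * t + k)) has_vector_derivative m *\<^sub>R D) (at t)"
proof -
  have "((\<lambda>t. m * t + k) has_vector_derivative m) (at t)"
    by (auto intro!: derivative_eq_intros simp: has_real_derivative_iff_has_vector_derivative[symmetric])
  from vector_diff_chain_at[OF this assms] show ?thesis by (simp add: o_def)
qed

context riemannian_manifold
begin

text \<open>The exceptional times are made explicit because they have to be carried through
  reparametrisations and joins.\<close>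

definition C1_curve_off :: "(real \<Rightarrow> 'm) \<Rightarrow> real set \<Rightarrow> bool"
  where "C1_curve_off \<gamma> S \<longleftrightarrow> path \<gamma> \<and> finite S \<and>
    (\<forall>c\<in>A. (snd c \<circ> \<gamma>) C1_differentiable_on ({0<..<1} \<inter> \<gamma> -` fst c - S))"

lemma piecewise_C1_curve_iff: "piecewise_C1_curve A \<gamma> \<longleftrightarrow> (\<exists>S. C1_curve_off \<gamma> S)"
  unfolding piecewise_C1_curve_def C1_curve_off_def by blast

lemma open_curve_preimage:
  assumes "path \<gamma>" "c \<in> A" shows "open ({0<..<1} \<inter> \<gamma> -` fst c)"
proof -
  have "continuous_on {0<..<1} \<gamma>"
    using assms(1) unfolding path_def by (rule continuous_on_subset) auto
  from continuous_open_preimage[OF this _ open_chart[OF assms(2)]] show ?thesis by auto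
qed

lemma curve_has_vector_derivative:
  assumes "C1_curve_off \<gamma> S" "c \<in> A" "t \<in> {0<..<1} - S" "\<gamma> t \<in> fst c"
  shows "((snd c \<circ> \<gamma>) has_vector_derivative vector_derivative (snd c \<circ> \<gamma>) (at t)) (at t)"
  using assms unfolding C1_curve_off_def C1_differentiable_on_eq
  by (auto simp: vector_derivative_works[symmetric])

text \<open>The velocity transforms by the differential of the transition map, which is an isometry
  between the two coordinate norms.\<close>

lemma speed_in_chart:
  assumes \<gamma>: "path \<gamma>" "t \<in> {0<..<1}" and c: "c \<in> A" "\<gamma> t \<in> fst c"
    and D: "((snd c \<circ> \<gamma>) has_vector_derivative D) (at t)"
  shows "speed A g \<gamma> t = gnorm c (snd c (\<gamma> t)) D"
proof -
  let ?d = "chart_at A (\<gamma> t)"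
  let ?T = "transition c ?d"
  let ?x = "snd c (\<gamma> t)"
  note d = chart_at[of "\<gamma> t"]
  have x: "?x \<in> overlap c ?d" by (rule snd_in_overlap[OF c(1) d(1) c(2) d(2)])
  have "((?T \<circ> (snd c \<circ> \<gamma>)) has_vector_derivative frechet_derivative ?T (at ?x) D) (at t)"
    using diff_chain_at[OF D[unfolded has_vector_derivative_def]] transition_has_derivative[OF c(1) d(1) x]
      linear_cmul[OF has_derivative_linear[OF transition_has_derivative[OF c(1) d(1) x]]]
    unfolding has_vector_derivative_def by (fastforce simp: o_def)
  then have "((snd ?d \<circ> \<gamma>) has_vector_derivative frechet_derivative ?T (at ?x) D) (at t)"
  proof (rule has_vector_derivative_transform_within_open)
    show "open ({0<..<1} \<inter> \<gamma> -` fst c)" by (rule open_curve_preimage[OF \<gamma>(1) c(1)])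
  qed (use \<gamma> c transition_snd[OF c(1) d(1)] in auto)
  then have "vector_derivative (snd ?d \<circ> \<gamma>) (at t) = frechet_derivative ?T (at ?x) D"
    by (rule vector_derivative_at)
  then have "speed A g \<gamma> t = gnorm ?d (?T ?x) (frechet_derivative ?T (at ?x) D)"
    using transition_snd[OF c(1) d(1) c(2)] by (simp add: speed_def Let_def gnorm_def)
  then show ?thesis using gnorm_transition[OF c(1) d(1) x] by simp
qed

lemma speed_eq:
  assumes "C1_curve_off \<gamma> S" "c \<in> A" "t \<in> {0<..<1} - S" "\<gamma> t \<in> fst c"
  shows "speed A g \<gamma> t = gnorm c (snd c (\<gamma> t)) (vector_derivative (snd c \<circ> \<gamma>) (at t))"
  using assms by (intro speed_in_chart curve_has_vector_derivative) (auto simp: C1_curve_off_def)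

text \<open>The chart used by \<open>speed\<close> may change from time to time without any
  regularity; near a given time the speed is computed in one fixed chart instead. The purpose is
  measurability of the integrand of the length.\<close>

lemma continuous_on_speed:
  assumes "C1_curve_off \<gamma> S" shows "continuous_on ({0<..<1} - S) (speed A g \<gamma>)"
proof (rule continuous_at_imp_continuous_on, intro ballI)
  fix t assume t: "t \<in> {0<..<1} - S"
  define c where "c = chart_at A (\<gamma> t)"
  have c: "c \<in> A" "\<gamma> t \<in> fst c" using chart_at by (auto simp: c_def)
  let ?J = "{0<..<1} \<inter> \<gamma> -` fst c - S"
  have p: "path \<gamma>" "finite S" using assms by (auto simp: C1_curve_off_def)
  have J: "open ?J" using open_curve_preimage[OF p(1) c(1)] p(2) by (simp add: open_Diff finite_imp_closed)
  have \<gamma>: "continuous_on ?J \<gamma>"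
    using p(1) unfolding path_def by (rule continuous_on_subset) auto
  have "continuous_on ?J (\<lambda>t. gnorm c ((snd c \<circ> \<gamma>) t) (vector_derivative (snd c \<circ> \<gamma>) (at t)))"
  proof (rule continuous_on_gnorm[OF c(1)])
    show "continuous_on ?J (snd c \<circ> \<gamma>)"
      by (rule continuous_on_compose[OF \<gamma> continuous_on_subset[OF continuous_on_chart[OF c(1)]]]) auto
    show "(snd c \<circ> \<gamma>) ` ?J \<subseteq> chart_image c" by auto
    show "continuous_on ?J (\<lambda>t. vector_derivative (snd c \<circ> \<gamma>) (at t))"
      using assms c(1) unfolding C1_curve_off_def C1_differentiable_on_eq by blast
  qed
  then have "continuous_on ?J (speed A g \<gamma>)"
    by (rule continuous_on_eq) (use speed_eq[OF assms c(1)] in auto)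
  then show "isCont (speed A g \<gamma>) t" using J t c by (simp add: continuous_on_eq_continuous_at)
qed

lemma measurable_speed:
  assumes "C1_curve_off \<gamma> S" "I \<in> sets borel" "I \<subseteq> {0<..<1} - S"
  shows "(\<lambda>t. indicator I t * speed A g \<gamma> t) \<in> borel_measurable borel"
proof -
  have "(\<lambda>t. indicator I t *\<^sub>R speed A g \<gamma> t) \<in> borel_measurable borel"
    by (rule borel_measurable_continuous_on_indicator[OF assms(2)
        continuous_on_subset[OF continuous_on_speed[OF assms(1)] assms(3)]])
  then show ?thesis by simp
qed

definition length_on :: "(real \<Rightarrow> 'm) \<Rightarrow> real set \<Rightarrow> ennreal"
  where "length_on \<gamma> I = (\<integral>\<^sup>+t\<in>I. ennreal (speed A g \<gamma> t) \<partial>lborel)"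

lemma curve_length_eq: "curve_length A g \<gamma> = length_on \<gamma> {0..1}"
  by (simp add: curve_length_def length_on_def)

lemma length_on_cong_finite:
  assumes "finite F" "\<And>t. t \<notin> F \<Longrightarrow> t \<in> I \<longleftrightarrow> t \<in> J"
  shows "length_on \<gamma> I = length_on \<gamma> J"
  unfolding length_on_def
proof (rule nn_integral_cong_AE)
  show "AE t in lborel. ennreal (speed A g \<gamma> t) * indicator I t = ennreal (speed A g \<gamma> t) * indicator J t"
    using AE_notin_finite[OF assms(1)] by eventually_elim (use assms(2) in \<open>auto simp: indicator_def\<close>)
qed

lemma length_on_alt: "length_on \<gamma> I = (\<integral>\<^sup>+t. ennreal (indicator I t * speed A g \<gamma> t) \<partial>lborel)"
  unfolding length_on_def by (intro nn_integral_cong) (simp add: indicator_def)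

lemma length_on_add:
  assumes \<gamma>: "C1_curve_off \<gamma> S" and "0 \<le> a" "a \<le> b" "b \<le> c" "c \<le> 1"
  shows "length_on \<gamma> {a..c} = length_on \<gamma> {a..b} + length_on \<gamma> {b..c}"
proof -
  have S: "finite S" using \<gamma> by (simp add: C1_curve_off_def)
  let ?I = "{a<..<b} - S" and ?J = "{b<..<c} - S"
  have b: "?I \<in> sets borel" "?J \<in> sets borel"
    using S by (auto intro!: borel_open open_Diff finite_imp_closed)
  have m: "(\<lambda>t. indicator ?I t * speed A g \<gamma> t) \<in> borel_measurable lborel"
    "(\<lambda>t. indicator ?J t * speed A g \<gamma> t) \<in> borel_measurable lborel"
    using measurable_speed[OF \<gamma> b(1)] measurable_speed[OF \<gamma> b(2)] assms by (auto simp: subset_iff)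
  have f: "finite (S \<union> {a, b, c})" using S by simp
  have "length_on \<gamma> {a..c} = length_on \<gamma> (?I \<union> ?J)"
    by (rule length_on_cong_finite[OF f]) (use assms in auto)
  also have "\<dots> = (\<integral>\<^sup>+t. ennreal (indicator ?I t * speed A g \<gamma> t) + ennreal (indicator ?J t * speed A g \<gamma> t) \<partial>lborel)"
    unfolding length_on_alt by (intro nn_integral_cong) (auto simp: indicator_def)
  also have "\<dots> = length_on \<gamma> ?I + length_on \<gamma> ?J"
    unfolding length_on_alt by (rule nn_integral_add) (use m in measurable)
  also have "length_on \<gamma> ?I = length_on \<gamma> {a..b}" by (rule length_on_cong_finite[OF f]) auto
  also have "length_on \<gamma> ?J = length_on \<gamma> {b..c}" by (rule length_on_cong_finite[OF f]) auto
  finally show ?thesis .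
qed

text \<open>The speed gains the factor |m| and the time differential loses it. Negative
  \<open>m\<close> is included, so that curves can be reversed.\<close>

lemma length_on_reparametrize:
  assumes \<gamma>: "C1_curve_off \<gamma> S" and m: "m \<noteq> 0"
    and \<eta>: "\<And>t. t \<in> {a<..<b} \<Longrightarrow> \<eta> t = \<gamma> (m * t + k) \<and> m * t + k \<in> {0<..<1}"
  shows "length_on \<eta> {a..b} = length_on \<gamma> ((\<lambda>t. m * t + k) ` {a..b})"
proof -
  have S: "finite S" using \<gamma> by (simp add: C1_curve_off_def)
  let ?a = "\<lambda>t. m * t + k"
  let ?J = "{a<..<b} - ?a -` S"
  have "inj ?a" using m by (auto simp: inj_on_def)
  then have fin: "finite (?a -` S)" using S by (simp add: finite_vimageI)
  have J: "open ?J" using fin by (simp add: open_Diff finite_imp_closed)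
  have aJ: "?a ` ?J = {u. (u - k) / m \<in> ?J}"
  proof (intro set_eqI iffI)
    fix u assume "u \<in> {u. (u - k) / m \<in> ?J}"
    then have "(u - k) / m \<in> ?J" by simp
    moreover have "u = ?a ((u - k) / m)" using m by simp
    ultimately show "u \<in> ?a ` ?J" by (rule rev_image_eqI)
  qed (use m in auto)
  have "?a ` ?J = (\<lambda>u. (u - k) / m) -` ?J \<inter> space borel" unfolding aJ by auto
  also have "\<dots> \<in> sets borel"
    by (rule measurable_sets[of _ borel borel]) (use J in auto)
  finally have aJb: "?a ` ?J \<in> sets borel" .
  have sub: "?a ` ?J \<subseteq> {0<..<1} - S" using \<eta> by auto
  have sp: "speed A g \<eta> t = \<bar>m\<bar> * speed A g \<gamma> (?a t)" if t: "t \<in> ?J" for t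
  proof -
    define c where "c = chart_at A (\<gamma> (?a t))"
    have c: "c \<in> A" "\<gamma> (?a t) \<in> fst c" using chart_at by (auto simp: c_def)
    let ?D = "vector_derivative (snd c \<circ> \<gamma>) (at (?a t))"
    have "((snd c \<circ> \<gamma>) has_vector_derivative ?D) (at (?a t))"
      by (rule curve_has_vector_derivative[OF \<gamma> c(1) _ c(2)]) (use sub t in blast)
    from has_vector_derivative_affine[OF this]
    have "((snd c \<circ> \<eta>) has_vector_derivative m *\<^sub>R ?D) (at t)"
      by (rule has_vector_derivative_transform_within_open[OF _ J t]) (use \<eta> in auto)
    then have "vector_derivative (snd c \<circ> \<eta>) (at t) = m *\<^sub>R ?D" by (rule vector_derivative_at)
    moreover have "\<eta> t = \<gamma> (?a t)" using \<eta> t by blast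
    ultimately have "speed A g \<eta> t = gnorm c (snd c (\<gamma> (?a t))) (m *\<^sub>R ?D)"
      by (simp add: speed_def Let_def gnorm_def c_def)
    also have "\<dots> = \<bar>m\<bar> * speed A g \<gamma> (?a t)"
      unfolding gnorm_scaleR by (simp add: speed_def Let_def gnorm_def c_def)
    finally show ?thesis .
  qed
  have "length_on \<gamma> (?a ` {a..b}) = length_on \<gamma> (?a ` ?J)"
  proof (rule length_on_cong_finite)
    show "finite (S \<union> {?a a, ?a b})" using S by simp
    fix u assume "u \<notin> S \<union> {?a a, ?a b}"
    then show "u \<in> ?a ` {a..b} \<longleftrightarrow> u \<in> ?a ` ?J" by (force simp: less_le)
  qed
  also have "\<dots> = (\<integral>\<^sup>+u. ennreal (indicator (?a ` ?J) u * speed A g \<gamma> u) \<partial>lborel)"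
    unfolding length_on_def by (intro nn_integral_cong) (simp add: indicator_def)
  also have "\<dots> = \<bar>m\<bar> * (\<integral>\<^sup>+t. ennreal (indicator (?a ` ?J) (k + m * t) * speed A g \<gamma> (k + m * t)) \<partial>lborel)"
    by (rule nn_integral_real_affine[OF _ m]) (use measurable_speed[OF \<gamma> aJb sub] in measurable)
  also have "\<dots> = (\<integral>\<^sup>+t. \<bar>m\<bar> * ennreal (indicator (?a ` ?J) (k + m * t) * speed A g \<gamma> (k + m * t)) \<partial>lborel)"
  proof (rule nn_integral_cmult[symmetric])
    have "(\<lambda>t. indicator (?a ` ?J) (k + m * t) * speed A g \<gamma> (k + m * t)) \<in> borel_measurable borel"
      by (rule measurable_compose[OF _ measurable_speed[OF \<gamma> aJb sub]]) simp
    then show "(\<lambda>t. ennreal (indicator (?a ` ?J) (k + m * t) * speed A g \<gamma> (k + m * t))) \<in> borel_measurable lborel"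
      by simp
  qed
  also have "\<dots> = length_on \<eta> ?J"
    unfolding length_on_def
  proof (intro nn_integral_cong)
    fix t
    have "k + m * t \<in> ?a ` ?J \<longleftrightarrow> t \<in> ?J" using m by (auto simp: add.commute)
    then show "\<bar>m\<bar> * ennreal (indicator (?a ` ?J) (k + m * t) * speed A g \<gamma> (k + m * t))
      = ennreal (speed A g \<eta> t) * indicator ?J t"
      using sp[of t] by (cases "t \<in> ?J") (auto simp: ennreal_mult'[symmetric] add.commute simp del: Diff_iff)
  qed
  also have "\<dots> = length_on \<eta> {a..b}"
    by (rule length_on_cong_finite[of "?a -` S \<union> {a, b}"]) (use fin in auto)
  finally show ?thesis ..
qed

text \<open>Common source of the regularity of subcurves, reversed curves and the halves of a
  concatenation, all of which are affine reparametrisations on an open set of times.\<close>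

lemma C1_curve_piece:
  assumes \<gamma>: "C1_curve_off \<gamma> S" and m: "m \<noteq> 0" and J: "open J"
    and \<eta>: "\<And>t. t \<in> J \<Longrightarrow> \<eta> t = \<gamma> (m * t + k) \<and> m * t + k \<in> {0<..<1}" and c: "c \<in> A"
  shows "(snd c \<circ> \<eta>) C1_differentiable_on (J \<inter> \<eta> -` fst c - (\<lambda>t. m * t + k) -` S)"
proof -
  let ?a = "\<lambda>t. m * t + k"
  let ?T = "J \<inter> \<eta> -` fst c - ?a -` S"
  have "((snd c \<circ> \<gamma>) \<circ> ?a) C1_differentiable_on ?T"
  proof (rule C1_differentiable_compose)
    show "?a C1_differentiable_on ?T" unfolding C1_differentiable_on_eq
      by (auto intro!: derivative_intros)
    show "(snd c \<circ> \<gamma>) C1_differentiable_on (?a ` ?T)"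
      by (rule C1_differentiable_on_subset[where T = "{0<..<1} \<inter> \<gamma> -` fst c - S"])
        (use \<gamma> c \<eta> in \<open>auto simp: C1_curve_off_def\<close>)
    show "finite (?T \<inter> ?a -` {x})" for x
    proof (rule finite_subset)
      show "?T \<inter> ?a -` {x} \<subseteq> {(x - k) / m}" using m by (auto simp: field_simps)
    qed simp
  qed
  then show ?thesis
    by (rule C1_differentiable_on_cong_open[OF J, rotated 2]) (use \<eta> in auto)
qed

lemma finite_affine_vimage: "m \<noteq> (0::real) \<Longrightarrow> finite S \<Longrightarrow> finite ((\<lambda>t. m * t + k) -` S)"
  by (rule finite_vimageI) (auto simp: inj_on_def)

section \<open>The axioms of a metric, with values in \<open>ennreal\<close>\<close>

lemma dist_le_length_on:
  assumes "C1_curve_off \<gamma> S" "\<gamma> 0 = p" "\<gamma> 1 = q"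
  shows "riemannian_dist A g p q \<le> length_on \<gamma> {0..1}"
  unfolding riemannian_dist_def curve_length_eq[symmetric]
  by (rule Inf_lower) (use assms in \<open>auto simp: piecewise_C1_curve_iff pathstart_def pathfinish_def\<close>)

lemma dist_less_curve:
  assumes "riemannian_dist A g p q < e"
  obtains \<gamma> S where "C1_curve_off \<gamma> S" "\<gamma> 0 = p" "\<gamma> 1 = q" "length_on \<gamma> {0..1} < e"
proof -
  obtain x where "x \<in> curve_length A g ` {\<gamma>. piecewise_C1_curve A \<gamma> \<and> pathstart \<gamma> = p \<and> pathfinish \<gamma> = q}" "x < e"
    using assms unfolding riemannian_dist_def Inf_less_iff by blast
  then show thesis using that by (auto simp: piecewise_C1_curve_iff pathstart_def pathfinish_def curve_length_eq)
qed

text \<open>No order between \<open>a\<close> and \<open>b\<close> is assumed: \<open>a = 1\<close>,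
  \<open>b = 0\<close> is the reversed curve and yields symmetry of the distance.\<close>

lemma dist_subcurve:
  assumes \<gamma>: "C1_curve_off \<gamma> S" and ab: "a \<in> {0..1}" "b \<in> {0..1}" "a \<noteq> b"
  shows "riemannian_dist A g (\<gamma> a) (\<gamma> b) \<le> length_on \<gamma> (closed_segment a b)"
proof -
  let ?m = "b - a"
  let ?\<eta> = "\<lambda>t. \<gamma> (?m * t + a)"
  have m: "?m \<noteq> 0" using ab by simp
  \<comment> \<open>Since \<open>a \<noteq> b\<close>, they are not both 0 and not both 1, so a
    proper convex combination of them avoids both endpoints.\<close>
  have in01: "?m * t + a \<in> {0<..<1}" if "t \<in> {0<..<1}" for t
  proof -
    have eq: "?m * t + a = (1 - t) * a + t * b" by (simp add: algebra_simps)
    have "0 < (1 - t) * a + t * b"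
      using that ab by (cases "a = 0") (auto intro: add_pos_nonneg add_nonneg_pos)
    moreover have "0 < (1 - t) * (1 - a) + t * (1 - b)"
      using that ab by (cases "a = 1") (auto intro: add_pos_nonneg add_nonneg_pos)
    ultimately show ?thesis unfolding eq by (auto simp: algebra_simps)
  qed
  have seg: "(\<lambda>t. ?m * t + a) ` {0..1} = closed_segment a b"
    unfolding closed_segment_def by (auto simp: algebra_simps image_def)
  have "C1_curve_off ?\<eta> ((\<lambda>t. ?m * t + a) -` S)"
    unfolding C1_curve_off_def
  proof (intro conjI ballI)
    have sub: "(\<lambda>t. ?m * t + a) ` {0..1} \<subseteq> {0..1}"
      unfolding seg using ab by (intro closed_segment_subset) auto
    have c: "continuous_on {0..1} \<gamma>" using \<gamma> by (simp add: C1_curve_off_def path_def)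
    show "path ?\<eta>" unfolding path_def
      by (rule continuous_on_compose2[OF c _ sub]) (intro continuous_intros)
    show "finite ((\<lambda>t. ?m * t + a) -` S)" using \<gamma> m by (intro finite_affine_vimage) (auto simp: C1_curve_off_def)
    show "(snd c \<circ> ?\<eta>) C1_differentiable_on ({0<..<1} \<inter> ?\<eta> -` fst c - (\<lambda>t. ?m * t + a) -` S)" if "c \<in> A" for c
      by (rule C1_curve_piece[OF \<gamma> m _ _ that]) (use in01 in auto)
  qed
  then have "riemannian_dist A g (?\<eta> 0) (?\<eta> 1) \<le> length_on ?\<eta> {0..1}" by (rule dist_le_length_on) auto
  also have "\<dots> = length_on \<gamma> (closed_segment a b)"
    unfolding seg[symmetric] by (rule length_on_reparametrize[OF \<gamma> m]) (use in01 in auto)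
  finally show ?thesis by simp
qed

lemma dist_commute_le: "riemannian_dist A g q p \<le> riemannian_dist A g p q"
proof (rule ccontr)
  assume "\<not> riemannian_dist A g q p \<le> riemannian_dist A g p q"
  then obtain \<gamma> S where "C1_curve_off \<gamma> S" "\<gamma> 0 = p" "\<gamma> 1 = q" "length_on \<gamma> {0..1} < riemannian_dist A g q p"
    using dist_less_curve[of p q "riemannian_dist A g q p"] by (auto simp: not_le)
  then show False using dist_subcurve[of \<gamma> S 1 0]
    by (simp add: closed_segment_eq_real_ivl)
qed

lemma dist_commute: "riemannian_dist A g q p = riemannian_dist A g p q"
  by (intro antisym dist_commute_le)

text \<open>Concatenation of two curves that are optimal up to e/2. Reduction to a finite right-hand
  side is what makes such curves available.\<close>

lemma dist_triangle: "riemannian_dist A g p r \<le> riemannian_dist A g p q + riemannian_dist A g q r"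
proof (rule ennreal_le_epsilon)
  let ?d = "riemannian_dist A g"
  fix e :: real assume fin: "?d p q + ?d q r < top" and e: "0 < e"
  have "?d p q < ?d p q + ennreal (e / 2)" "?d q r < ?d q r + ennreal (e / 2)"
    using fin e by (auto simp: ennreal_add_less_top)
  then obtain \<gamma>1 S1 \<gamma>2 S2 where \<gamma>1: "C1_curve_off \<gamma>1 S1" "\<gamma>1 0 = p" "\<gamma>1 1 = q" "length_on \<gamma>1 {0..1} < ?d p q + ennreal (e / 2)"
    and \<gamma>2: "C1_curve_off \<gamma>2 S2" "\<gamma>2 0 = q" "\<gamma>2 1 = r" "length_on \<gamma>2 {0..1} < ?d q r + ennreal (e / 2)"
    using dist_less_curve[of p q] dist_less_curve[of q r] by metis
  let ?\<eta> = "\<gamma>1 +++ \<gamma>2"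
  let ?a1 = "\<lambda>t. 2 * t + (0::real)" and ?a2 = "\<lambda>t. 2 * t + (-1::real)"
  have p1: "?\<eta> t = \<gamma>1 (2 * t + 0) \<and> 2 * t + 0 \<in> {0<..<1}" if "t \<in> {0<..<1/2}" for t
    using that by (auto simp: joinpaths_def)
  have p2: "?\<eta> t = \<gamma>2 (2 * t + -1) \<and> 2 * t + -1 \<in> {0<..<1}" if "t \<in> {1/2<..<1}" for t
    using that by (auto simp: joinpaths_def)
  \<comment> \<open>The joint at 1/2 may be a corner and is therefore exceptional.\<close>
  let ?S = "insert (1/2) (?a1 -` S1 \<union> ?a2 -` S2)"
  have "C1_curve_off ?\<eta> ?S"
    unfolding C1_curve_off_def
  proof (intro conjI ballI)
    show "path ?\<eta>" using \<gamma>1 \<gamma>2 by (intro path_join_imp) (auto simp: C1_curve_off_def pathstart_def pathfinish_def)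
    have "finite (?a1 -` S1)" "finite (?a2 -` S2)"
      by (rule finite_affine_vimage; use \<gamma>1(1) \<gamma>2(1) in \<open>simp add: C1_curve_off_def\<close>)+
    then show "finite ?S" by simp
    fix c assume c: "c \<in> A"
    let ?T = "{0<..<1} \<inter> ?\<eta> -` fst c - ?S"
    show "(snd c \<circ> ?\<eta>) C1_differentiable_on ?T"
    proof (rule C1_differentiable_on_local)
      fix t assume t: "t \<in> ?T"
      then consider "t \<in> {0<..<1/2}" | "t \<in> {1/2<..<1}" by fastforce
      then show "\<exists>J. open J \<and> t \<in> J \<and> (snd c \<circ> ?\<eta>) C1_differentiable_on (?T \<inter> J)"
      proof cases
        case 1
        have "(snd c \<circ> ?\<eta>) C1_differentiable_on ({0<..<1/2} \<inter> ?\<eta> -` fst c - ?a1 -` S1)"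
          by (rule C1_curve_piece[OF \<gamma>1(1) _ _ p1 c]) auto
        then have "(snd c \<circ> ?\<eta>) C1_differentiable_on (?T \<inter> {0<..<1/2})"
          by (rule C1_differentiable_on_subset) auto
        with 1 show ?thesis by (intro exI[of _ "{0<..<1/2}"] conjI open_greaterThanLessThan)
      next
        case 2
        have "(snd c \<circ> ?\<eta>) C1_differentiable_on ({1/2<..<1} \<inter> ?\<eta> -` fst c - ?a2 -` S2)"
          by (rule C1_curve_piece[OF \<gamma>2(1) _ _ p2 c]) auto
        then have "(snd c \<circ> ?\<eta>) C1_differentiable_on (?T \<inter> {1/2<..<1})"
          by (rule C1_differentiable_on_subset) auto
        with 2 show ?thesis by (intro exI[of _ "{1/2<..<1}"] conjI open_greaterThanLessThan)
      qed
    qed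
  qed
  note \<eta> = this
  have "?d p r \<le> length_on ?\<eta> {0..1}"
    by (rule dist_le_length_on[OF \<eta>]) (use \<gamma>1 \<gamma>2 in \<open>auto simp: joinpaths_def\<close>)
  also have "\<dots> = length_on ?\<eta> {0..1/2} + length_on ?\<eta> {1/2..1}"
    by (rule length_on_add[OF \<eta>]) auto
  also have "length_on ?\<eta> {0..1/2} = length_on \<gamma>1 (?a1 ` {0..1/2})"
    by (rule length_on_reparametrize[OF \<gamma>1(1) _ p1]) auto
  also have "?a1 ` {0..1/2} = {0..1}"
  proof -
    have "x \<in> ?a1 ` {0..1/2}" if "x \<in> {0..1}" for x
      by (rule image_eqI[of _ _ "x / 2"]) (use that in auto)
    then show ?thesis by auto
  qed
  also have "length_on ?\<eta> {1/2..1} = length_on \<gamma>2 (?a2 ` {1/2..1})"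
    by (rule length_on_reparametrize[OF \<gamma>2(1) _ p2]) auto
  also have "?a2 ` {1/2..1} = {0..1}"
  proof -
    have "x \<in> ?a2 ` {1/2..1}" if "x \<in> {0..1}" for x
      by (rule image_eqI[of _ _ "(x + 1) / 2"]) (use that in \<open>auto simp: field_simps\<close>)
    then show ?thesis by auto
  qed
  also have "length_on \<gamma>1 {0..1} + length_on \<gamma>2 {0..1} \<le> (?d p q + ennreal (e / 2)) + (?d q r + ennreal (e / 2))"
    using \<gamma>1(4) \<gamma>2(4) by (intro add_mono) auto
  also have "\<dots> = ?d p q + ?d q r + (ennreal (e / 2) + ennreal (e / 2))" by (simp add: add_ac)
  also have "ennreal (e / 2) + ennreal (e / 2) = ennreal e" using e by (simp add: ennreal_plus[symmetric] del: ennreal_plus)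
  finally show "?d p r \<le> ?d p q + ?d q r + ennreal e" .
qed

text \<open>The coordinate segment, run through in unit time, has constant coordinate velocity
  \<open>y - x\<close>. All upper bounds for the distance come from this, in particular the
  Lipschitz bounds for the cutoffs in a chart.\<close>

lemma dist_segment_le:
  assumes c: "c \<in> A" and sub: "closed_segment x y \<subseteq> chart_image c"
    and G: "\<And>z. z \<in> closed_segment x y \<Longrightarrow> gnorm c z (y - x) \<le> G"
  shows "riemannian_dist A g (chart_inv c x) (chart_inv c y) \<le> ennreal G"
proof -
  define l where "l t = x + t *\<^sub>R (y - x)" for t
  define \<gamma> where "\<gamma> = chart_inv c \<circ> l"
  have l: "l t \<in> closed_segment x y" if "t \<in> {0..1}" for t
    unfolding closed_segment_def l_def using that by (auto simp: algebra_simps intro!: exI[of _ t])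
  have ld: "(l has_vector_derivative (y - x)) (at t)" for t
    unfolding l_def by (auto intro!: derivative_eq_intros)
  have lc: "continuous_on S l" for S unfolding l_def by (intro continuous_intros)
  have curve: "C1_curve_off \<gamma> {}"
    unfolding C1_curve_off_def
  proof (intro conjI ballI)
    show "path \<gamma>" unfolding path_def \<gamma>_def
      by (intro continuous_on_compose lc continuous_on_subset[OF continuous_on_chart_inv[OF c]]) (use l sub in auto)
    fix c' assume c': "c' \<in> A"
    let ?D = "\<lambda>t. frechet_derivative (transition c c') (at (l t)) (y - x)"
    let ?T = "{0<..<1} \<inter> \<gamma> -` fst c' - {}"
    have ov: "l t \<in> overlap c c'" if "t \<in> ?T" for t
      using that l[of t] sub by (auto simp: overlap_eq[OF c] \<gamma>_def)
    have hd: "((snd c' \<circ> \<gamma>) has_vector_derivative ?D t) (at t)" if "t \<in> ?T" for t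
    proof -
      have "((transition c c' \<circ> l) has_vector_derivative ?D t) (at t)"
        by (rule vector_derivative_diff_chain_within[OF ld
            has_derivative_at_withinI[OF transition_has_derivative[OF c c' ov[OF that]]]])
      then show ?thesis by (simp add: transition_def \<gamma>_def o_assoc)
    qed
    have hc: "continuous_on ?T ?D"
      by (rule continuous_on_compose2[OF C1_on_continuous_derivative[OF transition_C1[OF c c']] lc]) (use ov in auto)
    show "(snd c' \<circ> \<gamma>) C1_differentiable_on ?T"
      unfolding C1_differentiable_on_def by (intro exI[of _ ?D] conjI ballI hd hc)
  qed simp
  have speed: "speed A g \<gamma> t \<le> G" if t: "t \<in> {0<..<1}" for t
  proof -
    have lt: "l t \<in> chart_image c" using l[of t] t sub by auto
    have "((snd c \<circ> \<gamma>) has_vector_derivative (y - x)) (at t)"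
    proof (rule has_vector_derivative_transform_within_open[OF ld])
      show "open (l -` chart_image c)"
        using continuous_open_preimage[OF lc[of UNIV] open_UNIV open_chart_image[OF c]] by simp
    qed (use lt c in \<open>auto simp: \<gamma>_def\<close>)
    then have "speed A g \<gamma> t = gnorm c (snd c (\<gamma> t)) (y - x)"
      by (intro speed_in_chart) (use curve t c lt in \<open>auto simp: C1_curve_off_def \<gamma>_def\<close>)
    then show ?thesis using G[OF l[of t]] t c lt by (simp add: \<gamma>_def)
  qed
  have "riemannian_dist A g (chart_inv c x) (chart_inv c y) \<le> length_on \<gamma> {0..1}"
    by (rule dist_le_length_on[OF curve]) (auto simp: \<gamma>_def l_def)
  also have "\<dots> = length_on \<gamma> {0<..<1}" by (rule length_on_cong_finite[of "{0, 1}"]) auto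
  also have "\<dots> \<le> (\<integral>\<^sup>+t. ennreal G * indicator {0<..<1::real} t \<partial>lborel)"
    unfolding length_on_def by (intro nn_integral_mono) (use speed in \<open>auto simp: indicator_def intro: ennreal_leI\<close>)
  also have "\<dots> = ennreal G" by (simp add: nn_integral_cmult_indicator)
  finally show ?thesis .
qed

lemma dist_self: "riemannian_dist A g p p = 0"
proof -
  have "riemannian_dist A g (chart_inv (chart_at A p) (snd (chart_at A p) p)) (chart_inv (chart_at A p) (snd (chart_at A p) p)) \<le> ennreal 0"
    by (rule dist_segment_le) (use chart_at[of p] in \<open>auto simp: gnorm_def\<close>)
  then show ?thesis using chart_at[of p] by simp
qed

section \<open>Comparison of the distance with the topology of the manifold\<close>

lemma gnorm_upper_bound:
  assumes "c \<in> A" "compact K" "K \<subseteq> chart_image c"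
  shows "\<exists>M>0. \<forall>x\<in>K. \<forall>v. gnorm c x v \<le> M * norm v"
proof -
  have "continuous_on (K \<times> sphere 0 1) (\<lambda>z. gnorm c (fst z) (snd z))"
    by (rule continuous_on_gnorm[OF assms(1)]) (use assms(3) in \<open>auto intro!: continuous_intros\<close>)
  moreover have "compact (K \<times> sphere (0::real^'n) 1)" using assms(2) by (intro compact_Times) auto
  ultimately have "bounded ((\<lambda>z. gnorm c (fst z) (snd z)) ` (K \<times> sphere 0 1))"
    by (intro compact_imp_bounded compact_continuous_image)
  then obtain M where "M > 0" and M: "\<And>z. z \<in> K \<times> sphere 0 1 \<Longrightarrow> \<bar>gnorm c (fst z) (snd z)\<bar> \<le> M"
    unfolding bounded_pos by (auto simp del: mem_Times_iff)
  have "gnorm c x v \<le> M * norm v" if "x \<in> K" for x v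
  proof (cases "v = 0")
    case False
    have "gnorm c x v = gnorm c x (norm v *\<^sub>R sgn v)" by (simp add: sgn_div_norm False)
    also have "\<dots> = norm v * gnorm c x (sgn v)" by (simp add: gnorm_scaleR)
    finally show ?thesis using M[of "(x, sgn v)"] that False
      by (simp add: norm_sgn mult.commute mult_left_mono)
  qed (simp add: gnorm_def)
  with \<open>M > 0\<close> show ?thesis by blast
qed

text \<open>On a small coordinate ball the metric is bounded by a multiple \<open>M\<close> of the
  Euclidean one, so short segments have short length. This is one half of the comparison of
  topologies.\<close>

lemma dist_small_nhd:
  assumes "e > 0" shows "\<exists>N. open N \<and> p \<in> N \<and> (\<forall>q\<in>N. riemannian_dist A g p q < ennreal e)"
proof -
  define c where "c = chart_at A p"
  define x where "x = snd c p"
  have c: "c \<in> A" "p \<in> fst c" using chart_at by (auto simp: c_def)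
  have p: "chart_inv c x = p" and x: "x \<in> chart_image c" using c by (auto simp: x_def)
  obtain r where r: "r > 0" "cball x r \<subseteq> chart_image c"
    using open_contains_cball open_chart_image[OF c(1)] x by metis
  obtain M where M: "M > 0" "\<And>z v. z \<in> cball x r \<Longrightarrow> gnorm c z v \<le> M * norm v"
    using gnorm_upper_bound[OF c(1) compact_cball r(2)] by blast
  \<comment> \<open>The factor 2 gives \<open>M * s \<le> e / 2\<close>, hence the strict inequality
    at the end.\<close>
  define s where "s = min r (e / (2 * M))"
  have s: "s > 0" "s \<le> r" "M * s \<le> e / 2" using r(1) assms M(1) by (auto simp: s_def min_def field_simps)
  let ?N = "chart_inv c ` ball x s"
  have bs: "ball x s \<subseteq> cball x r" using s by auto
  have "open ?N" by (rule open_chart_inv_image[OF c(1)]) (use bs r in auto)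
  moreover have "p \<in> ?N" using p s(1) by (metis centre_in_ball imageI)
  moreover have "riemannian_dist A g p q < ennreal e" if "q \<in> ?N" for q
  proof -
    obtain y where y: "q = chart_inv c y" "y \<in> ball x s" using \<open>q \<in> ?N\<close> by blast
    have seg: "closed_segment x y \<subseteq> cball x r"
      by (rule closed_segment_subset) (use y bs r in auto)
    have "riemannian_dist A g (chart_inv c x) (chart_inv c y) \<le> ennreal (M * norm (y - x))"
      by (rule dist_segment_le[OF c(1)]) (use seg r M in auto)
    also have "\<dots> < ennreal e"
    proof (rule ennreal_lessI[OF assms])
      have "M * norm (y - x) \<le> M * s" using y M(1) by (intro mult_left_mono) (auto simp: dist_norm norm_minus_commute)
      then show "M * norm (y - x) < e" using s(3) assms by linarith
    qed
    finally show ?thesis using y p by simp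
  qed
  ultimately show ?thesis by blast
qed

text \<open>The fundamental theorem of calculus for the curve in coordinates, whose velocity has
  norm at most speed / l. The velocity may be unbounded near exceptional times, so the gauge
  integral is used: it needs only continuity of the curve and a derivative off a finite set.\<close>

lemma norm_increment_le_length:
  assumes \<gamma>: "C1_curve_off \<gamma> S" and c: "c \<in> A" and ab: "0 \<le> a" "a \<le> b" "b \<le> 1"
    and K: "\<And>t. t \<in> {a..b} \<Longrightarrow> \<gamma> t \<in> fst c \<and> snd c (\<gamma> t) \<in> K"
    and l: "l > 0" "\<And>z v. z \<in> K \<Longrightarrow> l * norm v \<le> gnorm c z v"
  shows "ennreal (l * norm (snd c (\<gamma> b) - snd c (\<gamma> a))) \<le> length_on \<gamma> {a..b}"
proof -
  have S: "finite S" using \<gamma> by (simp add: C1_curve_off_def)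
  let ?y = "snd c \<circ> \<gamma>"
  let ?I = "{a<..<b} - S"
  define f where "f t = (if t \<in> ?I then vector_derivative ?y (at t) else 0)" for t
  define G where "G t = indicator ?I t * speed A g \<gamma> t / l" for t
  have I: "?I \<in> sets borel" "?I \<subseteq> {0<..<1} - S"
    using S ab by (auto intro!: borel_open open_Diff finite_imp_closed)
  have "(f has_integral (?y b - ?y a)) {a..b}"
  proof (rule fundamental_theorem_of_calculus_interior_strong[OF S ab(2)])
    show "(?y has_vector_derivative f t) (at t)" if "t \<in> {a<..<b} - S" for t
      using curve_has_vector_derivative[OF \<gamma> c, of t] that K[of t] ab by (simp add: f_def)
    show "continuous_on {a..b} ?y"
    proof (rule continuous_on_compose)
      show "continuous_on {a..b} \<gamma>"
        using \<gamma> ab unfolding C1_curve_off_def path_def by (auto elim: continuous_on_subset)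
      show "continuous_on (\<gamma> ` {a..b}) (snd c)"
        by (rule continuous_on_subset[OF continuous_on_chart[OF c]]) (use K in auto)
    qed
  qed
  then have f: "(f has_integral (?y b - ?y a)) UNIV"
    by (rule has_integral_on_superset) (auto simp: f_def)
  have fG: "norm (f t) \<le> G t" for t
  proof (cases "t \<in> ?I")
    case True
    then have "l * norm (f t) \<le> speed A g \<gamma> t"
      using speed_eq[OF \<gamma> c, of t] I(2) K[of t] l(2)[of "snd c (\<gamma> t)" "f t"] by (auto simp: f_def)
    then show ?thesis using True l(1) by (simp add: G_def field_simps)
  next
    case False
    then have "f t = 0" "G t = 0" unfolding f_def G_def by (simp_all only: if_False indicator_simps) simp
    then show ?thesis by simp
  qed
  then have G0: "0 \<le> G t" for t using norm_ge_zero order_trans by blast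
  have Gm: "G \<in> borel_measurable borel"
    using measurable_speed[OF \<gamma> I] unfolding G_def by (intro borel_measurable_divide) auto
  have len: "length_on \<gamma> {a..b} = ennreal l * (\<integral>\<^sup>+t. ennreal (G t) \<partial>lborel)"
  proof -
    have "length_on \<gamma> {a..b} = length_on \<gamma> ?I"
      by (rule length_on_cong_finite[of "S \<union> {a, b}"]) (use S in auto)
    also have "\<dots> = (\<integral>\<^sup>+t. ennreal l * ennreal (G t) \<partial>lborel)"
      unfolding length_on_alt using l(1) by (intro nn_integral_cong) (simp add: G_def ennreal_mult'[symmetric])
    also have "\<dots> = ennreal l * (\<integral>\<^sup>+t. ennreal (G t) \<partial>lborel)"
      using Gm by (intro nn_integral_cmult) simp
    finally show ?thesis .
  qed
  show ?thesis
  \<comment> \<open>If the length is infinite there is nothing to show; if it is finite,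
    \<open>G\<close> is an integrable bound for the velocity.\<close>
  proof (cases "(\<integral>\<^sup>+t. ennreal (G t) \<partial>lborel) < \<infinity>")
    case True
    have Gi: "G integrable_on UNIV" by (rule nn_integral_integrable_on[OF Gm G0 True])
    have "norm (integral UNIV f) \<le> integral UNIV G"
      by (rule Henstock_Kurzweil_Integration.integral_norm_bound_integral) (use f fG Gi in auto)
    then have "norm (?y b - ?y a) \<le> integral UNIV G" using f by (simp add: integral_unique)
    then have "ennreal (l * norm (?y b - ?y a)) \<le> ennreal (l * integral UNIV G)"
      using l(1) by (intro ennreal_leI mult_left_mono) auto
    also have "\<dots> = length_on \<gamma> {a..b}"
      unfolding len nn_integral_lborel_eq_integral[OF Gm G0 True] using l(1) by (simp add: ennreal_mult')
    finally show ?thesis by simp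
  next
    case False
    then have "length_on \<gamma> {a..b} = \<infinity>" unfolding len using l(1) by (simp add: less_top[symmetric] ennreal_mult_top)
    then show ?thesis by simp
  qed
qed

text \<open>A curve from the centre to a point outside stays in the closed coordinate ball up to its
  first exit, and by then its coordinates have moved by at least \<open>r\<close>.\<close>

lemma dist_exit_le:
  assumes c: "c \<in> A" and r: "r > 0" "cball x r \<subseteq> chart_image c"
    and l: "l > 0" "\<And>z v. z \<in> cball x r \<Longrightarrow> l * norm v \<le> gnorm c z v"
    and q: "q \<notin> chart_inv c ` ball x r"
  shows "ennreal (l * r) \<le> riemannian_dist A g (chart_inv c x) q"
proof (rule ccontr)
  assume "\<not> ?thesis"
  then obtain \<gamma> S where \<gamma>: "C1_curve_off \<gamma> S" "\<gamma> 0 = chart_inv c x" "\<gamma> 1 = q"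
    and len: "length_on \<gamma> {0..1} < ennreal (l * r)"
    using dist_less_curve[of "chart_inv c x" q "ennreal (l * r)"] by (auto simp: not_le)
  let ?U = "chart_inv c ` ball x r"
  let ?Z = "{0..1} \<inter> \<gamma> -` (- ?U)"
  have bsub: "ball x r \<subseteq> chart_image c" using r by auto
  have U: "open ?U" by (rule open_chart_inv_image[OF c _ bsub]) auto
  have \<gamma>c: "continuous_on {0..1} \<gamma>" using \<gamma>(1) by (simp add: C1_curve_off_def path_def)
  have "closed ?Z" using U by (intro continuous_closed_preimage[OF \<gamma>c]) auto
  then have Z: "compact ?Z" using compact_Int_closed[OF compact_Icc, of ?Z 0 1] by (simp add: Int_absorb1)
  have "1 \<in> ?Z" using q \<gamma>(3) by simp
  \<comment> \<open>The first time outside \<open>?U\<close>; it exists because the set of times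
    outside is compact.\<close>
  then obtain s where s: "s \<in> ?Z" "\<And>t. t \<in> ?Z \<Longrightarrow> s \<le> t" using compact_attains_inf[OF Z] by blast
  have x: "x \<in> chart_image c" using r by auto
  have "\<gamma> 0 \<in> ?U" using \<gamma>(2) r(1) by auto
  then have s01: "0 < s" "s \<le> 1" using s(1) by (auto simp: less_le)
  have inU: "\<gamma> t \<in> ?U" if "t \<in> {0..<s}" for t using s(2)[of t] that s01 by (force simp: not_le)
  \<comment> \<open>At the exit time the curve is on the coordinate sphere:
    \<open>\<gamma> s\<close> is a limit of points of \<open>?U\<close>, and the image of the closed
    ball, compact in a Hausdorff space, contains all such limits.\<close>
  have "\<gamma> s \<in> closure ?U"
  proof (rule closed_sequentially[OF closed_closure])
    let ?t = "\<lambda>n. s * (1 - inverse (real (Suc n)))"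
    have t: "?t n \<in> {0..<s}" for n
      using s01 by (auto simp: field_simps)
    show "\<gamma> (?t n) \<in> closure ?U" for n using inU[OF t] closure_subset by blast
    have "?t \<longlonglongrightarrow> s * (1 - 0)" by (intro tendsto_intros LIMSEQ_inverse_real_of_nat)
    then have "?t \<longlonglongrightarrow> s" by simp
    then show "(\<lambda>n. \<gamma> (?t n)) \<longlonglongrightarrow> \<gamma> s"
    proof (rule continuous_on_tendsto_compose[OF \<gamma>c])
      show "\<forall>\<^sub>F n in sequentially. ?t n \<in> {0..1}"
      proof (intro always_eventually allI)
        show "?t n \<in> {0..1}" for n
          using t[of n] s01 unfolding atLeastLessThan_iff atLeastAtMost_iff by linarith
      qed
    qed (use s01 in auto)
  qed
  also have "closure ?U \<subseteq> chart_inv c ` cball x r"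
  proof (rule closure_minimal)
    have "compact (chart_inv c ` cball x r)"
      by (intro compact_continuous_image continuous_on_subset[OF continuous_on_chart_inv[OF c] r(2)]) auto
    then show "closed (chart_inv c ` cball x r)" by (rule compact_imp_closed)
  qed auto
  finally obtain y where y: "\<gamma> s = chart_inv c y" "y \<in> cball x r" by blast
  have "y \<notin> ball x r" using s(1) y(1) by auto
  have K: "\<gamma> t \<in> fst c \<and> snd c (\<gamma> t) \<in> cball x r" if "t \<in> {0..s}" for t
  proof -
    have "\<gamma> t \<in> chart_inv c ` cball x r"
      using inU[of t] y that by (cases "t = s") auto
    then show ?thesis using c r(2) by (auto simp: subset_iff)
  qed
  have "snd c (\<gamma> s) = y" "snd c (\<gamma> 0) = x" using y \<gamma>(2) c r(2) x by (auto simp: subset_iff)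
  then have "ennreal (l * r) \<le> ennreal (l * norm (snd c (\<gamma> s) - snd c (\<gamma> 0)))"
    using \<open>y \<notin> ball x r\<close> l(1) by (intro ennreal_leI mult_left_mono) (auto simp: dist_norm norm_minus_commute)
  also have "\<dots> \<le> length_on \<gamma> {0..s}"
    by (rule norm_increment_le_length[OF \<gamma>(1) c _ _ _ K l]) (use s01 in auto)
  also have "\<dots> \<le> length_on \<gamma> {0..1}"
    unfolding length_on_def using s01 by (intro nn_integral_mono) (auto simp: indicator_def)
  finally show False using len by simp
qed

text \<open>The other half of the comparison of topologies: a point off \<open>N\<close> lies
  outside a coordinate ball contained in \<open>N\<close>, and leaving that ball costs length
  \<open>l * r\<close>.\<close>

lemma dist_ball_subset:
  assumes "open N" "p \<in> N" shows "\<exists>\<delta>>0. \<forall>q. riemannian_dist A g p q < ennreal \<delta> \<longrightarrow> q \<in> N"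
proof -
  define c where "c = chart_at A p"
  define x where "x = snd c p"
  have c: "c \<in> A" "p \<in> fst c" using chart_at by (auto simp: c_def)
  have p: "chart_inv c x = p" and x: "x \<in> chart_image c" using c by (auto simp: x_def)
  have "open (chart_image c \<inter> chart_inv c -` N)"
    by (rule continuous_open_preimage[OF continuous_on_chart_inv[OF c(1)] open_chart_image[OF c(1)] assms(1)])
  moreover have "x \<in> chart_image c \<inter> chart_inv c -` N" using x p assms(2) by simp
  ultimately obtain r where r: "r > 0" "cball x r \<subseteq> chart_image c \<inter> chart_inv c -` N"
    using open_contains_cball by metis
  then have r': "cball x r \<subseteq> chart_image c" by blast
  obtain l where l: "l > 0" "\<And>z v. z \<in> cball x r \<Longrightarrow> l * norm v \<le> gnorm c z v"
    using gnorm_lower_bound[OF c(1) compact_cball r'] by blast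
  have "q \<in> N" if "riemannian_dist A g p q < ennreal (l * r)" for q
  proof (rule ccontr)
    assume "q \<notin> N"
    then have "q \<notin> chart_inv c ` ball x r" using r(2) by (auto simp: subset_iff)
    from dist_exit_le[OF c(1) r(1) r' l this] that p show False by simp
  qed
  then show ?thesis using l(1) r(1) by (intro exI[of _ "l * r"]) simp
qed

end

section \<open>Hopf-Rinow and cutoff functions\<close>

locale pointed_riemannian_manifold = riemannian_manifold A g
  for A :: "('m::{t2_space,second_countable_topology}, 'n::finite) chart set"
    and g :: "('m, 'n) tensor2" +
  fixes p0 :: 'm
begin

text \<open>The set on which the distance from \<open>p0\<close> is finite. Restricted to it the
  distance is real-valued, as \<open>Metric_space\<close> requires.\<close>

definition component :: "'m set"
  where "component = {q. riemannian_dist A g p0 q < \<infinity>}"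

definition rdist :: "'m \<Rightarrow> 'm \<Rightarrow> real"
  where "rdist x y = enn2real (riemannian_dist A g x y)"

lemma dist_finite: "x \<in> component \<Longrightarrow> y \<in> component \<Longrightarrow> riemannian_dist A g x y < \<infinity>"
proof -
  assume "x \<in> component" "y \<in> component"
  then have "riemannian_dist A g x p0 + riemannian_dist A g p0 y < \<infinity>"
    unfolding component_def by (simp add: dist_commute[of x p0] ennreal_add_less_top)
  then show ?thesis using dist_triangle[of x y p0] by (rule order.strict_trans1[rotated])
qed

lemma dist_eq_rdist: "x \<in> component \<Longrightarrow> y \<in> component \<Longrightarrow> riemannian_dist A g x y = ennreal (rdist x y)"
  using dist_finite[of x y] by (simp add: rdist_def less_top)

lemma base_in_component: "p0 \<in> component"
  by (simp add: component_def dist_self)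

lemma component_step:
  assumes "x \<in> component" "riemannian_dist A g x y < \<infinity>" shows "y \<in> component"
proof -
  have "riemannian_dist A g p0 x + riemannian_dist A g x y < \<infinity>"
    using assms by (simp add: component_def ennreal_add_less_top)
  then show ?thesis unfolding component_def
    using dist_triangle[of p0 y x] by (auto intro: order.strict_trans1)
qed

lemma dist_eq_0:
  assumes "riemannian_dist A g x y = 0" shows "x = y"
proof (rule ccontr)
  assume "x \<noteq> y"
  then obtain U where "open U" "x \<in> U" "y \<notin> U" using t1_space by blast
  from dist_ball_subset[OF this(1,2)] obtain \<delta> where "\<delta> > 0" "riemannian_dist A g x y < ennreal \<delta> \<Longrightarrow> y \<in> U"
    by blast
  then show False using assms \<open>y \<notin> U\<close> by simp
qed

text \<open>Gives access to total boundedness and to its equivalence with relative compactness in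
  complete metric spaces, the core of the Hopf-Rinow argument.\<close>

sublocale Metric_space component rdist
proof
  show "0 \<le> rdist x y" for x y by (simp add: rdist_def)
  show "rdist x y = rdist y x" for x y by (simp add: rdist_def dist_commute[of x y])
  show "rdist x y = 0 \<longleftrightarrow> x = y" if "x \<in> component" "y \<in> component" for x y
  proof
    assume "rdist x y = 0"
    then have "riemannian_dist A g x y = 0" using dist_eq_rdist[OF that] by simp
    then show "x = y" by (rule dist_eq_0)
  qed (simp add: rdist_def dist_self)
  show "rdist x z \<le> rdist x y + rdist y z" if "x \<in> component" "y \<in> component" "z \<in> component" for x y z
  proof -
    have nn: "0 \<le> rdist a b" for a b by (simp add: rdist_def)
    have "ennreal (rdist x z) \<le> ennreal (rdist x y) + ennreal (rdist y z)"
      using dist_triangle[of x z y]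
      unfolding dist_eq_rdist[OF that(1,3)] dist_eq_rdist[OF that(1,2)] dist_eq_rdist[OF that(2,3)] .
    also have "\<dots> = ennreal (rdist x y + rdist y z)" by (rule ennreal_plus[symmetric, OF nn nn])
    finally show ?thesis by (subst (asm) ennreal_le_iff) (auto intro: add_nonneg_nonneg nn)
  qed
qed

lemma open_component: "open component"
proof (subst open_subopen, intro ballI)
  fix x assume x: "x \<in> component"
  obtain N where N: "open N" "x \<in> N" "\<forall>q\<in>N. riemannian_dist A g x q < ennreal 1"
    using dist_small_nhd[of 1 x] by auto
  have "q \<in> component" if "q \<in> N" for q
  proof (rule component_step[OF x])
    have "riemannian_dist A g x q < ennreal 1" using N(3) that by blast
    also have "\<dots> < \<infinity>" by simp
    finally show "riemannian_dist A g x q < \<infinity>" .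
  qed
  then have "N \<subseteq> component" by blast
  with N show "\<exists>T. open T \<and> x \<in> T \<and> T \<subseteq> component" by blast
qed

text \<open>The two implications are the two halves of the comparison: \<open>dist_small_nhd\<close>
  for one, \<open>dist_ball_subset\<close> for the other.\<close>

lemma openin_mtopology_iff: "openin mtopology U \<longleftrightarrow> open U \<and> U \<subseteq> component"
proof
  assume U: "openin mtopology U"
  then have sub: "U \<subseteq> component" by (simp add: openin_mtopology)
  have "\<exists>T. open T \<and> x \<in> T \<and> T \<subseteq> U" if x: "x \<in> U" for x
  proof -
    obtain r where r: "r > 0" "mball x r \<subseteq> U" using U x by (auto simp: openin_mtopology)
    obtain N where N: "open N" "x \<in> N" "\<forall>q\<in>N. riemannian_dist A g x q < ennreal r"
      using dist_small_nhd[OF r(1), of x] by auto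
    have "q \<in> U" if "q \<in> N" for q
    proof -
      have q: "riemannian_dist A g x q < ennreal r" using N that by blast
      have xc: "x \<in> component" using x sub by blast
      have qc: "q \<in> component"
        by (rule component_step[OF xc]) (use q ennreal_less_top[of r] in \<open>auto intro: order.strict_trans\<close>)
      have "rdist x q < r" using q unfolding dist_eq_rdist[OF xc qc] by (simp add: ennreal_less_iff)
      then show ?thesis using r(2) xc qc by auto
    qed
    with N show ?thesis by blast
  qed
  then have "open U" by (subst open_subopen) blast
  with sub show "open U \<and> U \<subseteq> component" by blast
next
  assume U: "open U \<and> U \<subseteq> component"
  have "\<exists>r>0. mball x r \<subseteq> U" if x: "x \<in> U" for x
  proof -
    obtain \<delta> where \<delta>: "\<delta> > 0" "\<And>q. riemannian_dist A g x q < ennreal \<delta> \<Longrightarrow> q \<in> U"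
      using dist_ball_subset[of U x] U x by blast
    have "mball x \<delta> \<subseteq> U"
      using \<delta> dist_eq_rdist by (auto simp: ennreal_less_iff)
    with \<delta> show ?thesis by blast
  qed
  with U show "openin mtopology U" by (simp add: openin_mtopology)
qed

lemma mtopology_eq: "mtopology = top_of_set component"
  by (rule topology_eq[THEN iffD2]) (simp add: openin_mtopology_iff openin_open_eq[OF open_component] conj_commute)

lemma compactin_mtopology_iff: "compactin mtopology K \<longleftrightarrow> compact K \<and> K \<subseteq> component"
  unfolding mtopology_eq by (simp add: compactin_subtopology conj_commute)

lemma isCont_rdist: "q \<in> component \<Longrightarrow> isCont (rdist p0) q"
proof -
  assume q: "q \<in> component"
  show ?thesis
    unfolding isCont_def
  proof (rule tendstoI)
    fix e :: real assume e: "e > 0"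
    obtain N where N: "open N" "q \<in> N" "\<forall>z\<in>N. riemannian_dist A g q z < ennreal e"
      using dist_small_nhd[OF e, of q] by auto
    have "dist (rdist p0 z) (rdist p0 q) < e" if "z \<in> N" for z
    proof -
      have z: "riemannian_dist A g q z < ennreal e" using N that by blast
      have zc: "z \<in> component"
        by (rule component_step[OF q]) (use z ennreal_less_top[of e] in \<open>auto intro: order.strict_trans\<close>)
      have "rdist q z < e" using z unfolding dist_eq_rdist[OF q zc] by (simp add: ennreal_less_iff)
      then show ?thesis
        using triangle[OF base_in_component q zc] triangle[OF base_in_component zc q] commute[of q z]
        by (simp add: dist_real_def abs_less_iff)
    qed
    then show "\<forall>\<^sub>F z in at q. dist (rdist p0 z) (rdist p0 q) < e"
      using N(1,2) unfolding eventually_at_topological by blast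
  qed
qed

text \<open>This takes the place of minimising geodesics. On a curve from \<open>p0\<close> to
  \<open>q\<close> of length below \<open>r + e\<close>, the intermediate value theorem gives a
  point at distance exactly \<open>r'\<close> from \<open>p0\<close>; less than
  \<open>r + e - r'\<close> of the length remains.\<close>

lemma intermediate_point:
  assumes q: "q \<in> component" "rdist p0 q \<le> r" and r': "0 \<le> r'" "r' \<le> r" and e: "e > 0"
  shows "\<exists>m\<in>component. rdist p0 m \<le> r' \<and> rdist m q < r - r' + e"
proof (cases "rdist p0 q \<le> r'")
  case True
  then show ?thesis using q r' e by (intro bexI[of _ q]) auto
next
  case False
  have "riemannian_dist A g p0 q < ennreal (rdist p0 q + e)"
    unfolding dist_eq_rdist[OF base_in_component q(1)] using e by (simp add: ennreal_less_iff)
  also have "\<dots> \<le> ennreal (r + e)" using q(2) by (intro ennreal_leI) simp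
  finally obtain \<gamma> S where \<gamma>: "C1_curve_off \<gamma> S" "\<gamma> 0 = p0" "\<gamma> 1 = q" "length_on \<gamma> {0..1} < ennreal (r + e)"
    using dist_less_curve by metis
  have \<gamma>c: "continuous_on {0..1} \<gamma>" using \<gamma>(1) by (simp add: C1_curve_off_def path_def)
  have mono: "length_on \<gamma> I \<le> length_on \<gamma> {0..1}" if "I \<subseteq> {0..1}" for I
    unfolding length_on_def using that by (intro nn_integral_mono) (auto simp: indicator_def)
  have from0: "riemannian_dist A g p0 (\<gamma> t) \<le> length_on \<gamma> {0..t}" if "t \<in> {0..1}" for t
  proof (cases "t = 0")
    case False
    then show ?thesis using dist_subcurve[OF \<gamma>(1), of 0 t] that \<gamma>(2) by (simp add: closed_segment_eq_real_ivl)
  qed (simp add: \<gamma>(2) dist_self)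
  have inM: "\<gamma> t \<in> component" if "t \<in> {0..1}" for t
  proof -
    have "riemannian_dist A g p0 (\<gamma> t) \<le> length_on \<gamma> {0..1}"
      using from0[OF that] mono[of "{0..t}"] that by (auto intro: order.trans)
    also have "\<dots> < \<infinity>" using \<gamma>(4) by (rule order.strict_trans) simp
    finally show ?thesis by (simp add: component_def)
  qed
  have "continuous_on {0..1} (\<lambda>t. rdist p0 (\<gamma> t))"
  proof (rule continuous_on_compose2[OF _ \<gamma>c])
    show "continuous_on component (rdist p0)"
      by (intro continuous_at_imp_continuous_on ballI isCont_rdist)
  qed (use inM in auto)
  moreover have "rdist p0 (\<gamma> 0) \<le> r'" using r' \<gamma>(2) base_in_component by simp
  moreover have "r' \<le> rdist p0 (\<gamma> 1)" using False \<gamma>(3) by simp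
  ultimately obtain t where t: "0 \<le> t" "t \<le> 1" "rdist p0 (\<gamma> t) = r'"
    using IVT'[of "\<lambda>t. rdist p0 (\<gamma> t)" 0 r' 1] by auto
  have t1: "t \<noteq> 1" using t(3) False \<gamma>(3) by auto
  have tM: "\<gamma> t \<in> component" using inM t by simp
  have "ennreal (r' + rdist (\<gamma> t) q) = riemannian_dist A g p0 (\<gamma> t) + riemannian_dist A g (\<gamma> t) q"
    unfolding dist_eq_rdist[OF base_in_component tM] dist_eq_rdist[OF tM q(1)] t(3)
    using r' by (simp add: ennreal_plus)
  also have "\<dots> \<le> length_on \<gamma> {0..t} + length_on \<gamma> {t..1}"
    using from0[of t] dist_subcurve[OF \<gamma>(1), of t 1] t t1 \<gamma>(3)
    by (intro add_mono) (auto simp: closed_segment_eq_real_ivl)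
  also have "\<dots> = length_on \<gamma> {0..1}" using length_on_add[OF \<gamma>(1), of 0 t 1] t by simp
  also have "\<dots> < ennreal (r + e)" by (rule \<gamma>(4))
  finally have "r' + rdist (\<gamma> t) q < r + e" using r' by (subst (asm) ennreal_less_iff) auto
  then show ?thesis using tM t(3) by (intro bexI[of _ "\<gamma> t"]) auto
qed

text \<open>Local compactness, from the images of closed coordinate balls.\<close>

lemma compact_neighborhood:
  assumes x: "x \<in> component"
  shows "\<exists>\<delta>>0. \<exists>C. compactin mtopology C \<and> mball x \<delta> \<subseteq> C"
proof -
  define c where "c = chart_at A x"
  define y where "y = snd c x"
  have c: "c \<in> A" "x \<in> fst c" using chart_at by (auto simp: c_def)
  have p: "chart_inv c y = x" and y: "y \<in> chart_image c" using c by (auto simp: y_def)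
  have "open (chart_image c \<inter> chart_inv c -` component)"
    by (rule continuous_open_preimage[OF continuous_on_chart_inv[OF c(1)] open_chart_image[OF c(1)] open_component])
  moreover have "y \<in> chart_image c \<inter> chart_inv c -` component" using y p x by simp
  ultimately obtain r where r: "r > 0" "cball y r \<subseteq> chart_image c \<inter> chart_inv c -` component"
    using open_contains_cball by metis
  let ?C = "chart_inv c ` cball y r"
  have "compact ?C"
    by (intro compact_continuous_image continuous_on_subset[OF continuous_on_chart_inv[OF c(1)]]) (use r in auto)
  then have C: "compactin mtopology ?C" using r(2) by (auto simp: compactin_mtopology_iff)
  have "open (chart_inv c ` ball y r)"
    by (rule open_chart_inv_image[OF c(1)]) (use r(2) ball_subset_cball[of y r] in auto)
  moreover have "x \<in> chart_inv c ` ball y r" using p r(1) by (metis centre_in_ball imageI)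
  ultimately obtain \<delta> where \<delta>: "\<delta> > 0" "\<And>q. riemannian_dist A g x q < ennreal \<delta> \<Longrightarrow> q \<in> chart_inv c ` ball y r"
    using dist_ball_subset by metis
  have "mball x \<delta> \<subseteq> ?C"
  proof
    fix q assume "q \<in> mball x \<delta>"
    then have "riemannian_dist A g x q < ennreal \<delta>" using dist_eq_rdist by (auto simp: ennreal_less_iff)
    then show "q \<in> ?C" using \<delta>(2) ball_subset_cball[of y r] by blast
  qed
  with C \<delta>(1) show ?thesis by blast
qed

text \<open>The limit provided by completeness is at finite distance from late members of the
  sequence, so it cannot lie outside the component.\<close>

lemma mcomplete_component:
  assumes complete: "riemannian_complete A g" shows mcomplete
  unfolding mcomplete_def
proof (intro allI impI)
  fix \<sigma> assume \<sigma>: "MCauchy \<sigma>"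
  then have sM: "\<sigma> n \<in> component" for n by (auto simp: MCauchy_def)
  have "\<exists>N. \<forall>m\<ge>N. \<forall>n\<ge>N. riemannian_dist A g (\<sigma> m) (\<sigma> n) < e" if e: "e > 0" for e
  proof -
    \<comment> \<open>\<open>e\<close> is an extended real and may be infinite; a value strictly
      below it is the real threshold that \<open>MCauchy\<close> accepts.\<close>
    obtain y where y: "0 < y" "y < e" using dense[OF e] by blast
    then obtain r where r: "0 < ennreal r" "ennreal r < e" by (cases y) auto
    then have "r > 0" by simp
    then obtain N where "\<And>m n. N \<le> m \<Longrightarrow> N \<le> n \<Longrightarrow> rdist (\<sigma> m) (\<sigma> n) < r"
      using \<sigma> unfolding MCauchy_def by metis
    then have "riemannian_dist A g (\<sigma> m) (\<sigma> n) < ennreal r" if "N \<le> m" "N \<le> n" for m n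
      using that unfolding dist_eq_rdist[OF sM sM] by (simp add: ennreal_less_iff)
    with r(2) show ?thesis by (meson order.strict_trans)
  qed
  then obtain p where p: "(\<lambda>n. riemannian_dist A g (\<sigma> n) p) \<longlonglongrightarrow> 0"
    using complete unfolding riemannian_complete_def by blast
  have small: "\<forall>\<^sub>F n in sequentially. riemannian_dist A g (\<sigma> n) p < ennreal e" if "e > 0" for e
    using order_tendstoD(2)[OF p, of "ennreal e"] that by simp
  obtain n where "riemannian_dist A g (\<sigma> n) p < ennreal 1"
    using eventually_happens'[OF sequentially_bot small[of 1]] by auto
  then have pM: "p \<in> component"
    by (intro component_step[OF sM[of n]]) (auto intro: order.strict_trans)
  have "limitin mtopology \<sigma> p sequentially"
    unfolding limitin_metric
  proof (intro conjI allI impI pM)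
    fix e :: real assume "e > 0"
    from small[OF this] show "\<forall>\<^sub>F n in sequentially. \<sigma> n \<in> component \<and> rdist (\<sigma> n) p < e"
      by eventually_elim (use sM dist_eq_rdist[OF sM pM] in \<open>auto simp: ennreal_less_iff\<close>)
  qed
  then show "\<exists>x. limitin mtopology \<sigma> x sequentially" by blast
qed

text \<open>Hopf-Rinow: the radii of totally bounded balls form an open and closed subset of \<open>[0, \<infinity>)\<close>.\<close>

lemma totally_bounded_ball_limit:
  assumes s: "s > 0" and tb: "\<And>r. 0 \<le> r \<Longrightarrow> r < s \<Longrightarrow> mtotally_bounded (mcball p0 r)"
  shows "mtotally_bounded (mcball p0 s)"
  unfolding mtotally_bounded_def
proof (intro allI impI)
  fix e :: real assume e: "e > 0"
  \<comment> \<open>Stopping e/4 short of \<open>s\<close>: a point of the \<open>s\<close>-ball is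
    within e/2 of a point of the \<open>r\<close>-ball, which in turn is within e/4 of the finite
    net.\<close>
  define r where "r = max 0 (s - e / 4)"
  have r: "0 \<le> r" "r < s" "s - r \<le> e / 4" using s e by (auto simp: r_def max_def)
  obtain K where K: "finite K" "K \<subseteq> mcball p0 r" "mcball p0 r \<subseteq> (\<Union>x\<in>K. mball x (e / 4))"
    using tb[OF r(1,2)] e unfolding mtotally_bounded_def by (metis divide_pos_pos zero_less_numeral)
  have "q \<in> (\<Union>x\<in>K. mball x e)" if "q \<in> mcball p0 s" for q
  proof -
    have q: "q \<in> component" "rdist p0 q \<le> s" using that by auto
    obtain m where m: "m \<in> component" "rdist p0 m \<le> r" "rdist m q < s - r + e / 4"
      using intermediate_point[OF q r(1), of "e / 4"] r e by auto
    then obtain x where x: "x \<in> K" "m \<in> mball x (e / 4)" using K(3) base_in_component by fastforce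
    then have "rdist x q \<le> rdist x m + rdist m q" using m q by (intro triangle) auto
    also have "\<dots> < e" using x m r e by auto
    finally show ?thesis using x q by auto
  qed
  moreover have "K \<subseteq> mcball p0 s" using K(2) r(2) by fastforce
  ultimately show "\<exists>K. finite K \<and> K \<subseteq> mcball p0 s \<and> mcball p0 s \<subseteq> (\<Union>x\<in>K. mball x e)"
    using K(1) by blast
qed

text \<open>Completeness makes the totally bounded closed ball compact. Finitely many compact
  neighbourhoods of its points then cover a slightly larger ball.\<close>

lemma totally_bounded_ball_extend:
  assumes mcomplete and s: "s \<ge> 0" and tb: "mtotally_bounded (mcball p0 s)"
  shows "\<exists>\<delta>>0. mtotally_bounded (mcball p0 (s + \<delta>))"
proof -
  have "compactin mtopology (mtopology closure_of (mcball p0 s))"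
    using tb mtotally_bounded_eq_compact_closure_of[OF assms(1)] by blast
  then have K: "compactin mtopology (mcball p0 s)" by (simp add: closure_of_closedin)
  \<comment> \<open>The factor 2 leaves room: balls of radius \<open>D x\<close> cover the
    \<open>s\<close>-ball, and anything within \<open>D x\<close> of such a ball is still in the
    doubled one.\<close>
  have "\<forall>x\<in>mcball p0 s. \<exists>\<delta>>0. \<exists>C. compactin mtopology C \<and> mball x (2 * \<delta>) \<subseteq> C"
  proof
    fix x assume "x \<in> mcball p0 s"
    then obtain \<delta> C where "\<delta> > 0" "compactin mtopology C" "mball x \<delta> \<subseteq> C"
      using compact_neighborhood[of x] by auto
    then show "\<exists>\<delta>>0. \<exists>C. compactin mtopology C \<and> mball x (2 * \<delta>) \<subseteq> C"
      by (intro exI[of _ "\<delta> / 2"]) auto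
  qed
  then obtain D C where D: "\<And>x. x \<in> mcball p0 s \<Longrightarrow> D x > 0"
    and C: "\<And>x. x \<in> mcball p0 s \<Longrightarrow> compactin mtopology (C x)" "\<And>x. x \<in> mcball p0 s \<Longrightarrow> mball x (2 * D x) \<subseteq> C x"
    by metis
  have "mcball p0 s \<subseteq> \<Union>((\<lambda>x. mball x (D x)) ` mcball p0 s)" using D by fastforce
  then obtain F where F: "finite F" "F \<subseteq> (\<lambda>x. mball x (D x)) ` mcball p0 s" "mcball p0 s \<subseteq> \<Union>F"
    using compactinD[OF K, of "(\<lambda>x. mball x (D x)) ` mcball p0 s"] by auto
  then obtain X where X: "X \<subseteq> mcball p0 s" "finite X" "F = (\<lambda>x. mball x (D x)) ` X"
    using finite_subset_image[OF F(1,2)] by blast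
  \<comment> \<open>The entry 1 makes the minimum meaningful even for empty \<open>X\<close>. Half
    of \<delta> is used to enlarge the radius, the other half as slack for the intermediate
    point.\<close>
  define \<delta> where "\<delta> = Min (insert 1 (D ` X))"
  have \<delta>: "\<delta> > 0" "\<And>x. x \<in> X \<Longrightarrow> \<delta> \<le> D x"
    using X D by (auto simp: \<delta>_def subset_iff)
  have "mcball p0 (s + \<delta> / 2) \<subseteq> \<Union>(C ` X)"
  proof
    fix q assume "q \<in> mcball p0 (s + \<delta> / 2)"
    then have q: "q \<in> component" "rdist p0 q \<le> s + \<delta> / 2" by auto
    obtain m where m: "m \<in> component" "rdist p0 m \<le> s" "rdist m q < s + \<delta> / 2 - s + \<delta> / 2"
      using intermediate_point[OF q s, of "\<delta> / 2"] \<delta>(1) by auto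
    then have "m \<in> \<Union>F" using F(3) base_in_component by auto
    then obtain x where x: "x \<in> X" "m \<in> mball x (D x)" using X(3) by blast
    then have "rdist x q \<le> rdist x m + rdist m q" using m q by (intro triangle) auto
    also have "\<dots> < 2 * D x" using x m \<delta>(2)[OF x(1)] by auto
    finally have "q \<in> mball x (2 * D x)" using x q by auto
    then show "q \<in> \<Union>(C ` X)" using C(2) x(1) X(1) by blast
  qed
  moreover have "mtotally_bounded (\<Union>(C ` X))"
  proof (rule mtotally_bounded_Union)
    fix Q assume "Q \<in> C ` X"
    then show "mtotally_bounded Q" using C(1) X(1) compactin_imp_mtotally_bounded by blast
  qed (use X in auto)
  ultimately have "mtotally_bounded (mcball p0 (s + \<delta> / 2))" using mtotally_bounded_subset by blast
  then show ?thesis using \<delta>(1) by (intro exI[of _ "\<delta> / 2"]) auto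
qed

lemma compact_mcball:
  assumes complete: "riemannian_complete A g" shows "compact (mcball p0 r)"
proof -
  note mc = mcomplete_component[OF complete]
  let ?T = "{r. 0 \<le> r \<and> mtotally_bounded (mcball p0 r)}"
  have T0: "0 \<in> ?T"
  proof -
    have "mcball p0 0 = {p0}" using base_in_component by (auto simp: antisym_conv)
    then show ?thesis using base_in_component by simp
  qed
  have mono: "r \<in> ?T" if "t \<in> ?T" "0 \<le> r" "r \<le> t" for r t
    using that mtotally_bounded_subset[of "mcball p0 t" "mcball p0 r"] by fastforce
  have all: "r \<in> ?T" if "0 \<le> r" for r
  proof (rule ccontr)
    assume r: "r \<notin> ?T"
    have bdd: "t \<le> r" if "t \<in> ?T" for t using mono[OF that \<open>0 \<le> r\<close>] r by fastforce
    then have bd: "bdd_above ?T" by (rule bdd_aboveI)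
    define s where "s = Sup ?T"
    have s0: "0 \<le> s" unfolding s_def by (rule cSup_upper[OF T0 bd])
    have below: "t \<in> ?T" if t: "0 \<le> t" "t < s" for t
    proof -
      have "\<exists>t'\<in>?T. t < t'" using less_cSupD[of ?T t] T0 t(2) unfolding s_def by blast
      then obtain t' where "t' \<in> ?T" "t < t'" by blast
      then show ?thesis using mono t(1) by auto
    qed
    \<comment> \<open>The supremum is attained by the limit lemma, which requires a positive radius;
      the ball of radius 0 is a single point. The extension lemma then exceeds the supremum.\<close>
    have "s \<in> ?T"
    proof (cases "s = 0")
      case False
      then show ?thesis using s0 totally_bounded_ball_limit[of s] below by auto
    qed (use T0 in simp)
    then obtain \<delta> where "\<delta> > 0" "mtotally_bounded (mcball p0 (s + \<delta>))"
      using totally_bounded_ball_extend[OF mc s0] by auto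
    then have "s + \<delta> \<in> ?T" using s0 by simp
    then have "s + \<delta> \<le> s" unfolding s_def by (rule cSup_upper[OF _ bd])
    then show False using \<open>\<delta> > 0\<close> by simp
  qed
  show ?thesis
  proof (cases "0 \<le> r")
    case True
    then have "compactin mtopology (mtopology closure_of (mcball p0 r))"
      using all[of r] mtotally_bounded_eq_compact_closure_of[OF mc] by blast
    then show ?thesis by (simp add: closure_of_closedin compactin_mtopology_iff)
  next
    case False
    have "q \<notin> mcball p0 r" for q
    proof
      assume "q \<in> mcball p0 r"
      then have "rdist p0 q \<le> r" by simp
      then show False using False nonneg[of p0 q] by linarith
    qed
    then have "mcball p0 r = {}" by blast
    then show ?thesis by simp
  qed
qed

text \<open>The case distinction is essential: off the component the distance is infinite,
  \<open>enn2real\<close> sends it to 0, and the formula alone would give 1 there.\<close>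

definition cutoff :: "real \<Rightarrow> 'm \<Rightarrow> real"
  where "cutoff k q = (if q \<in> component then max 0 (1 - rdist p0 q / k) else 0)"

lemma cutoff_bounds: "k > 0 \<Longrightarrow> 0 \<le> cutoff k q \<and> cutoff k q \<le> 1"
  by (auto simp: cutoff_def)

lemma cutoff_support: "k > 0 \<Longrightarrow> q \<notin> mcball p0 k \<Longrightarrow> cutoff k q = 0"
  using base_in_component by (auto simp: cutoff_def max_def not_le field_simps)

text \<open>Points at finite distance are both inside or both outside the component, so the case
  distinction in \<open>cutoff\<close> is never crossed; inside, the triangle inequality
  applies.\<close>

lemma cutoff_lipschitz:
  assumes k: "k > 0" and d: "riemannian_dist A g x y \<le> ennreal G" and G: "G \<ge> 0"
  shows "\<bar>cutoff k y - cutoff k x\<bar> \<le> G / k"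
proof -
  have fin: "riemannian_dist A g x y < \<infinity>" "riemannian_dist A g y x < \<infinity>"
    using d ennreal_less_top[of G] by (auto simp: dist_commute[of y x] intro: order.strict_trans1)
  show ?thesis
  proof (cases "x \<in> component")
    case True
    have yc: "y \<in> component" by (rule component_step[OF True fin(1)])
    have "rdist x y \<le> G" using d G unfolding dist_eq_rdist[OF True yc] by simp
    then have "\<bar>rdist p0 x - rdist p0 y\<bar> \<le> G"
      using triangle[OF base_in_component True yc] triangle[OF base_in_component yc True] commute[of x y]
      by (simp add: abs_le_iff)
    then have "\<bar>rdist p0 x / k - rdist p0 y / k\<bar> \<le> G / k"
      using k by (simp add: diff_divide_distrib[symmetric] divide_right_mono)
    then show ?thesis using True yc by (auto simp: cutoff_def max_def)
  next
    case False
    then have "y \<notin> component" using component_step[OF _ fin(2)] by blast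
    then show ?thesis using False k G by (simp add: cutoff_def)
  qed
qed

lemma continuous_on_cutoff:
  assumes k: "k > 0" shows "continuous_on UNIV (cutoff k)"
proof (rule continuous_at_imp_continuous_on, intro ballI)
  fix q
  show "isCont (cutoff k) q"
    unfolding isCont_def
  proof (rule tendstoI)
    fix e :: real assume e: "e > 0"
    obtain N where N: "open N" "q \<in> N" "\<forall>z\<in>N. riemannian_dist A g q z < ennreal (e * k / 2)"
      using dist_small_nhd[of "e * k / 2" q] e k by auto
    have "dist (cutoff k z) (cutoff k q) < e" if "z \<in> N" for z
      using cutoff_lipschitz[OF k, of q z "e * k / 2"] N(3) that e k by (auto simp: dist_real_def less_imp_le)
    then show "\<forall>\<^sub>F z in at q. dist (cutoff k z) (cutoff k q) < e"
      using N(1,2) unfolding eventually_at_topological by blast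
  qed
qed

end

section \<open>Integrating the divergence\<close>

text \<open>Squaring removes the kink of the positive part at 0, which leaves a C1 truncation built
  from polynomials.\<close>

lemma C1_on_max_0_square:
  fixes f :: "'a::real_normed_vector \<Rightarrow> real"
  assumes "C1_on S f" shows "C1_on S (\<lambda>x. (max 0 (f x))\<^sup>2)"
proof (rule C1_on_real_compose[OF assms subset_UNIV])
  show "continuous_on UNIV (\<lambda>t::real. 2 * max 0 t)" by (intro continuous_intros)
  show "((\<lambda>t. (max 0 t)\<^sup>2) has_real_derivative 2 * max 0 t) (at t)" for t :: real
  proof -
    consider "t < 0" | "t = 0" | "t > 0" by linarith
    then show ?thesis
    proof cases
      case 1
      have "((\<lambda>t. 0) has_real_derivative 2 * max 0 t) (at t)" using 1 by simp
      then show ?thesis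
        by (rule has_field_derivative_transform_within_open[of _ _ _ "{..<0}"]) (use 1 in auto)
    next
      case 2
      have "((\<lambda>h. (max 0 h)\<^sup>2 / h) \<longlongrightarrow> 0) (at (0::real))"
      proof (rule Lim_null_comparison)
        show "\<forall>\<^sub>F h in at 0. norm ((max 0 h)\<^sup>2 / h) \<le> \<bar>h\<bar>" for h :: real
          by (intro always_eventually allI) (auto simp: max_def power2_eq_square)
        show "((\<lambda>h::real. \<bar>h\<bar>) \<longlongrightarrow> 0) (at 0)" by (rule tendsto_rabs_zero) (rule tendsto_ident_at)
      qed
      then show ?thesis using 2 by (simp add: DERIV_def)
    next
      case 3
      have "((\<lambda>t. t\<^sup>2) has_real_derivative 2 * max 0 t) (at t)"
        using 3 by (auto intro!: derivative_eq_intros)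
      then show ?thesis
        by (rule has_field_derivative_transform_within_open[of _ _ _ "{0<..}"]) (use 3 in auto)
    qed
  qed
qed

text \<open>With d the distance of \<open>x\<close> and \<open>y\<close>, the inner square is at
  least 1 for d \<le> r and 0 for d^2 \<ge> 2 r^2; the outer expression clips it at 1. Only C1
  regularity is claimed. The squared norm is written as a sum over \<open>Basis\<close> so that the
  closure rules for C1 maps apply.\<close>

definition smooth_bump :: "'a::euclidean_space \<Rightarrow> real \<Rightarrow> 'a \<Rightarrow> real"
  where "smooth_bump x r y = 1 - (max 0 (1 - (max 0 (2 - (\<Sum>b\<in>Basis. ((y - x) \<bullet> b)\<^sup>2) / r\<^sup>2))\<^sup>2))\<^sup>2"

lemma smooth_bump_C1: "C1_on S (smooth_bump x r)"
proof -
  have "C1_on S (\<lambda>y. (y - x) \<bullet> b)" for b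
    by (intro C1_on_bounded_linear[OF bounded_linear_inner_left] C1_on_diff C1_on_ident C1_on_const)
  then show ?thesis
    unfolding smooth_bump_def[abs_def] divide_inverse power2_eq_square[of "_ \<bullet> _"]
    by (intro C1_on_diff C1_on_const C1_on_max_0_square C1_on_mult C1_on_sum)
qed

lemma smooth_bump_properties:
  assumes r: "r > 0"
  shows "0 \<le> smooth_bump x r y" "smooth_bump x r y \<le> 1"
    "y \<in> ball x r \<Longrightarrow> smooth_bump x r y = 1" "y \<notin> cball x (2 * r) \<Longrightarrow> smooth_bump x r y = 0"
proof -
  define s where "s = (\<Sum>b\<in>Basis. ((y - x) \<bullet> b)\<^sup>2) / r\<^sup>2"
  define b where "b = (max 0 (2 - s))\<^sup>2"
  have bump: "smooth_bump x r y = 1 - (max 0 (1 - b))\<^sup>2" by (simp add: smooth_bump_def b_def s_def)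
  have s: "s = (dist x y)\<^sup>2 / r\<^sup>2"
    unfolding s_def dist_norm norm_minus_commute[of x] power2_norm_eq_inner
    by (subst euclidean_inner) (simp add: power2_eq_square)
  have "0 \<le> b" by (simp add: b_def)
  then have "(max 0 (1 - b))\<^sup>2 \<le> 1\<^sup>2" by (intro power_mono) auto
  then show "0 \<le> smooth_bump x r y" "smooth_bump x r y \<le> 1" by (auto simp: bump)
  show "smooth_bump x r y = 1" if "y \<in> ball x r"
  proof -
    have "(dist x y)\<^sup>2 \<le> r\<^sup>2" using that by (intro power_mono) auto
    then have "s \<le> 1" using r by (simp add: s)
    then have "1\<^sup>2 \<le> b" unfolding b_def by (intro power_mono) auto
    then show ?thesis by (simp add: bump)
  qed
  show "smooth_bump x r y = 0" if "y \<notin> cball x (2 * r)"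
  proof -
    have "(2 * r)\<^sup>2 \<le> (dist x y)\<^sup>2" using that r by (intro power_mono) auto
    then have "4 * r\<^sup>2 \<le> (dist x y)\<^sup>2" by (simp add: power_mult_distrib)
    then have "4 \<le> s" using r by (simp add: s pos_le_divide_eq)
    then have "b = 0" by (simp add: b_def)
    then show ?thesis by (simp add: bump)
  qed
qed

context riemannian_manifold
begin

section \<open>Functions on the manifold and their derivatives along a field\<close>

lemma continuous_on_from_charts:
  fixes f :: "'m \<Rightarrow> 'z::topological_space"
  assumes "\<And>c. c \<in> A \<Longrightarrow> continuous_on (chart_image c) (f \<circ> chart_inv c)"
  shows "continuous_on UNIV f"
proof -
  have "continuous_on (fst c) f" if c: "c \<in> A" for c
  proof -
    have "continuous_on (fst c) ((f \<circ> chart_inv c) \<circ> snd c)"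
      by (intro continuous_on_compose continuous_on_chart[OF c] continuous_on_subset[OF assms[OF c]]) auto
    then show ?thesis by (rule continuous_on_eq) (use c in auto)
  qed
  then have "continuous_on (\<Union>c\<in>A. fst c) f" by (intro continuous_on_open_UN open_chart)
  then show ?thesis using smooth_atlas by (simp add: smooth_atlas_def)
qed

lemma C1_function_continuous: "C1_function f \<Longrightarrow> continuous_on UNIV f"
  unfolding C1_function_def by (rule continuous_on_from_charts) (rule C1_on_imp_continuous_on, blast)

lemma C1_function_const: "C1_function (\<lambda>p. k)"
  by (simp add: C1_function_def o_def)

lemma C1_function_add: "C1_function f \<Longrightarrow> C1_function h \<Longrightarrow> C1_function (\<lambda>p. f p + h p)"
  by (auto simp: C1_function_def o_def intro: C1_on_add)

lemma C1_function_diff: "C1_function f \<Longrightarrow> C1_function h \<Longrightarrow> C1_function (\<lambda>p. f p - h p)"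
  by (auto simp: C1_function_def o_def intro: C1_on_diff)

lemma C1_function_mult: "C1_function f \<Longrightarrow> C1_function h \<Longrightarrow> C1_function (\<lambda>p. f p * h p)"
  by (auto simp: C1_function_def o_def intro: C1_on_mult)

definition vderiv :: "('m, 'n) vfield \<Rightarrow> ('m \<Rightarrow> real) \<Rightarrow> 'm \<Rightarrow> real"
  where "vderiv X f p = chart_deriv X (chart_at A p) f p"

lemma vderiv_eq:
  assumes "C1_function f" "smooth_vector_field A X" "c \<in> A" "p \<in> fst c"
  shows "vderiv X f p = chart_deriv X c f p"
  unfolding vderiv_def by (rule chart_deriv_cong) (use assms chart_at in auto)

lemma vderiv_add:
  assumes "C1_function f" "C1_function h"
  shows "vderiv X (\<lambda>p. f p + h p) p = vderiv X f p + vderiv X h p"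
proof -
  let ?c = "chart_at A p"
  have x: "snd ?c p \<in> chart_image ?c" using chart_at by simp
  have "((\<lambda>y. (f \<circ> chart_inv ?c) y + (h \<circ> chart_inv ?c) y) has_derivative
    (\<lambda>v. frechet_derivative (f \<circ> chart_inv ?c) (at (snd ?c p)) v
       + frechet_derivative (h \<circ> chart_inv ?c) (at (snd ?c p)) v)) (at (snd ?c p))"
    by (intro has_derivative_add C1_function_has_derivative assms chart_at x)
  from fun_cong[OF frechet_derivative_at[OF this]] show ?thesis
    by (simp add: vderiv_def chart_deriv_def o_def)
qed

text \<open>Used where a partition function is locally constant: equal to 1 near the support of the
  cutoff, or equal to 0 off its own support.\<close>

lemma vderiv_local:
  assumes f: "C1_function f" and U: "open U" "p \<in> U" and eq: "\<And>q. q \<in> U \<Longrightarrow> f q = k"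
  shows "vderiv X f p = 0"
proof -
  let ?c = "chart_at A p"
  let ?x = "snd ?c p"
  let ?V = "chart_image ?c \<inter> chart_inv ?c -` U"
  note c = chart_at[of p]
  have V: "open ?V"
    by (rule continuous_open_preimage[OF continuous_on_chart_inv[OF c(1)] open_chart_image[OF c(1)] U(1)])
  have x: "?x \<in> ?V" using c U(2) by simp
  have "((\<lambda>y. k) has_derivative (\<lambda>v. 0)) (at ?x)" by simp
  then have "((f \<circ> chart_inv ?c) has_derivative (\<lambda>v. 0)) (at ?x)"
    by (rule has_derivative_transform_within_open[OF _ V x]) (use eq in auto)
  from frechet_derivative_at[OF this] show ?thesis
    by (simp add: vderiv_def chart_deriv_def fun_eq_iff)
qed

lemma continuous_on_vderiv:
  assumes f: "C1_function f" and X: "smooth_vector_field A X"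
  shows "continuous_on UNIV (vderiv X f)"
proof (rule continuous_on_from_charts)
  fix c assume c: "c \<in> A"
  have fc: "C1_on (chart_image c) (f \<circ> chart_inv c)" using f c by (simp add: C1_function_def)
  have "continuous_on (chart_image c) (\<lambda>x. \<Sum>i\<in>UNIV. X c x $ i * partial i (f \<circ> chart_inv c) x)"
    unfolding partial_def
    by (intro continuous_intros C1_on_imp_continuous_on[OF vector_field_C1[OF X c]] C1_on_continuous_derivative[OF fc])
  then show "continuous_on (chart_image c) (vderiv X f \<circ> chart_inv c)"
  proof (rule continuous_on_eq)
    fix x assume x: "x \<in> chart_image c"
    have "(f \<circ> chart_inv c) differentiable (at x)" using fc x by (simp add: C1_on_iff)
    from fun_cong[OF frechet_derivative_at[OF has_derivative_partial[OF this]], of "X c x"]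
    show "(\<Sum>i\<in>UNIV. X c x $ i * partial i (f \<circ> chart_inv c) x) = (vderiv X f \<circ> chart_inv c) x"
      using c x by (simp add: vderiv_eq[OF f X c] chart_deriv_def)
  qed
qed

lemma continuous_on_metric_norm:
  assumes X: "smooth_vector_field A X" shows "continuous_on UNIV (metric_norm A g X)"
proof (rule continuous_on_from_charts)
  fix c assume c: "c \<in> A"
  have "continuous_on (chart_image c) (\<lambda>x. gnorm c x (X c x))"
    by (intro continuous_on_gnorm c C1_on_imp_continuous_on[OF vector_field_C1[OF X c]]) auto
  then show "continuous_on (chart_image c) (metric_norm A g X \<circ> chart_inv c)"
    by (rule continuous_on_eq) (use c in \<open>simp add: metric_norm_eq[OF X c]\<close>)
qed

lemma metric_norm_nonneg: "smooth_vector_field A X \<Longrightarrow> 0 \<le> metric_norm A g X p"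
  using metric_norm_eq[OF _ chart_at, of X p] gnorm_nonneg[OF chart_at(1)[of p]] chart_at(2)[of p] by simp

lemma finite_volume_nhd: "\<exists>N. open N \<and> p \<in> N \<and> emeasure \<mu>\<^sub>g N < \<infinity>"
proof -
  define c where "c = chart_at A p"
  have c: "c \<in> A" "p \<in> fst c" using chart_at by (auto simp: c_def)
  obtain r where r: "r > 0" "cball (snd c p) r \<subseteq> chart_image c"
    using open_contains_cball open_chart_image[OF c(1)] c(2) snd_in_chart_image by metis
  let ?N = "chart_inv c ` ball (snd c p) r"
  let ?K = "chart_inv c ` cball (snd c p) r"
  have "open ?N" by (rule open_chart_inv_image[OF c(1)]) (use r ball_subset_cball in auto)
  moreover have "p \<in> ?N" by (rule image_eqI[of _ _ "snd c p"]) (use c r in auto)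
  moreover have "compact ?K"
    by (intro compact_continuous_image continuous_on_subset[OF continuous_on_chart_inv[OF c(1)] r(2)]) simp
  then have "?K \<in> sets \<mu>\<^sub>g" by (simp add: sets_volume borel_closed compact_imp_closed)
  then have "emeasure \<mu>\<^sub>g ?N \<le> emeasure \<mu>\<^sub>g ?K" by (intro emeasure_mono) auto
  then have "emeasure \<mu>\<^sub>g ?N < \<infinity>"
    using chart_volume_finite[OF c(1) compact_cball r(2)] by (rule order.strict_trans1)
  ultimately show ?thesis by blast
qed

text \<open>Provides the set over which the freezing error \<epsilon> is integrated; its volume has
  to be finite for the total error to be controlled.\<close>

lemma finite_volume_nhd_compact:
  assumes "compact K" shows "\<exists>N. open N \<and> K \<subseteq> N \<and> emeasure \<mu>\<^sub>g N < \<infinity>"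
proof -
  obtain N where N: "\<And>p. open (N p) \<and> p \<in> N p \<and> emeasure \<mu>\<^sub>g (N p) < \<infinity>"
    using finite_volume_nhd by metis
  obtain P where P: "finite P" "P \<subseteq> K" "K \<subseteq> (\<Union>p\<in>P. N p)"
    using compactE_image[OF assms, of K N] N by (metis UN_I subsetI)
  have "emeasure \<mu>\<^sub>g (\<Union>p\<in>P. N p) \<le> (\<Sum>p\<in>P. emeasure \<mu>\<^sub>g (N p))"
    by (rule emeasure_subadditive_finite) (use P N in \<open>auto simp: sets_volume\<close>)
  also have "\<dots> < \<infinity>" using P(1) N by (simp add: less_top)
  finally have "emeasure \<mu>\<^sub>g (\<Union>p\<in>P. N p) < \<infinity>" .
  moreover have "open (\<Union>p\<in>P. N p)" using N by blast
  ultimately show ?thesis using P(3) by blast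
qed

text \<open>Outside \<open>fst c\<close> the bump is continued by \<open>0\<close>; this is \<open>C\<^sup>1\<close> in every chart because its support is
  compact, hence closed, in the Hausdorff space \<open>'m\<close>.\<close>

lemma bump_function:
  assumes W: "open W" "q \<in> W"
  shows "\<exists>\<beta> K V. C1_function \<beta> \<and> (\<forall>p. 0 \<le> \<beta> p \<and> \<beta> p \<le> 1) \<and> compact K \<and> K \<subseteq> W \<and>
    (\<forall>p. p \<notin> K \<longrightarrow> \<beta> p = 0) \<and> open V \<and> q \<in> V \<and> (\<forall>p\<in>V. \<beta> p = 1)"
proof -
  define c where "c = chart_at A q"
  define x where "x = snd c q"
  have c: "c \<in> A" "q \<in> fst c" using chart_at by (auto simp: c_def)
  have q: "chart_inv c x = q" and x: "x \<in> chart_image c" using c by (auto simp: x_def)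
  have "open (chart_image c \<inter> chart_inv c -` W)"
    by (rule continuous_open_preimage[OF continuous_on_chart_inv[OF c(1)] open_chart_image[OF c(1)] W(1)])
  moreover have "x \<in> chart_image c \<inter> chart_inv c -` W" using x q W(2) by simp
  ultimately obtain s where s: "s > 0" "cball x s \<subseteq> chart_image c \<inter> chart_inv c -` W"
    using open_contains_cball by metis
  define r where "r = s / 2"
  have r: "r > 0" "cball x (2 * r) \<subseteq> chart_image c" "cball x (2 * r) \<subseteq> chart_inv c -` W"
    using s by (auto simp: r_def)
  define \<beta> where "\<beta> p = (if p \<in> fst c then smooth_bump x r (snd c p) else 0)" for p
  define K where "K = chart_inv c ` cball x (2 * r)"
  have K: "compact K" unfolding K_def
    by (intro compact_continuous_image continuous_on_subset[OF continuous_on_chart_inv[OF c(1)] r(2)]) simp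
  have \<beta>0: "\<beta> p = 0" if "p \<notin> K" for p
  proof (cases "p \<in> fst c")
    case True
    then have "snd c p \<notin> cball x (2 * r)" using that c(1) unfolding K_def by (metis chart_inv_snd imageI)
    from smooth_bump_properties(4)[OF r(1) this] show ?thesis by (simp add: \<beta>_def)
  qed (simp add: \<beta>_def)
  have "C1_function \<beta>"
    unfolding C1_function_def
  proof
    fix c' assume c': "c' \<in> A"
    let ?O = "overlap c' c" and ?E = "chart_image c' \<inter> chart_inv c' -` (- K)"
    have O: "open ?O" by (rule open_overlap[OF c' c(1)])
    have E: "open ?E"
      by (rule continuous_open_preimage[OF continuous_on_chart_inv[OF c'] open_chart_image[OF c']])
        (use K in \<open>simp add: compact_imp_closed open_Compl\<close>)
    have 1: "C1_on ?O (\<beta> \<circ> chart_inv c')"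
    proof (rule C1_on_cong[OF O])
      show "C1_on ?O (\<lambda>y. smooth_bump x r (transition c' c y))"
        by (rule C1_on_compose[OF transition_C1[OF c' c(1)] smooth_bump_C1[of UNIV] subset_UNIV])
      show "smooth_bump x r (transition c' c y) = (\<beta> \<circ> chart_inv c') y" if "y \<in> ?O" for y
        using that by (auto simp: \<beta>_def overlap_eq[OF c'] transition_def)
    qed
    have 2: "C1_on ?E (\<beta> \<circ> chart_inv c')"
      by (rule C1_on_cong[OF E C1_on_const[of _ 0]]) (use \<beta>0 in auto)
    have "chart_image c' \<subseteq> ?O \<union> ?E"
    proof -
      have "K \<subseteq> fst c" using c(1) r(2) by (auto simp: K_def subset_iff)
      then show ?thesis by (auto simp: overlap_eq[OF c'])
    qed
    then show "C1_on (chart_image c') (\<beta> \<circ> chart_inv c')" by (rule C1_on_subset[OF C1_on_Un[OF O E 1 2]])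
  qed
  moreover have "0 \<le> \<beta> p \<and> \<beta> p \<le> 1" for p
    using smooth_bump_properties(1,2)[OF r(1), of x "snd c p"] by (simp add: \<beta>_def)
  moreover have "K \<subseteq> W" using r(3) by (auto simp: K_def)
  moreover have b: "ball x r \<subseteq> chart_image c" using r(1,2) by (auto simp: subset_iff)
  then have "open (chart_inv c ` ball x r)" by (intro open_chart_inv_image[OF c(1)]) auto
  moreover have "q \<in> chart_inv c ` ball x r" using q r(1) by (metis centre_in_ball imageI)
  moreover have "\<beta> p = 1" if "p \<in> chart_inv c ` ball x r" for p
    using that b c(1) smooth_bump_properties(3)[OF r(1)] by (auto simp: \<beta>_def subset_iff)
  ultimately show ?thesis using K \<beta>0 by blast
qed

end

text \<open>Here \<open>R\<close> is any nonnegative C1 weight, and the base point \<open>p0\<close>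
  is the one at which the divergence will be shown to vanish.\<close>

locale conformal_vector_field = pointed_riemannian_manifold A g p0
  for A :: "('m::{t2_space,second_countable_topology}, 'n::finite) chart set"
    and g :: "('m, 'n) tensor2" and p0 :: 'm +
  fixes X :: "('m, 'n) vfield" and \<sigma> :: "'m \<Rightarrow> real" and R :: "'m \<Rightarrow> real"
  assumes X: "smooth_vector_field A X" and R: "C1_function R" and R_nonneg: "\<And>p. R p \<ge> 0"
    and lie: "\<And>c x. c \<in> A \<Longrightarrow> x \<in> chart_image c \<Longrightarrow>
      lie_derivative X g c x = (2 * \<sigma> (chart_inv c x)) *\<^sub>R g c x"
begin

text \<open>The divergence of \<open>R X\<close>.\<close>

definition flux_div :: "'m \<Rightarrow> real"
  where "flux_div p = R p * (real CARD('n) * \<sigma> p) + vderiv X R p"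

abbreviation flux_norm :: "'m \<Rightarrow> real"
  where "flux_norm p \<equiv> R p * metric_norm A g X p"

lemma C1_function_conformal_factor: "C1_function \<sigma>"
  unfolding C1_function_def by (intro ballI conformal_factor_C1[OF X]) (auto simp: lie)

lemma continuous_on_flux_div: "continuous_on UNIV flux_div"
  unfolding flux_div_def[abs_def]
  by (intro continuous_intros C1_function_continuous[OF R] continuous_on_vderiv[OF R X]
      C1_function_continuous[OF C1_function_conformal_factor])

lemma continuous_on_flux_norm: "continuous_on UNIV flux_norm"
  by (intro continuous_intros C1_function_continuous[OF R] continuous_on_metric_norm[OF X])

text \<open>\<open>\<eta>\<close> times the divergence plus the derivative of \<open>\<eta>\<close> along \<open>R X\<close> is the divergence of \<open>\<eta> R X\<close>.\<close>

definition flux_term :: "('m \<Rightarrow> real) \<Rightarrow> 'm \<Rightarrow> real"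
  where "flux_term \<eta> p = \<eta> p * flux_div p + R p * vderiv X \<eta> p"

text \<open>The factor 1 / k is the Lipschitz constant of the cutoff, \<epsilon> the freezing error
  per unit of volume. The right side is linear in \<eta> and the left side subadditive, so the
  estimate passes from pieces to sums.\<close>

definition flux_estimate :: "real \<Rightarrow> real \<Rightarrow> ('m \<Rightarrow> real) \<Rightarrow> bool"
  where "flux_estimate k \<epsilon> \<eta> \<longleftrightarrow>
    integrable \<mu>\<^sub>g (\<lambda>p. \<eta> p * (flux_norm p + \<epsilon>)) \<and>
    integrable \<mu>\<^sub>g (\<lambda>p. cutoff k p * flux_term \<eta> p) \<and>
    \<bar>\<integral>p. cutoff k p * flux_term \<eta> p \<partial>\<mu>\<^sub>g\<bar> \<le> (1 / k) * (\<integral>p. \<eta> p * (flux_norm p + \<epsilon>) \<partial>\<mu>\<^sub>g)"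

lemma flux_term_continuous: "C1_function \<eta> \<Longrightarrow> continuous_on UNIV (flux_term \<eta>)"
  unfolding flux_term_def[abs_def]
  by (intro continuous_intros C1_function_continuous[OF R] C1_function_continuous continuous_on_flux_div
      continuous_on_vderiv[OF _ X])

lemma flux_estimate_add:
  assumes "C1_function \<eta>" "C1_function \<theta>" "flux_estimate k \<epsilon> \<eta>" "flux_estimate k \<epsilon> \<theta>"
  shows "flux_estimate k \<epsilon> (\<lambda>p. \<eta> p + \<theta> p)"
proof -
  have t: "cutoff k p * flux_term (\<lambda>p. \<eta> p + \<theta> p) p = cutoff k p * flux_term \<eta> p + cutoff k p * flux_term \<theta> p" for p
    by (simp add: flux_term_def vderiv_add[OF assms(1,2)] algebra_simps)
  have n: "(\<eta> p + \<theta> p) * (flux_norm p + \<epsilon>) = \<eta> p * (flux_norm p + \<epsilon>) + \<theta> p * (flux_norm p + \<epsilon>)" for p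
    by (simp add: algebra_simps)
  note a' = assms(3)[unfolded flux_estimate_def] and b' = assms(4)[unfolded flux_estimate_def]
  note a = conjunct1[OF a'] conjunct1[OF conjunct2[OF a']] conjunct2[OF conjunct2[OF a']]
  note b = conjunct1[OF b'] conjunct1[OF conjunct2[OF b']] conjunct2[OF conjunct2[OF b']]
  show ?thesis
    unfolding flux_estimate_def t n
  proof (intro conjI)
    show "integrable \<mu>\<^sub>g (\<lambda>p. \<eta> p * (flux_norm p + \<epsilon>) + \<theta> p * (flux_norm p + \<epsilon>))"
      "integrable \<mu>\<^sub>g (\<lambda>p. cutoff k p * flux_term \<eta> p + cutoff k p * flux_term \<theta> p)"
      by (rule Bochner_Integration.integrable_add[OF a(1) b(1)], rule Bochner_Integration.integrable_add[OF a(2) b(2)])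
    have 1: "(\<integral>p. cutoff k p * flux_term \<eta> p + cutoff k p * flux_term \<theta> p \<partial>\<mu>\<^sub>g)
      = (\<integral>p. cutoff k p * flux_term \<eta> p \<partial>\<mu>\<^sub>g) + (\<integral>p. cutoff k p * flux_term \<theta> p \<partial>\<mu>\<^sub>g)"
      by (rule Bochner_Integration.integral_add[OF a(2) b(2)])
    have 2: "(\<integral>p. \<eta> p * (flux_norm p + \<epsilon>) + \<theta> p * (flux_norm p + \<epsilon>) \<partial>\<mu>\<^sub>g)
      = (\<integral>p. \<eta> p * (flux_norm p + \<epsilon>) \<partial>\<mu>\<^sub>g) + (\<integral>p. \<theta> p * (flux_norm p + \<epsilon>) \<partial>\<mu>\<^sub>g)"
      by (rule Bochner_Integration.integral_add[OF a(1) b(1)])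
    show "\<bar>\<integral>p. cutoff k p * flux_term \<eta> p + cutoff k p * flux_term \<theta> p \<partial>\<mu>\<^sub>g\<bar>
      \<le> (1 / k) * (\<integral>p. \<eta> p * (flux_norm p + \<epsilon>) + \<theta> p * (flux_norm p + \<epsilon>) \<partial>\<mu>\<^sub>g)"
      unfolding 1 2 distrib_left[of "1 / k"]
      by (rule order_trans[OF abs_triangle_ineq add_mono[OF a(3) b(3)]])
  qed
qed

text \<open>\<open>frozen_divergence_bound\<close> in a chart, with \<open>N\<close> the metric
  norm, \<open>s\<close> the volume density and \<open>f\<close> the cutoff in coordinates.\<close>

lemma flux_estimate_local:
  assumes k: "k > 0" and \<epsilon>: "\<epsilon> > 0"
  shows "\<exists>W. open W \<and> q \<in> W \<and> (\<forall>\<eta> K. C1_function \<eta> \<longrightarrow> (\<forall>p. 0 \<le> \<eta> p) \<longrightarrow> compact K \<longrightarrow> K \<subseteq> W \<longrightarrow>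
    (\<forall>p. p \<notin> K \<longrightarrow> \<eta> p = 0) \<longrightarrow> flux_estimate k \<epsilon> \<eta>)"
proof -
  define c where "c = chart_at A q"
  have c: "c \<in> A" "q \<in> fst c" using chart_at by (auto simp: c_def)
  let ?\<Omega> = "chart_image c"
  let ?s = "\<lambda>y. sqrt (det (g c y))"
  let ?R = "R \<circ> chart_inv c"
  \<comment> \<open>The volume density is part of the field, so that the coordinate divergence of
    \<eta> V is the density times the divergence of \<eta> R X.\<close>
  define V where "V y = (?R y * ?s y) *\<^sub>R X c y" for y
  have RC: "C1_on ?\<Omega> ?R" using R c(1) by (simp add: C1_function_def)
  have sC: "C1_on ?\<Omega> ?s" by (intro C1_on_sqrt C1_on_det metric_C1[OF c(1)] metric_det_pos[OF c(1)])
  have spos: "?s y > 0" if "y \<in> ?\<Omega>" for y using metric_det_pos[OF c(1) that] by simp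
  have Xc: "C1_on ?\<Omega> (X c)" by (rule vector_field_C1[OF X c(1)])
  have VC: "C1_on ?\<Omega> V"
  proof -
    have "V = (\<lambda>y. \<Sum>i\<in>UNIV. (?R y * ?s y * X c y $ i) *\<^sub>R axis i 1)"
      by (auto simp: fun_eq_iff V_def vec_eq_iff axis_def if_distrib cong: if_cong)
    moreover have "C1_on ?\<Omega> (\<lambda>y. \<Sum>i\<in>UNIV. (?R y * ?s y * X c y $ i) *\<^sub>R (axis i 1 :: real^'n))"
      by (intro C1_on_sum C1_on_bounded_linear[OF bounded_linear_scaleR_left] C1_on_mult RC sC C1_on_vec_nth Xc)
    ultimately show ?thesis by simp
  qed
  have gV: "gnorm c y (V y) = ?s y * (?R y * gnorm c y (X c y))" if "y \<in> ?\<Omega>" for y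
    using spos[OF that] R_nonneg by (simp add: V_def gnorm_scaleR)
  obtain r where r: "r > 0" "ball (snd c q) r \<subseteq> ?\<Omega>"
    and est: "\<And>K \<eta> f B L. \<lbrakk>compact K; K \<subseteq> ball (snd c q) r; C1_on UNIV \<eta>; \<And>x. \<eta> x \<ge> 0; \<And>x. x \<notin> K \<Longrightarrow> \<eta> x = 0;
      f \<in> borel_measurable borel; \<And>x. \<bar>f x\<bar> \<le> B; L \<ge> 0;
      \<And>v G x t. (\<forall>z\<in>ball (snd c q) r. gnorm c z v \<le> G) \<Longrightarrow> x \<in> ball (snd c q) r \<Longrightarrow> x + t *\<^sub>R v \<in> ball (snd c q) r
         \<Longrightarrow> \<bar>f (x + t *\<^sub>R v) - f x\<bar> \<le> L * G * \<bar>t\<bar>\<rbrakk> \<Longrightarrow>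
      integrable lborel (\<lambda>x. \<eta> x * (gnorm c x (V x) + \<epsilon> * ?s x)) \<and>
      integrable lborel (\<lambda>x. f x * (\<Sum>i\<in>UNIV. frechet_derivative (\<lambda>y. \<eta> y * V y $ i) (at x) (axis i 1))) \<and>
      \<bar>\<integral>x. f x * (\<Sum>i\<in>UNIV. frechet_derivative (\<lambda>y. \<eta> y * V y $ i) (at x) (axis i 1)) \<partial>lborel\<bar>
        \<le> L * (\<integral>x. \<eta> x * (gnorm c x (V x) + \<epsilon> * ?s x) \<partial>lborel)"
  proof (rule frozen_divergence_bound[of ?\<Omega> "snd c q" V "gnorm c" ?s \<epsilon>])
    show "open ?\<Omega>" by (rule open_chart_image[OF c(1)])
    show "snd c q \<in> ?\<Omega>" using c by simp
    show "C1_on ?\<Omega> V" by (rule VC)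
    show "continuous_on ?\<Omega> (\<lambda>x. gnorm c x v)" for v by (intro continuous_on_gnorm c continuous_intros) auto
    show "continuous_on ?\<Omega> (\<lambda>x. gnorm c x (V x))"
      by (intro continuous_on_gnorm c continuous_intros C1_on_imp_continuous_on[OF VC]) auto
    show "0 \<le> gnorm c x v" if "x \<in> ?\<Omega>" for x v by (rule gnorm_nonneg[OF c(1) that])
    show "continuous_on ?\<Omega> ?s" by (rule continuous_on_sqrt_det[OF c(1)])
  qed (use spos \<epsilon> in auto)
  let ?B = "ball (snd c q) r"
  let ?W = "chart_inv c ` ?B"
  have W: "open ?W" by (rule open_chart_inv_image[OF c(1) _ r(2)]) simp
  have qW: "q \<in> ?W" by (rule image_eqI[of _ _ "snd c q"]) (use c r in auto)
  define f where "f x = (if x \<in> ?B then cutoff k (chart_inv c x) else 0)" for x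
  have fm: "f \<in> borel_measurable borel"
  proof -
    have "(\<lambda>x. indicator ?B x *\<^sub>R cutoff k (chart_inv c x)) \<in> borel_measurable borel"
      by (intro borel_measurable_continuous_on_indicator continuous_on_compose2[OF continuous_on_cutoff[OF k]
          continuous_on_subset[OF continuous_on_chart_inv[OF c(1)] r(2)]]) auto
    moreover have "(\<lambda>x. indicator ?B x *\<^sub>R cutoff k (chart_inv c x)) = f" by (auto simp: f_def fun_eq_iff)
    ultimately show ?thesis by simp
  qed
  have fb: "\<bar>f x\<bar> \<le> 1" for x using cutoff_bounds[OF k] by (simp add: f_def)
  \<comment> \<open>The coordinate segment in direction \<open>v\<close> has length at most
    \<open>\<bar>t\<bar> * G\<close>, and the cutoff is 1/k-Lipschitz for the distance.\<close>
  have lip: "\<bar>f (x + t *\<^sub>R v) - f x\<bar> \<le> 1 / k * G * \<bar>t\<bar>"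
    if G: "\<forall>z\<in>?B. gnorm c z v \<le> G" and x: "x \<in> ?B" "x + t *\<^sub>R v \<in> ?B" for v G x t
  proof -
    have seg: "closed_segment x (x + t *\<^sub>R v) \<subseteq> ?B" by (rule closed_segment_subset[OF x convex_ball])
    have G0: "0 \<le> G" using G x(1) gnorm_nonneg[OF c(1), of x v] r(2) by (meson in_mono order_trans)
    have "riemannian_dist A g (chart_inv c x) (chart_inv c (x + t *\<^sub>R v)) \<le> ennreal (\<bar>t\<bar> * G)"
    proof (rule dist_segment_le[OF c(1)])
      show "closed_segment x (x + t *\<^sub>R v) \<subseteq> ?\<Omega>" using seg r(2) by blast
      fix z assume "z \<in> closed_segment x (x + t *\<^sub>R v)"
      then have "gnorm c z v \<le> G" using G seg by blast
      then show "gnorm c z (x + t *\<^sub>R v - x) \<le> \<bar>t\<bar> * G" by (simp add: gnorm_scaleR mult_left_mono)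
    qed
    from cutoff_lipschitz[OF k this] G0 x show ?thesis by (simp add: f_def mult.commute)
  qed
  have "flux_estimate k \<epsilon> \<eta>"
    if \<eta>: "C1_function \<eta>" and \<eta>0: "\<And>p. 0 \<le> \<eta> p" and K: "compact K" "K \<subseteq> ?W" and \<eta>K: "\<And>p. p \<notin> K \<Longrightarrow> \<eta> p = 0"
    for \<eta> K
  proof -
    \<comment> \<open>\<eta> in coordinates, continued by 0. Its support is compact inside the
      chart, so it is C1 on the whole space.\<close>
    define e where "e x = (if x \<in> ?\<Omega> then \<eta> (chart_inv c x) else 0)" for x
    let ?K = "snd c ` K"
    have Wc: "?W \<subseteq> fst c" using r(2) c(1) by (auto simp: subset_iff)
    then have Kc: "K \<subseteq> fst c" using K(2) by blast
    have K': "compact ?K"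
      by (rule compact_continuous_image[OF continuous_on_subset[OF continuous_on_chart[OF c(1)] Kc] K(1)])
    have "snd c ` ?W = ?B" using r(2) c(1) by (force simp: image_image subset_iff)
    then have K'B: "?K \<subseteq> ?B" using K(2) by blast
    have eK: "e x = 0" if "x \<notin> ?K" for x
    proof (cases "x \<in> ?\<Omega>")
      case True
      have "chart_inv c x \<notin> K" using that True c(1) by (metis imageI snd_chart_inv)
      then show ?thesis by (simp add: e_def \<eta>K)
    qed (simp add: e_def)
    have eC\<Omega>: "C1_on ?\<Omega> e"
      by (rule C1_on_cong[OF open_chart_image[OF c(1)], of "\<eta> \<circ> chart_inv c"]) (use \<eta> c in \<open>auto simp: C1_function_def e_def\<close>)
    have eC: "C1_on UNIV e"
      by (rule C1_on_extend_zero[OF open_chart_image[OF c(1)] eC\<Omega> K' _ eK]) (use K'B r(2) in auto)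
    have e0: "e x \<ge> 0" for x using \<eta>0 by (simp add: e_def)
    note E = est[OF K' K'B eC e0 eK fm fb _ lip]
    have div: "(\<Sum>i\<in>UNIV. frechet_derivative (\<lambda>y. e y * V y $ i) (at x) (axis i 1))
      = ?s x * flux_term \<eta> (chart_inv c x)" if x: "x \<in> ?\<Omega>" for x
    proof -
      let ?p = "chart_inv c x"
      have p: "?p \<in> fst c" "snd c ?p = x" using c(1) x by auto
      have ed: "(e has_derivative frechet_derivative (\<eta> \<circ> chart_inv c) (at x)) (at x)"
        by (rule has_derivative_transform_within_open[OF C1_function_has_derivative[OF \<eta> c(1) x] open_chart_image[OF c(1)] x])
          (simp add: e_def)
      have Rd: "(?R has_derivative frechet_derivative ?R (at x)) (at x)"
        by (rule C1_function_has_derivative[OF R c(1) x])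
      have ud: "((\<lambda>y. e y * ?R y) has_derivative (\<lambda>v. e x * frechet_derivative ?R (at x) v
          + frechet_derivative (\<eta> \<circ> chart_inv c) (at x) v * ?R x)) (at x)"
        by (rule has_derivative_mult[OF ed Rd])
      have "(\<lambda>y. e y * V y $ i) = (\<lambda>y. (e y * ?R y) * (?s y * X c y $ i))" for i
        by (simp add: V_def fun_eq_iff mult_ac)
      then have "(\<Sum>i\<in>UNIV. frechet_derivative (\<lambda>y. e y * V y $ i) (at x) (axis i 1))
        = (\<Sum>i\<in>UNIV. frechet_derivative (\<lambda>y. (e y * ?R y) * (?s y * X c y $ i)) (at x) (axis i 1))" by simp
      also have "\<dots> = ?s x * ((e x * ?R x) * (real CARD('n) * \<sigma> ?p) + frechet_derivative (\<lambda>y. e y * ?R y) (at x) (X c x))"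
        by (rule divergence_conformal[OF X c(1) x lie[OF c(1) x]]) (use ud in \<open>auto simp: differentiable_def\<close>)
      also have "frechet_derivative (\<lambda>y. e y * ?R y) (at x) (X c x)
        = e x * frechet_derivative ?R (at x) (X c x) + frechet_derivative (\<eta> \<circ> chart_inv c) (at x) (X c x) * ?R x"
        using fun_cong[OF frechet_derivative_at[OF ud], of "X c x"] by simp
      finally show ?thesis
        using x by (simp add: flux_term_def flux_div_def vderiv_eq[OF \<eta> X c(1) p(1)] vderiv_eq[OF R X c(1) p(1)]
            chart_deriv_def p(2) e_def algebra_simps)
    qed
    have termK: "flux_term \<eta> p = 0" if "p \<notin> K" for p
    proof -
      have "vderiv X \<eta> p = 0"
        by (rule vderiv_local[OF \<eta>, of "- K" _ 0]) (use that K(1) \<eta>K in \<open>auto simp: compact_imp_closed open_Compl\<close>)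
      then show ?thesis using \<eta>K[OF that] by (simp add: flux_term_def)
    qed
    have h1: "(\<lambda>p. \<eta> p * (flux_norm p + \<epsilon>)) \<in> borel_measurable borel"
      by (intro borel_measurable_continuous_onI continuous_intros C1_function_continuous[OF \<eta>] C1_function_continuous[OF R]
          continuous_on_metric_norm[OF X])
    have h2: "(\<lambda>p. cutoff k p * flux_term \<eta> p) \<in> borel_measurable borel"
      by (intro borel_measurable_continuous_onI continuous_intros continuous_on_cutoff[OF k] flux_term_continuous[OF \<eta>])
    \<comment> \<open>The density inside \<open>V\<close> and the weight \<open>?s\<close> next to
      \<epsilon> are exactly what turns the Lebesgue integrals into integrals against the Riemannian
      volume.\<close>
    have i1: "indicator ?\<Omega> x * (?s x * (\<eta> (chart_inv c x) * (flux_norm (chart_inv c x) + \<epsilon>)))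
      = e x * (gnorm c x (V x) + \<epsilon> * ?s x)" for x
      using c(1) by (cases "x \<in> ?\<Omega>") (simp_all add: e_def gV metric_norm_eq[OF X c(1)] algebra_simps)
    have i2: "indicator ?\<Omega> x * (?s x * (cutoff k (chart_inv c x) * flux_term \<eta> (chart_inv c x)))
      = f x * (\<Sum>i\<in>UNIV. frechet_derivative (\<lambda>y. e y * V y $ i) (at x) (axis i 1))" for x
    proof (cases "x \<in> ?B")
      case True
      then have "x \<in> ?\<Omega>" using r(2) by blast
      then show ?thesis using True by (simp add: div f_def)
    next
      case False
      have "flux_term \<eta> (chart_inv c x) = 0" if x: "x \<in> ?\<Omega>"
      proof (rule termK)
        show "chart_inv c x \<notin> K"
        proof
          assume "chart_inv c x \<in> K"
          then have "snd c (chart_inv c x) \<in> ?K" by (rule imageI)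
          then show False using K'B False x c(1) by auto
        qed
      qed
      then show ?thesis using False by (cases "x \<in> ?\<Omega>") (simp_all add: f_def)
    qed
    have s1: "\<eta> p * (flux_norm p + \<epsilon>) = 0" and s2: "cutoff k p * flux_term \<eta> p = 0" if "p \<notin> fst c" for p
      using that Kc \<eta>K[of p] termK[of p] by auto
    note A = integral_volume_chart[OF c(1) h1 s1, unfolded i1]
    note B = integral_volume_chart[OF c(1) h2 s2, unfolded i2]
    show ?thesis
      unfolding flux_estimate_def using E k A B by simp
  qed
  then show ?thesis using W qW by (intro exI[of _ ?W]) blast
qed

text \<open>The functions \<open>\<beta>\<^sub>j \<Prod>\<^bsub>i<j\<^esub> (1 - \<beta>\<^sub>i)\<close> built from finitely many bumps sum to \<open>1\<close> wherever some
  \<open>\<beta>\<^sub>i = 1\<close>; no division is needed.\<close>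

lemma flux_estimate_global:
  assumes k: "k > 0" and \<epsilon>: "\<epsilon> > 0" and K: "compact K" "K \<subseteq> N" and N: "open N"
  shows "\<exists>\<eta> U. C1_function \<eta> \<and> (\<forall>p. 0 \<le> \<eta> p \<and> \<eta> p \<le> 1) \<and> (\<forall>p. p \<notin> N \<longrightarrow> \<eta> p = 0) \<and>
    open U \<and> K \<subseteq> U \<and> (\<forall>p\<in>U. \<eta> p = 1) \<and> flux_estimate k \<epsilon> \<eta>"
proof -
  \<comment> \<open>All that is needed of a bump at \<open>q\<close>, in one predicate so that a
    single choice over \<open>K\<close> yields every family: the bump, the set \<open>V\<close>
    where it is 1, and a support \<open>C\<close> small enough for the local estimate.\<close>
  define good where "good q \<beta> V C \<longleftrightarrow> C1_function \<beta> \<and> (\<forall>p. 0 \<le> \<beta> p \<and> \<beta> p \<le> 1) \<and>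
    (\<forall>p. p \<notin> C \<longrightarrow> \<beta> p = 0) \<and> C \<subseteq> N \<and> open V \<and> q \<in> V \<and> (\<forall>p\<in>V. \<beta> p = 1) \<and>
    (\<forall>\<eta>. C1_function \<eta> \<longrightarrow> (\<forall>p. 0 \<le> \<eta> p) \<longrightarrow> (\<forall>p. p \<notin> C \<longrightarrow> \<eta> p = 0) \<longrightarrow> flux_estimate k \<epsilon> \<eta>)"
    for q \<beta> V C
  have "\<forall>q\<in>K. \<exists>\<beta> V C. good q \<beta> V C"
  proof
    fix q assume "q \<in> K"
    obtain W where W: "open W" "q \<in> W" and est: "\<And>\<eta> K. C1_function \<eta> \<Longrightarrow> (\<forall>p. 0 \<le> \<eta> p) \<Longrightarrow> compact K \<Longrightarrow> K \<subseteq> W \<Longrightarrow>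
      (\<forall>p. p \<notin> K \<longrightarrow> \<eta> p = 0) \<Longrightarrow> flux_estimate k \<epsilon> \<eta>"
      using flux_estimate_local[OF k \<epsilon>, of q] by blast
    have "open (W \<inter> N)" "q \<in> W \<inter> N" using W N K(2) \<open>q \<in> K\<close> by auto
    from bump_function[OF this] obtain \<beta> C V where b: "C1_function \<beta>" "\<forall>p. 0 \<le> \<beta> p \<and> \<beta> p \<le> 1" "compact C" "C \<subseteq> W \<inter> N"
      "\<forall>p. p \<notin> C \<longrightarrow> \<beta> p = 0" "open V" "q \<in> V" "\<forall>p\<in>V. \<beta> p = 1" by blast
    have C: "C \<subseteq> W" "C \<subseteq> N" using b(4) by auto
    have "good q \<beta> V C"
      unfolding good_def by (intro conjI allI impI b C est[OF _ _ b(3) C(1)]) auto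
    then show "\<exists>\<beta> V C. good q \<beta> V C" by blast
  qed
  then obtain \<beta> V C where good: "\<And>q. q \<in> K \<Longrightarrow> good q (\<beta> q) (V q) (C q)" by metis
  have b: "C1_function (\<beta> q)" "0 \<le> \<beta> q p \<and> \<beta> q p \<le> 1" "p \<notin> C q \<Longrightarrow> \<beta> q p = 0" "C q \<subseteq> N"
    and V: "open (V q)" "q \<in> V q" "p \<in> V q \<Longrightarrow> \<beta> q p = 1"
    and est: "C1_function \<eta> \<Longrightarrow> (\<forall>p. 0 \<le> \<eta> p) \<Longrightarrow> (\<forall>p. p \<notin> C q \<longrightarrow> \<eta> p = 0) \<Longrightarrow> flux_estimate k \<epsilon> \<eta>"
    if "q \<in> K" for q p \<eta>
    using good[OF that] unfolding good_def by simp_all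
  have Kcover: "K \<subseteq> (\<Union>q\<in>K. V q)" using V(2) by blast
  obtain P where P: "P \<subseteq> K" "finite P" "K \<subseteq> (\<Union>q\<in>P. V q)"
    by (rule compactE_image[OF K(1) V(1) Kcover])
  have "\<exists>\<eta>. C1_function \<eta> \<and> (\<forall>p. 0 \<le> \<eta> p \<and> \<eta> p \<le> 1) \<and> (\<forall>p. p \<notin> N \<longrightarrow> \<eta> p = 0) \<and>
    (\<forall>p\<in>(\<Union>q\<in>P. V q). \<eta> p = 1) \<and> flux_estimate k \<epsilon> \<eta>"
    using P(2,1)
  proof (induction P rule: finite_induct)
    case empty
    have "vderiv X (\<lambda>p. 0) p = 0" for p
      by (rule vderiv_local[OF C1_function_const, of UNIV _ _ 0]) auto
    then have "flux_estimate k \<epsilon> (\<lambda>p. 0)" by (simp add: flux_estimate_def flux_term_def)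
    then show ?case by (intro exI[of _ "\<lambda>p. 0"]) (auto simp: C1_function_const)
  next
    case (insert q P)
    then have q: "q \<in> K" by simp
    obtain \<eta> where \<eta>: "C1_function \<eta>" "\<And>p. 0 \<le> \<eta> p \<and> \<eta> p \<le> 1" "\<And>p. p \<notin> N \<Longrightarrow> \<eta> p = 0"
      "\<And>p. p \<in> (\<Union>q\<in>P. V q) \<Longrightarrow> \<eta> p = 1" "flux_estimate k \<epsilon> \<eta>"
      using insert by blast
    \<comment> \<open>\<open>1 - \<eta>\<close> is the product of the factors 1 - \<beta> of the
      earlier bumps. The new term inherits the support of \<open>\<beta> q\<close>, so the local
      estimate applies to it.\<close>
    let ?\<theta> = "\<lambda>p. (1 - \<eta> p) * \<beta> q p"
    have \<theta>: "C1_function ?\<theta>" by (intro C1_function_mult C1_function_diff C1_function_const \<eta> b q)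
    have "flux_estimate k \<epsilon> ?\<theta>"
      by (rule est[OF q \<theta>]) (use \<eta>(2) b(2,3)[OF q] in auto)
    from flux_estimate_add[OF \<eta>(1) \<theta> \<eta>(5) this] have "flux_estimate k \<epsilon> (\<lambda>p. \<eta> p + ?\<theta> p)" .
    moreover have "0 \<le> \<eta> p + ?\<theta> p \<and> \<eta> p + ?\<theta> p \<le> 1" for p
    proof -
      have "0 \<le> ?\<theta> p" "?\<theta> p \<le> (1 - \<eta> p) * 1"
        using \<eta>(2)[of p] b(2)[OF q, of p] by (auto intro!: mult_left_mono mult_nonneg_nonneg simp del: mult_1_right)
      then show ?thesis using \<eta>(2)[of p] by auto
    qed
    moreover have "\<eta> p + ?\<theta> p = 0" if "p \<notin> N" for p
      using \<eta>(3)[OF that] b(3)[OF q, of p] b(4)[OF q] that by auto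
    moreover have "\<eta> p + ?\<theta> p = 1" if "p \<in> (\<Union>q\<in>insert q P. V q)" for p
    proof (cases "p \<in> V q")
      case True
      then show ?thesis using V(3)[OF q] by simp
    next
      case False
      then show ?thesis using \<eta>(4)[of p] that by auto
    qed
    ultimately show ?case
      by (intro exI[of _ "\<lambda>p. \<eta> p + ?\<theta> p"] conjI allI impI ballI C1_function_add \<eta>(1) \<theta>) blast+
  qed
  then obtain \<eta> where \<eta>: "C1_function \<eta>" "\<forall>p. 0 \<le> \<eta> p \<and> \<eta> p \<le> 1" "\<forall>p. p \<notin> N \<longrightarrow> \<eta> p = 0"
    "\<forall>p\<in>(\<Union>q\<in>P. V q). \<eta> p = 1" "flux_estimate k \<epsilon> \<eta>" by blast
  have "open (\<Union>q\<in>P. V q)" using V(1) P(1) by blast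
  with \<eta> P(3) show ?thesis by (intro exI[of _ \<eta>] exI[of _ "\<Union>q\<in>P. V q"] conjI)
qed

text \<open>The partition function \<eta> is 1 near the support of the cutoff. There its derivative
  along \<open>X\<close> vanishes and \<open>flux_term\<close> reduces to the divergence
  itself.\<close>

lemma flux_div_integral_bound:
  assumes k: "k > 0" and complete: "riemannian_complete A g" and int: "integrable \<mu>\<^sub>g flux_norm"
  shows "integrable \<mu>\<^sub>g (\<lambda>p. cutoff k p * flux_div p)"
    and "(\<integral>p. cutoff k p * flux_div p \<partial>\<mu>\<^sub>g) \<le> (1 / k) * ((\<integral>p. flux_norm p \<partial>\<mu>\<^sub>g) + 1)"
proof -
  have K: "compact (mcball p0 k)" by (rule compact_mcball[OF complete])
  obtain N where N: "open N" "mcball p0 k \<subseteq> N" "emeasure \<mu>\<^sub>g N < \<infinity>" using finite_volume_nhd_compact[OF K] by blast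
  have Ns: "N \<in> sets \<mu>\<^sub>g" using N(1) by (simp add: sets_volume)
  define m where "m = measure \<mu>\<^sub>g N"
  \<comment> \<open>\<open>m + 1\<close> instead of \<open>m\<close> avoids division by a possibly
    vanishing volume and still gives \<open>\<epsilon> * m \<le> 1\<close>.\<close>
  define \<epsilon> where "\<epsilon> = 1 / (m + 1)"
  have m: "m \<ge> 0" by (simp add: m_def)
  then have \<epsilon>: "\<epsilon> > 0" "\<epsilon> * m \<le> 1" by (auto simp: \<epsilon>_def)
  obtain \<eta> U where \<eta>: "C1_function \<eta>" "\<forall>p. 0 \<le> \<eta> p \<and> \<eta> p \<le> 1" "\<forall>p. p \<notin> N \<longrightarrow> \<eta> p = 0"
    and U: "open U" "mcball p0 k \<subseteq> U" "\<forall>p\<in>U. \<eta> p = 1" and est: "flux_estimate k \<epsilon> \<eta>"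
    using flux_estimate_global[OF k \<epsilon>(1) K N(2,1)] by blast
  have eq: "cutoff k p * flux_term \<eta> p = cutoff k p * flux_div p" for p
  proof (cases "p \<in> mcball p0 k")
    case True
    then have "p \<in> U" using U(2) by blast
    then have "vderiv X \<eta> p = 0" using U(3) by (intro vderiv_local[OF \<eta>(1) U(1), of p 1]) auto
    then show ?thesis using U(3) \<open>p \<in> U\<close> by (simp add: flux_term_def)
  next
    case False
    from cutoff_support[OF k this] show ?thesis by simp
  qed
  note e = est[unfolded flux_estimate_def eq]
  show "integrable \<mu>\<^sub>g (\<lambda>p. cutoff k p * flux_div p)" using e by (rule conjunct1[OF conjunct2])
  have "\<bar>\<integral>p. cutoff k p * flux_div p \<partial>\<mu>\<^sub>g\<bar> \<le> (1 / k) * (\<integral>p. \<eta> p * (flux_norm p + \<epsilon>) \<partial>\<mu>\<^sub>g)"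
    using e by (rule conjunct2[OF conjunct2])
  then have "(\<integral>p. cutoff k p * flux_div p \<partial>\<mu>\<^sub>g) \<le> (1 / k) * (\<integral>p. \<eta> p * (flux_norm p + \<epsilon>) \<partial>\<mu>\<^sub>g)"
    by (rule order_trans[OF abs_ge_self])
  also have "\<dots> \<le> (1 / k) * ((\<integral>p. flux_norm p \<partial>\<mu>\<^sub>g) + 1)"
  proof (rule mult_left_mono)
    have iN: "integrable \<mu>\<^sub>g (\<lambda>p. \<epsilon> * indicator N p)"
      using Ns N(3) by (intro integrable_mult_right integrable_real_indicator) auto
    have "(\<integral>p. \<eta> p * (flux_norm p + \<epsilon>) \<partial>\<mu>\<^sub>g) \<le> (\<integral>p. flux_norm p + \<epsilon> * indicator N p \<partial>\<mu>\<^sub>g)"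
    proof (rule integral_mono[OF conjunct1[OF e] Bochner_Integration.integrable_add[OF int iN]])
      fix p
      have fn: "0 \<le> flux_norm p" using R_nonneg metric_norm_nonneg[OF X] by simp
      show "\<eta> p * (flux_norm p + \<epsilon>) \<le> flux_norm p + \<epsilon> * indicator N p"
      proof (cases "p \<in> N")
        case True
        have "\<eta> p * (flux_norm p + \<epsilon>) \<le> 1 * (flux_norm p + \<epsilon>)"
          using \<eta>(2) fn \<epsilon>(1) by (intro mult_right_mono) auto
        then show ?thesis using True by simp
      qed (use \<eta>(3) fn in simp)
    qed
    also have "\<dots> = (\<integral>p. flux_norm p \<partial>\<mu>\<^sub>g) + \<epsilon> * m"
      unfolding Bochner_Integration.integral_add[OF int iN] using Ns by (simp add: m_def)
    finally show "(\<integral>p. \<eta> p * (flux_norm p + \<epsilon>) \<partial>\<mu>\<^sub>g) \<le> (\<integral>p. flux_norm p \<partial>\<mu>\<^sub>g) + 1" using \<epsilon>(2) by linarith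
  qed (use k in simp)
  finally show "(\<integral>p. cutoff k p * flux_div p \<partial>\<mu>\<^sub>g) \<le> (1 / k) * ((\<integral>p. flux_norm p \<partial>\<mu>\<^sub>g) + 1)" .
qed

text \<open>A positive value at \<open>p0\<close> persists on an open set of positive volume. This
  bounds the integrals against the cutoffs from below, uniformly in \<open>k \<ge> 2\<close>, while
  their upper bound is of order 1 / k.\<close>

lemma flux_div_eq_0:
  assumes complete: "riemannian_complete A g" and int: "integrable \<mu>\<^sub>g flux_norm"
    and nonneg: "\<And>p. flux_div p \<ge> 0"
  shows "flux_div p0 = 0"
proof (rule ccontr)
  assume "flux_div p0 \<noteq> 0"
  define D where "D = flux_div p0"
  have D: "D > 0" using nonneg[of p0] \<open>flux_div p0 \<noteq> 0\<close> by (simp add: D_def)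
  obtain N where N: "open N" "p0 \<in> N" "emeasure \<mu>\<^sub>g N < \<infinity>" using finite_volume_nhd by blast
  \<comment> \<open>On the unit ball the cutoff is at least 1/2 once \<open>k \<ge> 2\<close>, and
    the divergence exceeds D/2, whence the constant D/4 below. \<open>N\<close> makes the volume
    finite.\<close>
  define U where "U = N \<inter> mball p0 1 \<inter> {p. flux_div p > D / 2}"
  have "open {p. flux_div p > D / 2}"
    using open_Collect_less[OF continuous_on_const[of UNIV "D / 2"] continuous_on_flux_div] .
  moreover have "open (mball p0 1)" using openin_mball openin_mtopology_iff by blast
  ultimately have U: "open U" using N(1) by (auto simp: U_def)
  have p0U: "p0 \<in> U" using N(2) D base_in_component by (simp add: U_def D_def)
  have Us: "U \<in> sets \<mu>\<^sub>g" using U by (simp add: sets_volume)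
  have "emeasure \<mu>\<^sub>g U \<le> emeasure \<mu>\<^sub>g N" using N(1) by (intro emeasure_mono) (auto simp: U_def sets_volume)
  then have fin: "emeasure \<mu>\<^sub>g U < \<infinity>" using N(3) by (rule order.strict_trans1)
  have "emeasure \<mu>\<^sub>g U > 0" using volume_open_pos[OF U] p0U by blast
  then have mU: "measure \<mu>\<^sub>g U > 0" using fin by (simp add: measure_def enn2real_positive_iff)
  define I where "I = (\<integral>p. flux_norm p \<partial>\<mu>\<^sub>g)"
  define a where "a = D / 4 * measure \<mu>\<^sub>g U"
  have a: "a > 0" using D mU by (simp add: a_def)
  \<comment> \<open>Large enough for \<open>a * k \<ge> I + 2\<close>, against the upper bound
    \<open>I + 1\<close>.\<close>
  define k where "k = max 2 ((I + 2) / a)"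
  have k: "k \<ge> 2" "k > 0" "(I + 2) / a \<le> k" by (auto simp: k_def)
  have "a = (\<integral>p. D / 4 * indicator U p \<partial>\<mu>\<^sub>g)" using Us by (simp add: a_def)
  also have "\<dots> \<le> (\<integral>p. cutoff k p * flux_div p \<partial>\<mu>\<^sub>g)"
  proof (rule integral_mono)
    show "integrable \<mu>\<^sub>g (\<lambda>p. D / 4 * indicator U p)"
      using Us fin by (intro integrable_mult_right integrable_real_indicator) auto
    show "integrable \<mu>\<^sub>g (\<lambda>p. cutoff k p * flux_div p)" by (rule flux_div_integral_bound(1)[OF k(2) complete int])
    fix p
    show "D / 4 * indicator U p \<le> cutoff k p * flux_div p"
    proof (cases "p \<in> U")
      case True
      then have p: "p \<in> component" "rdist p0 p \<le> 1" "D / 2 \<le> flux_div p" by (auto simp: U_def)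
      have "rdist p0 p / k \<le> 1 / 2" using p(2) k(1,2) by (simp add: divide_le_eq)
      then have "1 / 2 \<le> cutoff k p" unfolding cutoff_def if_P[OF p(1)] by linarith
      then have "1 / 2 * (D / 2) \<le> cutoff k p * flux_div p" using p(3) D by (intro mult_mono) auto
      then show ?thesis using True by simp
    qed (use nonneg cutoff_bounds[OF k(2)] in simp)
  qed
  also have "\<dots> \<le> (1 / k) * (I + 1)" unfolding I_def by (rule flux_div_integral_bound(2)[OF k(2) complete int])
  finally have "a * k \<le> I + 1" using k(2) by (simp add: field_simps)
  moreover have "I + 2 \<le> a * k" using k(3) a by (simp add: divide_le_eq mult.commute)
  ultimately show False by simp
qed

end

theorem theorem1p3:
  fixes A :: "('m::{t2_space,second_countable_topology}, 'n::finite) chart set"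
    and g :: "('m, 'n) tensor2"
    and X :: "('m, 'n) vfield"
    and \<rho> :: "'m \<Rightarrow> real"
  assumes "almost_yamabe_soliton A g X \<rho>"
    and "riemannian_complete A g"
    and "\<not> compact (UNIV :: 'm set)"
    and "CARD('n) \<ge> 3"
    and "\<And>p. 0 \<le> \<rho> p \<and> \<rho> p \<le> scalar_curvature A g p"
    and "\<And>p. metric_inner A g X (gradient g (scalar_curvature A g)) p \<ge> 0"
    and "square_integrable (riemannian_volume A g)
           (\<lambda>p. scalar_curvature A g p + metric_norm A g X p)"
  shows "killing_field A g X"
proof -
  let ?R = "scalar_curvature A g"
  let ?\<sigma> = "\<lambda>p. ?R p - \<rho> p"
  interpret riemannian_manifold A g
    using assms(1) by unfold_locales (auto simp: almost_yamabe_soliton_def)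
  have X: "smooth_vector_field A X" using assms(1) by (simp add: almost_yamabe_soliton_def)
  have lie: "lie_derivative X g c x = (2 * ?\<sigma> (chart_inv c x)) *\<^sub>R g c x" if "c \<in> A" "x \<in> chart_image c" for c x
  proof -
    have "(1/2) *\<^sub>R lie_derivative X g c x = ?\<sigma> (chart_inv c x) *\<^sub>R g c x"
      using assms(1) that unfolding almost_yamabe_soliton_def by blast
    then have "2 *\<^sub>R ((1/2) *\<^sub>R lie_derivative X g c x) = 2 *\<^sub>R (?\<sigma> (chart_inv c x) *\<^sub>R g c x)" by simp
    then show ?thesis by simp
  qed
  \<comment> \<open>\<open>scalar_curvature\<close> is evaluated in the charts picked by
    \<open>chart_at\<close>, so its regularity in a fixed chart cannot be read off its formula; it
    is obtained from \<open>?\<sigma>\<close> and \<open>\<rho>\<close>.\<close>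
  have \<sigma>C: "C1_on (chart_image c) (\<lambda>x. ?\<sigma> (chart_inv c x))" if "c \<in> A" for c
    by (rule conformal_factor_C1[OF X that]) (rule lie[OF that])
  have R: "C1_function ?R"
    unfolding C1_function_def
  proof
    fix c assume c: "c \<in> A"
    have "smooth_on (chart_image c) (\<rho> \<circ> chart_inv c)"
      using assms(1) c by (simp add: almost_yamabe_soliton_def smooth_function_def)
    from C1_on_add[OF \<sigma>C[OF c] smooth_on_imp_C1_on[OF this]]
    show "C1_on (chart_image c) (?R \<circ> chart_inv c)" by (simp add: o_def)
  qed
  have R0: "?R p \<ge> 0" and \<sigma>0: "?\<sigma> p \<ge> 0" for p using assms(5)[of p] by auto
  have "?\<sigma> p = 0" for p
  proof -
    \<comment> \<open>The base point is the arbitrary point \<open>p\<close> itself, so every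
      component is reached.\<close>
    interpret conformal_vector_field A g p X ?\<sigma> ?R
      by unfold_locales (use X R R0 lie in auto)
    have vd: "vderiv X ?R q \<ge> 0" for q
      using assms(6)[of q] metric_inner_gradient[OF R X chart_at[of q]] by (simp add: vderiv_def)
    have nn: "0 \<le> flux_div q" for q
      unfolding flux_div_def using R0 \<sigma>0 vd by (intro add_nonneg_nonneg mult_nonneg_nonneg) auto
    have sq: "integrable \<mu>\<^sub>g (\<lambda>p. (?R p + metric_norm A g X p)\<^sup>2)"
      using assms(7) by (simp add: square_integrable_def)
    have int: "integrable \<mu>\<^sub>g flux_norm"
    proof (rule Bochner_Integration.integrable_bound[OF sq])
      have "flux_norm \<in> borel_measurable borel" by (rule borel_measurable_continuous_onI[OF continuous_on_flux_norm])
      then show "flux_norm \<in> borel_measurable \<mu>\<^sub>g" by (simp add: measurable_cong_sets[OF sets_volume refl])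
      show "AE q in \<mu>\<^sub>g. norm (flux_norm q) \<le> norm ((?R q + metric_norm A g X q)\<^sup>2)"
      proof (rule AE_I2)
        fix q
        have "0 \<le> ?R q" "0 \<le> metric_norm A g X q" using R0 metric_norm_nonneg[OF X] by auto
        then show "norm (flux_norm q) \<le> norm ((?R q + metric_norm A g X q)\<^sup>2)"
          by (simp add: power2_eq_square algebra_simps)
      qed
    qed
    have "flux_div p = 0" by (rule flux_div_eq_0[OF assms(2) int nn])
    moreover have "0 \<le> ?R p * (real CARD('n) * ?\<sigma> p)" using R0 \<sigma>0 by simp
    ultimately have "?R p * (real CARD('n) * ?\<sigma> p) = 0" using vd[of p] unfolding flux_div_def by linarith
    then have "?R p = 0 \<or> ?\<sigma> p = 0" by simp
    \<comment> \<open>Where the curvature vanishes, \<open>\<rho>\<close> is squeezed to 0, so the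
      difference is 0 in that case too.\<close>
    then show "?\<sigma> p = 0" using assms(5)[of p] by auto
  qed
  then show ?thesis unfolding killing_field_def using lie by simp
qed

end
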